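(* Consider the St-SoPro iteration $(\mathbf{x}^k,\mathbf{q}^k)_{k\ge 0}$ for the consensus problem described in the context, and suppose Assumption 1 and Assumption 2 (both stated in the context) hold. If there is $\eta_s\in(0,1)$ such that $$D \succ \frac{\Lambda_{M}}{2(1-\eta_s)}+\frac{(\Lambda_{M}-\Lambda_{m})^{2}}{8 \eta_s m_{\beta}} +\frac{\Lambda_{M}-3\Lambda_{m}}{2} + \beta\Big(\frac{I_{Nd}}{2}+ W\Big),$$ then $\mathbf{z}^k$ converges linearly to a neighborhood of $\mathbf{z}^\star$ in expectation, i.e., there exist $\delta_s\in(0,1)$ and $\Gamma>0$ such that for each $k\ge 0$, $$\mathbf{E}\big[\|\mathbf{z}^{k+1}-\mathbf{z}^{\star}\|_{Q}^{2}\big]\le(1-\delta_s)\,\mathbf{E}\big[\|\mathbf{z}^{k}-\mathbf{z}^{\star}\|_{Q}^{2}\big]+\Gamma N \tau \sigma^2,$$ and $$\limsup_{k \rightarrow \infty}\mathbf{E}\big[\|\mathbf{z}^{k}-\mathbf{z}^{\star}\|_{Q}^{2} \big]\leq \frac{1}{\delta_s}\Gamma N \tau \sigma^2 .$$ In particular, given any $c_1>0$, one can take $\Gamma = \frac{2(1+ c_{1}) \delta_s }{\lambda_{W}}+2$ and $$\delta_s= \sup_{c_{2}>0} \min \left\{\frac{\beta \lambda_{W} \kappa_{c_0, \eta_s}}{2(1+c_{1})\|\Lambda_{M}+D\|^{2}},\ \frac{1-\eta_s}{(1+1 / c_{1})(1+c_{2})},\ \frac{2 \eta_s m_{\beta}-c_0}{\lambda_{\max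 }\big(R+(1+1 / c_{1})(1+1 / c_{2}) \Lambda_{M}^{2} /(\beta \lambda_{W})\big)}\right\},$$ where $c_0\in(0,2\eta_s m_\beta)$ is such that $$\kappa_{c_0,\eta_s}:=\lambda_{\min}\Big(R-\frac{\Lambda_{M}}{2(1-\eta_s)}-\frac{(\Lambda_{M}-\Lambda_{m})^{2}}{4 c_0}+\Lambda_{m}-\Lambda_{M}-\beta\big(\tfrac{I_{N d}}{2}+W\big)\Big)>0$$ (such a $c_0$ always exists).
   Context: Notation: $\|\cdot\|$ is the $\ell_2$ norm (spectral norm for matrices); $\|\mathbf{x}\|_A^2:=\mathbf{x}^TA\mathbf{x}$; $\succ,\succeq$ are the Loewner orders; $\otimes$ is the Kronecker product; $A^\dagger$ is the pseudoinverse; $\lambda_{\max},\lambda_{\min}$ are the largest/smallest eigenvalues. Problem. $(\mathcal V,\mathcal E)$ is a connected undirected graph with $\mathcal V=\{1,\dots,N\}$; $\mathcal N_i$ is the set of neighbors of $i$. Agent $i$ observes $\mathcal C$ samples $\xi_{i,1},\dots,\xi_{i,\mathcal C}\in\mathbb R^m$, which are independent random vectors, with sample losses $l_{i,j}(\cdot,\xi_{i,j}):\mathbb R^d\to\mathbb R$ and local loss $f_i(x)=\frac1{\mathcal C}\sum_{j=1}^{\mathcal C} l_{i,j}(x,\xi_{i,j})$. The problem is to minimize $\sum_{i\in\mathcal V} f_i(x_i)$ over $x_1,\dots,x_N\in\mathbb R^d$ subject to $x_1=\dots=x_N$. For $\mathbf{x}=(x_1^T,\dots,x_N^T)^T\in\mathbb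 R^{Nd}$ put $f(\mathbf{x})=\sum_i f_i(x_i)$. Assumption 1. (a) There is an optimal solution $x^\star\in\mathbb R^d$, and the global objective $\bar f(x)=\sum_{i}f_i(x)$ is globally restricted strongly convex with respect to $x^\star$ with convexity parameter $m_{\bar f}>0$, i.e. $\langle\nabla\bar f(x)-\nabla\bar f(x^\star),x-x^\star\rangle\ge m_{\bar f}\|x-x^\star\|^2$ for all $x\in\mathbb R^d$. (b) For any given $\xi_{i,j}$, $l_{i,j}(\cdot,\xi_{i,j})$ is twice continuously differentiable and convex. (c) There is $M_i>0$ such that $l_{i,j}(\cdot,\xi_{i,j})$ is $M_i$-smooth (its gradient is $M_i$-Lipschitz) for all $\xi_{i,j}$. Consequently $m_iI_d\preceq\nabla^2 l_{i,j}(x,\xi_{i,j})\preceq M_iI_d$ for some $m_i\in[0,M_i]$, and $x^\star$ is unique; let $\mathbf{x}^\star=((x^\star)^T,\dots,(x^\star)^T)^T$. Assumption 2. The random vectors $\xi_{i,j}$ ($i\in\mathcal V$, $j=1,\dots,\mathcal C$) are independent and there is some $\sigma>0$ such that $\mathbf E_{\xi_{i,j}}[\|\nabla l_{i,j}(x_i,\xi_{i,j})-\nabla f_i(x_i)\|^2]\le\sigma^2$ for all $x_i\in\mathbb R^d$. Weight matrix. $p_{ij}=p_{ji}>0$ for $\{i,j\}\in\mathcal E$; $P\in\mathbb R^{N\times N}$ has $[P]_{ii}=\sum_{s\in\mathcal N_i}p_{is}$, $[P]_{ij}=-p_{ij}$ for $j\in\mathcal N_i$, and $0$ otherwise; $W=P\otimes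 I_d$. $\lambda_W$ is the smallest nonzero eigenvalue of $W$. Algorithm (St-SoPro). Parameters: $\beta>0$ and a symmetric block-diagonal matrix $D=\operatorname{diag}(D_1,\dots,D_N)$, $D_i\in\mathbb R^{d\times d}$. Start from arbitrary $\mathbf{x}^0\in\mathbb R^{Nd}$ and $\mathbf{q}^0=((q_1^0)^T,\dots,(q_N^0)^T)^T$ with $\sum_i q_i^0=\mathbf 0_d$. At each iteration $k\ge0$ each agent $i$ chooses two independent random sample sets $\mathcal G_i^k,\mathcal S_i^k$ uniformly from $\{1,\dots,\mathcal C\}$ without replacement, with $|\mathcal G_i^k|=\mathcal G$ for all $i,k$, and sets $g_i(x_i^k)=\frac1{|\mathcal G_i^k|}\sum_{j\in\mathcal G_i^k}\nabla l_{i,j}(x_i^k,\xi_{i,j})$, $h_i(x_i^k)=\frac1{|\mathcal S_i^k|}\sum_{j\in\mathcal S_i^k}\nabla^2 l_{i,j}(x_i^k,\xi_{i,j})$, which are unbiased estimates of $\nabla f_i(x_i^k)$ and $\nabla^2 f_i(x_i^k)$. With $g(\mathbf{x}^k)$ the stacked vector of the $g_i(x_i^k)$ and $h(\mathbf{x}^k)=\operatorname{diag}(h_1(x_1^k),\dots,h_N(x_N^k))$, the iteration is $$\mathbf{x}^{k+1}=\mathbf{x}^k-(h(\mathbf{x}^k)+D)^{-1}(g(\mathbf{x}^k)+\beta W\mathbf{x}^k+\mathbf{q}^k),\qquad \mathbf{q}^{k+1}=\mathbf{q}^k+\beta W\mathbf{x}^{k+1}.$$ (The condition on $D$ in the claim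 ensures that $h(\mathbf{x}^k)+D$ is positive definite.) $\mathbf{E}$ denotes expectation over the random sample sets $\mathcal G_i^k,\mathcal S_i^k$. Derived quantities. $\tau:=\frac{\mathcal C-\mathcal G}{\mathcal C\,\mathcal G}$. $\Lambda_m=\operatorname{diag}(m_1,\dots,m_N)\otimes I_d$, $\Lambda_M=\operatorname{diag}(M_1,\dots,M_N)\otimes I_d$, $M=\max_i M_i$. $m_\beta>0$ is the maximum over $\gamma>0$ of $\zeta(\gamma)=\min\{\frac{m_{\bar f}}N-2M\gamma,\ \beta\frac{\lambda_W}{2(1+1/\gamma^2)}\}$. $R=\frac{\Lambda_m+\Lambda_M}2+D$ and $Q=\operatorname{diag}(\beta R,I_{Nd})$ (positive definite under the condition on $D$). $\mathbf{v}^k=(W^\dagger)^{1/2}\mathbf{q}^k$, $\mathbf{v}^\star=-(W^\dagger)^{1/2}\nabla f(\mathbf{x}^\star)$, $\mathbf{z}^k=((\mathbf{x}^k)^T,(\mathbf{v}^k)^T)^T$, $\mathbf{z}^\star=((\mathbf{x}^\star)^T,(\mathbf{v}^\star)^T)^T$.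
   Formalization: Assumption 2 is replaced: for the observed data, the sample variance of the gradients ∇l_ij about ∇f_i, normalised by 1/(C−1), is at most σ² for all x. With the printed bound in expectation over ξ_ij, the explicit constants fail (e.g. N=2, d=1, C=2, G=1). *)

theory Defs
  imports "HOL-Probability.Probability"
begin

section \<open>Matrices\<close>

definition symmetric :: "real^'a^'a \<Rightarrow> bool" where
  "symmetric A \<longleftrightarrow> transpose A = A"

definition quad :: "real^'a^'a \<Rightarrow> real^'a \<Rightarrow> real" where
  "quad A x = x \<bullet> (A *v x)"

definition psd :: "real^'a^'a \<Rightarrow> bool" where
  "psd A \<longleftrightarrow> symmetric A \<and> (\<forall>x. quad A x \<ge> 0)"

definition pd :: "real^'a^'a \<Rightarrow> bool" where
  "pd A \<longleftrightarrow> symmetric A \<and> (\<forall>x. x \<noteq> 0 \<longrightarrow> quad A x > 0)"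

definition loewner_le :: "real^'a^'a \<Rightarrow> real^'a^'a \<Rightarrow> bool"  (infix \<open>\<preceq>\<^sub>L\<close> 50) where
  "A \<preceq>\<^sub>L B \<longleftrightarrow> psd (B - A)"

definition loewner_less :: "real^'a^'a \<Rightarrow> real^'a^'a \<Rightarrow> bool"  (infix \<open>\<prec>\<^sub>L\<close> 50) where
  "A \<prec>\<^sub>L B \<longleftrightarrow> pd (B - A)"

definition eigenvalues :: "real^'a^'a \<Rightarrow> real set" where
  "eigenvalues A = {c. \<exists>v. v \<noteq> 0 \<and> A *v v = c *\<^sub>R v}"

text \<open>The next three are used for symmetric matrices only; those have finitely many
  eigenvalues, all of them real, and at least one.\<close>

definition lambda_max :: "real^'a^'a \<Rightarrow> real" where
  "lambda_max A = Max (eigenvalues A)"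

definition lambda_min :: "real^'a^'a \<Rightarrow> real" where
  "lambda_min A = Min (eigenvalues A)"

definition lambda_min_nonzero :: "real^'a^'a \<Rightarrow> real" where
  "lambda_min_nonzero A = Min (eigenvalues A - {0})"

text \<open>\<open>norm\<close> on the type of matrices is the Frobenius norm, hence the operator norm here.\<close>

definition spectral_norm :: "real^'a^'b \<Rightarrow> real" where
  "spectral_norm A = onorm (\<lambda>x. A *v x)"

text \<open>The Moore-Penrose inverse, and the positive semidefinite square root of a positive
  semidefinite matrix.\<close>

definition pseudoinverse :: "real^'a^'b \<Rightarrow> real^'b^'a" where
  "pseudoinverse A = (THE X. A ** X ** A = A \<and> X ** A ** X = X \<and>
     symmetric (A ** X) \<and> symmetric (X ** A))"

definition psd_sqrt :: "real^'a^'a \<Rightarrow> real^'a^'a" where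
  "psd_sqrt A = (THE B. psd B \<and> B ** B = A)"

definition kronecker :: "real^('a::finite)^'a \<Rightarrow> real^('b::finite)^'b \<Rightarrow> real^('a \<times> 'b)^('a \<times> 'b)" where
  "kronecker A B = (\<chi> p q. A $ fst p $ fst q * B $ snd p $ snd q)"

definition diag :: "('a::finite \<Rightarrow> real) \<Rightarrow> real^'a^'a" where
  "diag a = (\<chi> i j. if i = j then a i else 0)"

section \<open>Stacked vectors\<close>

text \<open>A vector of length $Nd$ is indexed by pairs (agent, coordinate). Vectors of length $2Nd$
  are indexed by a sum type.\<close>

definition stack :: "('n::finite \<Rightarrow> real^'d) \<Rightarrow> real^('n \<times> 'd)" where
  "stack u = (\<chi> p. u (fst p) $ snd p)"

definition component :: "real^('n::finite \<times> 'd::finite) \<Rightarrow> 'n \<Rightarrow> real^'d" where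
  "component x i = (\<chi> a. x $ (i, a))"

definition block_diag :: "('n::finite \<Rightarrow> real^'d^'d) \<Rightarrow> real^('n \<times> 'd)^('n \<times> 'd)" where
  "block_diag B = (\<chi> p q. if fst p = fst q then B (fst p) $ snd p $ snd q else 0)"

definition vec_join :: "real^('a::finite) \<Rightarrow> real^('b::finite) \<Rightarrow> real^('a + 'b)" where
  "vec_join x y = (\<chi> s. case s of Inl p \<Rightarrow> x $ p | Inr p \<Rightarrow> y $ p)"

definition block_diag2 :: "real^('a::finite)^'a \<Rightarrow> real^('b::finite)^'b \<Rightarrow> real^('a + 'b)^('a + 'b)" where
  "block_diag2 A B = (\<chi> s t. case (s, t) of
       (Inl p, Inl q) \<Rightarrow> A $ p $ q | (Inr p, Inr q) \<Rightarrow> B $ p $ q | _ \<Rightarrow> 0)"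

section \<open>Gradients and Hessians\<close>

definition grad :: "('a::real_inner \<Rightarrow> real) \<Rightarrow> 'a \<Rightarrow> 'a" where
  "grad f x = (THE D. GDERIV f x :> D)"

definition hess :: "(real^'a \<Rightarrow> real) \<Rightarrow> real^'a \<Rightarrow> real^'a^'a" where
  "hess f x = jacobian (grad f) (at x)"

definition twice_cont_diff :: "(real^'a \<Rightarrow> real) \<Rightarrow> bool" where
  "twice_cont_diff f \<longleftrightarrow> (\<forall>x. f differentiable (at x)) \<and>
     (\<forall>x. grad f differentiable (at x)) \<and> continuous_on UNIV (hess f)"

section \<open>The consensus problem\<close>

text \<open>The agents are the elements of the finite type \<open>'n\<close> (so $N$ is its cardinality) and the
  samples of each agent are indexed by the finite type \<open>'c\<close> (so its cardinality is the number
  of samples). \<open>l i j x s\<close> is the loss at \<open>x\<close> of sample \<open>j\<close> of agent \<open>i\<close>, if the value of that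
  sample is \<open>s\<close>; \<open>dat i j\<close> is the observed value.\<close>

definition connected_graph :: "('n \<times> 'n) set \<Rightarrow> bool" where
  "connected_graph E \<longleftrightarrow> sym E \<and> irrefl E \<and> (\<forall>i j. (i, j) \<in> E\<^sup>*)"

definition weight_matrix :: "('n::finite \<times> 'n) set \<Rightarrow> ('n \<Rightarrow> 'n \<Rightarrow> real) \<Rightarrow> real^'n^'n" where
  "weight_matrix E p = (\<chi> i j. if i = j then (\<Sum>s \<in> E `` {i}. p i s)
     else if (i, j) \<in> E then - p i j else 0)"

definition local_loss ::
  "('n \<Rightarrow> 'c::finite \<Rightarrow> real^'d \<Rightarrow> real^'m \<Rightarrow> real) \<Rightarrow> ('n \<Rightarrow> 'c \<Rightarrow> real^'m) \<Rightarrow> 'n \<Rightarrow> real^'d \<Rightarrow> real"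
  where "local_loss l dat i x = (1 / real CARD('c)) * (\<Sum>j\<in>UNIV. l i j x (dat i j))"

definition global_loss ::
  "('n::finite \<Rightarrow> 'c::finite \<Rightarrow> real^'d \<Rightarrow> real^'m \<Rightarrow> real) \<Rightarrow> ('n \<Rightarrow> 'c \<Rightarrow> real^'m) \<Rightarrow> real^'d \<Rightarrow> real"
  where "global_loss l dat x = (\<Sum>i\<in>UNIV. local_loss l dat i x)"

definition stacked_loss ::
  "('n::finite \<Rightarrow> 'c::finite \<Rightarrow> real^'d \<Rightarrow> real^'m \<Rightarrow> real) \<Rightarrow> ('n \<Rightarrow> 'c \<Rightarrow> real^'m) \<Rightarrow>
    real^('n \<times> 'd) \<Rightarrow> real"
  where "stacked_loss l dat x = (\<Sum>i\<in>UNIV. local_loss l dat i (component x i))"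

definition assumption1 ::
  "('n::finite \<Rightarrow> 'c::finite \<Rightarrow> real^'d \<Rightarrow> real^'m \<Rightarrow> real) \<Rightarrow> ('n \<Rightarrow> 'c \<Rightarrow> real^'m) \<Rightarrow>
    real^'d \<Rightarrow> real \<Rightarrow> ('n \<Rightarrow> real) \<Rightarrow> bool"
  where "assumption1 l dat xs mf Mi \<longleftrightarrow>
    (\<forall>y. global_loss l dat xs \<le> global_loss l dat y) \<and> 0 < mf \<and>
    (\<forall>x. (grad (global_loss l dat) x - grad (global_loss l dat) xs) \<bullet> (x - xs)
           \<ge> mf * (norm (x - xs))\<^sup>2) \<and>
    (\<forall>i j s. twice_cont_diff (\<lambda>x. l i j x s) \<and> convex_on UNIV (\<lambda>x. l i j x s)) \<and>
    (\<forall>i. 0 < Mi i) \<and>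
    (\<forall>i j s. (Mi i)-lipschitz_on UNIV (grad (\<lambda>x. l i j x s)))"

definition hessian_bounds ::
  "('n \<Rightarrow> 'c \<Rightarrow> real^'d \<Rightarrow> real^'m \<Rightarrow> real) \<Rightarrow> ('n \<Rightarrow> real) \<Rightarrow> ('n \<Rightarrow> real) \<Rightarrow> bool"
  where "hessian_bounds l mi Mi \<longleftrightarrow>
    (\<forall>i. 0 \<le> mi i \<and> mi i \<le> Mi i) \<and>
    (\<forall>i j s x. mi i *\<^sub>R mat 1 \<preceq>\<^sub>L hess (\<lambda>x. l i j x s) x \<and>
               hess (\<lambda>x. l i j x s) x \<preceq>\<^sub>L Mi i *\<^sub>R mat 1)"

text \<open>The variance of the sample gradients of agent \<open>i\<close> about their mean, in the unbiased
  normalisation by one less than the number of samples. If the sample gradients are independent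
  with common mean and each of them has variance at most $\sigma^2$, then the expectation of
  this quantity is at most $\sigma^2$. (For a single sample the quotient is 0/0 = 0.)\<close>

definition sample_variance ::
  "('n \<Rightarrow> 'c::finite \<Rightarrow> real^'d \<Rightarrow> real^'m \<Rightarrow> real) \<Rightarrow> ('n \<Rightarrow> 'c \<Rightarrow> real^'m) \<Rightarrow> 'n \<Rightarrow> real^'d \<Rightarrow> real"
  where "sample_variance l dat i x =
    (\<Sum>j\<in>UNIV. (norm (grad (\<lambda>y. l i j y (dat i j)) x - grad (local_loss l dat i) x))\<^sup>2)
      / (real CARD('c) - 1)"

text \<open>The samples are random vectors on the probability space \<open>S\<close>, and \<open>w\<close> is the outcome that
  has been observed. The iteration is analysed for fixed data, so the variance bound is imposed on
  the observed data. (A bound on an expectation over \<open>S\<close> would say nothing about the sample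
  gradients at iterates that themselves depend on the data.)\<close>

definition assumption2 ::
  "'w measure \<Rightarrow> ('n \<Rightarrow> 'c::finite \<Rightarrow> 'w \<Rightarrow> real^'m) \<Rightarrow> 'w \<Rightarrow>
    ('n \<Rightarrow> 'c \<Rightarrow> real^'d \<Rightarrow> real^'m \<Rightarrow> real) \<Rightarrow> real \<Rightarrow> bool"
  where "assumption2 S \<xi> w l \<sigma> \<longleftrightarrow>
    prob_space S \<and> w \<in> space S \<and>
    prob_space.indep_vars S (\<lambda>_. borel) (\<lambda>(i, j). \<xi> i j) UNIV \<and>
    0 < \<sigma> \<and> (\<forall>i x. sample_variance l (\<lambda>i j. \<xi> i j w) i x \<le> \<sigma>\<^sup>2)"

section \<open>The algorithm\<close>

definition sample_grad ::
  "('n \<Rightarrow> 'c \<Rightarrow> real^'d \<Rightarrow> real^'m \<Rightarrow> real) \<Rightarrow> ('n \<Rightarrow> 'c \<Rightarrow> real^'m) \<Rightarrow> 'c set \<Rightarrow> 'n \<Rightarrow> real^'d \<Rightarrow> real^'d"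
  where "sample_grad l dat A i x =
    (1 / real (card A)) *\<^sub>R (\<Sum>j\<in>A. grad (\<lambda>y. l i j y (dat i j)) x)"

definition sample_hess ::
  "('n \<Rightarrow> 'c \<Rightarrow> real^'d \<Rightarrow> real^'m \<Rightarrow> real) \<Rightarrow> ('n \<Rightarrow> 'c \<Rightarrow> real^'m) \<Rightarrow> 'c set \<Rightarrow> 'n \<Rightarrow> real^'d \<Rightarrow> real^'d^'d"
  where "sample_hess l dat A i x =
    (1 / real (card A)) *\<^sub>R (\<Sum>j\<in>A. hess (\<lambda>y. l i j y (dat i j)) x)"

text \<open>\<open>st_sopro l dat W \<beta> D G H x0 q0 k\<close> is the pair of the k-th iterates if the sample
  sets of agent \<open>i\<close> at iteration \<open>k\<close> are \<open>G k i\<close> (gradients) and \<open>H k i\<close> (Hessians).\<close>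

primrec st_sopro ::
  "('n::finite \<Rightarrow> 'c \<Rightarrow> real^'d \<Rightarrow> real^'m \<Rightarrow> real) \<Rightarrow> ('n \<Rightarrow> 'c \<Rightarrow> real^'m) \<Rightarrow>
    real^('n \<times> 'd)^('n \<times> 'd) \<Rightarrow> real \<Rightarrow> real^('n \<times> 'd)^('n \<times> 'd) \<Rightarrow>
    (nat \<Rightarrow> 'n \<Rightarrow> 'c set) \<Rightarrow> (nat \<Rightarrow> 'n \<Rightarrow> 'c set) \<Rightarrow>
    real^('n \<times> 'd) \<Rightarrow> real^('n \<times> 'd) \<Rightarrow> nat \<Rightarrow> (real^('n \<times> 'd)) \<times> (real^('n \<times> 'd))"
  where
    "st_sopro l dat W \<beta> D G H x0 q0 0 = (x0, q0)"
  | "st_sopro l dat W \<beta> D G H x0 q0 (Suc k) =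
      (let (x, q) = st_sopro l dat W \<beta> D G H x0 q0 k;
           g = stack (\<lambda>i. sample_grad l dat (G k i) i (component x i));
           h = block_diag (\<lambda>i. sample_hess l dat (H k i) i (component x i));
           x' = x - matrix_inv (h + D) *v (g + \<beta> *\<^sub>R (W *v x) + q)
       in (x', q + \<beta> *\<^sub>R (W *v x')))"

text \<open>All sample sets are drawn uniformly without replacement and mutually independently (over
  agents, iterations, and the two kinds). All gradient samples have the same size \<open>nG\<close>; the size
  of the Hessian samples may depend on the agent and on the iteration.\<close>

definition sampling ::
  "'o measure \<Rightarrow> (nat \<Rightarrow> 'n \<Rightarrow> 'o \<Rightarrow> 'c::finite set) \<Rightarrow> (nat \<Rightarrow> 'n \<Rightarrow> 'o \<Rightarrow> 'c set) \<Rightarrow>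
    nat \<Rightarrow> (nat \<Rightarrow> 'n \<Rightarrow> nat) \<Rightarrow> bool"
  where "sampling \<Omega> G H nG nH \<longleftrightarrow>
    prob_space \<Omega> \<and>
    1 \<le> nG \<and> nG \<le> CARD('c) \<and> (\<forall>k i. 1 \<le> nH k i \<and> nH k i \<le> CARD('c)) \<and>
    prob_space.indep_vars \<Omega> (\<lambda>_. count_space UNIV)
      (\<lambda>(k, i, b). if b then G k i else H k i) UNIV \<and>
    (\<forall>k i. distr \<Omega> (count_space UNIV) (G k i) = measure_pmf (pmf_of_set {A. card A = nG})) \<and>
    (\<forall>k i. distr \<Omega> (count_space UNIV) (H k i) = measure_pmf (pmf_of_set {A. card A = nH k i}))"

definition converges_linearly_to_neighborhood :: "(nat \<Rightarrow> real) \<Rightarrow> real \<Rightarrow> real \<Rightarrow> real \<Rightarrow> bool" where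
  "converges_linearly_to_neighborhood e \<delta> \<Gamma> \<rho> \<longleftrightarrow>
    0 < \<delta> \<and> \<delta> < 1 \<and> 0 < \<Gamma> \<and>
    (\<forall>k. e (Suc k) \<le> (1 - \<delta>) * e k + \<Gamma> * \<rho>) \<and>
    limsup (\<lambda>k. ereal (e k)) \<le> ereal (1 / \<delta> * \<Gamma> * \<rho>)"

end

theory Submission
  imports Defs
begin

text \<open>
  Let \<open>e\<close> and \<open>u\<close> be the errors of \<open>x\<close> and \<open>v\<close>, let \<open>d\<close> be the step from \<open>x\<close> to its successor, and
  let \<open>\<epsilon>\<close> be the noise in the sampled gradient. The iteration says that
  \<open>(h + D) d = - (\<nabla>f(x) - \<nabla>f(x*) + \<epsilon> + \<beta> W e + W^(1/2) u)\<close>. Eliminating \<open>u\<close> with this equation turns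
  the change of the Lyapunov function \<open>\<beta> |e|_R^2 + |u|^2\<close> into an explicit quadratic expression
  in \<open>d\<close>, \<open>e\<close>, \<open>\<epsilon>\<close> and the gradients. A fraction \<open>1 - \<eta>\<close> of the monotonicity term is spent, by
  cocoercivity, on the coupling of the gradients with \<open>d\<close>; the fraction \<open>\<eta>\<close> gives
  \<open>2 \<eta> m\<beta> |e|^2\<close>, by restricted strong convexity of \<open>f + (\<beta>/2) |.|_W^2\<close>. What remains is the decrease
  \<open>\<beta> \<kappa> |d|^2 + \<beta> (2 \<eta> m\<beta> - c0) |e|^2 + \<beta>^2 (1 - \<eta>) |e|_W^2\<close>, up to noise. The same equation, in
  the norm of the pseudoinverse of \<open>W\<close>, bounds \<open>|u|^2\<close> by these three quantities, so that the decrease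
  is at least the fraction \<open>\<delta>\<close> of the Lyapunov function. Given the past, the noise has mean zero, and the
  variance of sampling without replacement is \<open>\<tau>\<close> times the sample variance. The bound is affine in
  \<open>\<delta>\<close>, hence it passes to the supremum over \<open>c2\<close>.
\<close>

subsection \<open>Quadratic forms\<close>

text \<open>The decrease is proved pathwise, for arbitrary Hessian blocks between their bounds and
  an arbitrary gradient estimate; expectations come afterwards. The obstacle is that
  \<open>d\<close> depends on the noise \<open>\<epsilon>\<close>, so the inner product of
  \<open>e + d\<close> with \<open>\<epsilon>\<close> does not have mean zero. Only the part with
  \<open>e\<close>, which is fixed before the sample is drawn, averages out. The part with
  \<open>d\<close> is absorbed by Young's inequality: it costs \<open>\<beta>/2 |d|^2\<close>, the
  origin of half the identity in the condition on \<open>D\<close>, and leaves the summand 2 of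
  \<Gamma>. The other summand of \<Gamma> is the noise in the bound on \<open>|u|^2\<close>. The
  pseudoinverse of \<open>W\<close> behaves like an inverse here: \<open>q\<close> keeps agent sum
  zero and so do the local gradients at the optimum, hence \<open>q + F xs\<close> is orthogonal to
  the consensus vectors, which form the kernel of \<open>W\<close>. The Lyapunov function can thus
  be written in \<open>q\<close>, with no square root left. The condition on \<open>D\<close> says
  exactly that the matrix inside \<open>\<kappa> c0\<close> is positive definite at the excluded
  endpoint \<open>c0 = 2 \<eta> m\<beta>\<close>; a slightly smaller \<open>c0\<close> is then
  reached by perturbation.\<close>

lemma quad_add: "quad (A + B) x = quad A x + quad B x"
  by (simp add: quad_def matrix_vector_mult_add_rdistrib inner_add_right)

lemma quad_diff: "quad (A - B) x = quad A x - quad B x"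
  by (simp add: quad_def matrix_vector_mult_diff_rdistrib inner_diff_right)

lemma quad_scaleR: "quad (c *\<^sub>R A) x = c * quad A x"
  by (simp add: quad_def scaleR_matrix_vector_assoc [symmetric])

lemma quad_mat_1: "quad (mat 1) x = (norm x)\<^sup>2"
  by (simp add: quad_def power2_norm_eq_inner)

lemma quad_mult_vec: "quad A (c *\<^sub>R x) = c\<^sup>2 * quad A x"
  by (simp add: quad_def matrix_vector_mult_scaleR power2_eq_square)

lemma quad_zero [simp]: "quad A 0 = 0"
  by (simp add: quad_def)

lemmas quad_simps = quad_add quad_diff quad_scaleR quad_mat_1

lemma symmetric_inner: "symmetric A \<Longrightarrow> (A *v x) \<bullet> y = x \<bullet> (A *v y)"
  by (metis dot_lmul_matrix symmetric_def transpose_matrix_vector)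

lemma symmetricI:
  assumes "\<And>x y. (A *v x) \<bullet> y = x \<bullet> (A *v y)"
  shows "symmetric A"
proof -
  have "transpose A *v x = A *v x" for x
  proof (rule vector_eq_rdot [THEN iffD1], rule allI)
    fix z show "(transpose A *v x) \<bullet> z = (A *v x) \<bullet> z"
      by (metis assms dot_lmul_matrix transpose_matrix_vector)
  qed
  then show ?thesis
    by (simp add: symmetric_def matrix_eq)
qed

lemma symmetric_add: "symmetric A \<Longrightarrow> symmetric B \<Longrightarrow> symmetric (A + B)"
  by (simp add: symmetric_def transpose_def vec_eq_iff)

lemma symmetric_diff: "symmetric A \<Longrightarrow> symmetric B \<Longrightarrow> symmetric (A - B)"
  by (simp add: symmetric_def transpose_def vec_eq_iff)

lemma symmetric_scaleR: "symmetric A \<Longrightarrow> symmetric (c *\<^sub>R A)"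
  by (simp add: symmetric_def transpose_def vec_eq_iff)

lemma symmetric_mat: "symmetric (mat c)"
  by (simp add: symmetric_def)

lemma symmetric_square: "symmetric A \<Longrightarrow> symmetric (A ** A)"
  by (simp add: symmetric_def matrix_transpose_mul)

lemmas symmetric_intros = symmetric_add symmetric_diff symmetric_scaleR symmetric_mat symmetric_square

lemma quad_square: "symmetric A \<Longrightarrow> quad (A ** A) x = (norm (A *v x))\<^sup>2"
  by (simp add: quad_def matrix_vector_mul_assoc [symmetric] symmetric_inner power2_norm_eq_inner)

lemma quad_add_vec:
  "symmetric A \<Longrightarrow> quad A (x + y) = quad A x + 2 * (x \<bullet> (A *v y)) + quad A y"
  using symmetric_inner [of A x y]
  by (simp add: quad_def matrix_vector_right_distrib inner_add_left inner_add_right inner_commute)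

text \<open>Young's inequality in the seminorm of \<open>A\<close>, from \<open>quad A\<close> being
  nonnegative at \<open>x - y / c\<close>. The free constants \<open>c1\<close> and
  \<open>c2\<close> of the rate enter as this \<open>c\<close>.\<close>

lemma quad_add_le:
  assumes "psd A" "c > 0"
  shows "quad A (x + y) \<le> (1 + c) * quad A x + (1 + 1 / c) * quad A y"
proof -
  have sA: "symmetric A" and nn: "\<And>z. quad A z \<ge> 0"
    using assms by (auto simp: psd_def)
  have "quad A (x + (-1/c) *\<^sub>R y) = quad A x - 2 / c * (x \<bullet> (A *v y)) + quad A y / c\<^sup>2"
    unfolding quad_add_vec [OF sA] quad_mult_vec
    by (simp add: matrix_vector_mult_scaleR power_divide del: scaleR_minus_left)
  then have "0 \<le> c * (quad A x - 2 / c * (x \<bullet> (A *v y)) + quad A y / c\<^sup>2)"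
    using nn [of "x + (-1/c) *\<^sub>R y"] assms by simp
  also have "\<dots> = c * quad A x - 2 * (x \<bullet> (A *v y)) + quad A y / c"
    using assms by (simp add: field_simps power2_eq_square)
  finally show ?thesis
    unfolding quad_add_vec [OF sA] by (simp add: algebra_simps)
qed

lemma pd_imp_psd: "pd A \<Longrightarrow> psd A"
  unfolding pd_def psd_def by (metis less_eq_real_def quad_zero)

lemma pd_invertible:
  assumes "pd A" shows "A *v (matrix_inv A *v x) = x"
proof -
  have "x = 0" if "A *v x = 0" for x
    using assms that by (auto simp: pd_def quad_def)
  then have "inj ((*v) A)"
    by (simp add: inj_matrix_vector_mult linear_injective_0)
  then have "invertible A"
    by (simp add: invertible_left_inverse matrix_left_invertible_injective)
  then have "A ** matrix_inv A = mat 1"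
    unfolding invertible_def matrix_inv_def by (rule someI2_ex) blast
  then show ?thesis
    by (simp add: matrix_vector_mul_assoc)
qed

subsection \<open>The spectral theorem\<close>

text \<open>First-order optimality condition at \<open>t = 0\<close>, used for the minimiser of the
  Rayleigh quotient.\<close>

lemma linear_le_quadratic_imp_zero:
  fixes a b :: real
  assumes "\<And>t. 0 \<le> a * t + b * t\<^sup>2" shows "a = 0"
proof (rule ccontr)
  assume "a \<noteq> 0"
  \<comment> \<open>The added 1 keeps \<open>c\<close> nonzero and strictly above \<open>b\<close>,
    so the test point \<open>t = - a / c\<close> gives a negative value.\<close>
  define c where "c = \<bar>b\<bar> + 1"
  then have c_pos: "c \<noteq> 0" by simp
  have "0 \<le> a * (- a / c) + b * (- a / c)\<^sup>2" by fact
  also have "\<dots> = (a\<^sup>2 / c\<^sup>2) * (b - c)"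
    by (simp add: c_pos power_divide divide_simps) (simp add: algebra_simps power2_eq_square)
  finally have "0 \<le> (a\<^sup>2 / c\<^sup>2) * (b - c)" .
  moreover have "a\<^sup>2 / c\<^sup>2 > 0"
    using \<open>a \<noteq> 0\<close> c_pos by simp
  ultimately have "b - c \<ge> 0"
    using zero_le_mult_iff [of "a\<^sup>2 / c\<^sup>2" "b - c"] by linarith
  then show False by (simp add: c_def)
qed

text \<open>A minimiser of \<open>quad A\<close> on the unit sphere of \<open>S\<close> exists by
  compactness. The shifted matrix \<open>B\<close> is nonnegative on \<open>S\<close> and its form
  vanishes at \<open>v\<close>, which forces \<open>B *v v = 0\<close>.\<close>

lemma symmetric_min_eigenvector:
  fixes A :: "real^'a^'a"
  assumes A: "symmetric A" and S: "subspace S" "\<And>x. x \<in> S \<Longrightarrow> A *v x \<in> S" "S \<noteq> {0}"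
  obtains v where "v \<in> S" "norm v = 1" "A *v v = quad A v *\<^sub>R v"
proof -
  obtain y where y: "y \<in> S" "y \<noteq> 0"
    using S subspace_0 by blast
  then have "y /\<^sub>R norm y \<in> S \<inter> sphere 0 1"
    using S by (simp add: subspace_scale)
  then have "S \<inter> sphere 0 1 \<noteq> {}" by blast
  moreover have "compact (S \<inter> sphere 0 1)"
    by (simp add: S closed_Int_compact closed_subspace)
  moreover have "continuous_on (S \<inter> sphere 0 1) (quad A)"
    unfolding quad_def
    by (intro continuous_on_inner continuous_on_id linear_continuous_on matrix_vector_mul_bounded_linear)
  ultimately have "\<exists>v\<in>S \<inter> sphere 0 1. \<forall>x\<in>S \<inter> sphere 0 1. quad A v \<le> quad A x"
    by (intro continuous_attains_inf)
  then obtain v where v: "v \<in> S" "norm v = 1"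
    and min: "\<And>x. x \<in> S \<Longrightarrow> norm x = 1 \<Longrightarrow> quad A v \<le> quad A x"
    by auto
  define c where "c = quad A v"
  have nn: "0 \<le> quad A x - c * (norm x)\<^sup>2" if "x \<in> S" for x
  proof (cases "x = 0")
    case False
    have "c \<le> quad A ((1 / norm x) *\<^sub>R x)"
      unfolding c_def using that False S by (intro min) (auto simp: subspace_scale)
    then show ?thesis
      using False by (simp add: quad_mult_vec field_simps)
  qed auto
  define B where "B = A - c *\<^sub>R mat 1"
  have B: "symmetric B"
    unfolding B_def by (intro symmetric_intros A)
  have qB: "quad B x = quad A x - c * (norm x)\<^sup>2" for x
    by (simp add: B_def quad_simps)
  define r where "r = B *v v"
  have rS: "r \<in> S"
    using S v by (simp add: r_def B_def matrix_vector_mult_diff_rdistrib subspace_diff subspace_scale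
        scaleR_matrix_vector_assoc [symmetric])
  \<comment> \<open>The variation is taken in the direction of the residual
    \<open>r = B *v v\<close> itself, which stays in \<open>S\<close> by invariance; the linear
    coefficient is then twice the squared norm of \<open>r\<close>.\<close>
  have "0 \<le> (2 * (v \<bullet> (B *v r))) * t + quad B r * t\<^sup>2" for t
  proof -
    have "0 \<le> quad B (v + t *\<^sub>R r)"
      unfolding qB using v rS S by (intro nn) (simp add: subspace_add subspace_scale)
    also have "\<dots> = (2 * (v \<bullet> (B *v r))) * t + quad B r * t\<^sup>2"
      unfolding quad_add_vec [OF B] quad_mult_vec
      using qB [of v] v by (simp add: c_def matrix_vector_mult_scaleR)
    finally show ?thesis .
  qed
  then have "2 * (v \<bullet> (B *v r)) = 0"
    by (rule linear_le_quadratic_imp_zero)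
  then have "r \<bullet> r = 0"
    using symmetric_inner [OF B, of v r] by (simp add: r_def)
  then have "A *v v = c *\<^sub>R v"
    by (simp add: r_def B_def matrix_vector_mult_diff_rdistrib scaleR_matrix_vector_assoc [symmetric])
  then show ?thesis
    using that v by (simp add: c_def)
qed

text \<open>Stated for invariant subspaces so that induction on the dimension applies: the part of
  \<open>S\<close> orthogonal to one eigenvector is again invariant, because \<open>A\<close> is
  symmetric.\<close>

lemma symmetric_orthonormal_eigenvectors:
  fixes A :: "real^'a^'a"
  assumes A: "symmetric A" and "subspace S" "\<And>x. x \<in> S \<Longrightarrow> A *v x \<in> S"
  shows "\<exists>B. B \<subseteq> S \<and> pairwise orthogonal B \<and> (\<forall>b\<in>B. norm b = 1 \<and> A *v b = quad A b *\<^sub>R b) \<and> span B = S"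
  using assms(2,3)
proof (induction "dim S" arbitrary: S rule: less_induct)
  case less
  show ?case
  proof (cases "S = {0}")
    case True
    then show ?thesis by (intro exI [of _ "{}"]) auto
  next
    case False
    obtain v where v: "v \<in> S" "norm v = 1" and eig: "A *v v = quad A v *\<^sub>R v"
      using symmetric_min_eigenvector [OF A less.prems(1,2) False] by blast
    define T where "T = S \<inter> {x. v \<bullet> x = 0}"
    have T: "subspace T"
      unfolding T_def by (intro subspace_inter less.prems subspace_hyperplane)
    have inv: "A *v x \<in> T" if "x \<in> T" for x
      using that less.prems symmetric_inner [OF A, of v x] by (auto simp: T_def eig)
    have "v \<notin> T"
      using v by (auto simp: T_def norm_eq_1)
    then have "T \<subset> S" using v unfolding T_def by blast
    then have "dim T < dim S"
      using T less.prems by (intro dim_psubset) (metis less.prems(1) span_eq_iff)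
    from less.hyps [OF this T inv] obtain B where B: "B \<subseteq> T" "pairwise orthogonal B"
      "\<forall>b\<in>B. norm b = 1 \<and> A *v b = quad A b *\<^sub>R b" "span B = T" by blast
    show ?thesis
    proof (intro exI [of _ "insert v B"] conjI ballI)
      show "insert v B \<subseteq> S" using v B by (auto simp: T_def)
      show "pairwise orthogonal (insert v B)"
        using B by (auto simp: pairwise_insert T_def orthogonal_def inner_commute)
      show "span (insert v B) = S"
      proof
        show "span (insert v B) \<subseteq> S"
          using v B less.prems(1) by (intro span_minimal) (auto simp: T_def)
        show "S \<subseteq> span (insert v B)"
        proof
          fix x assume "x \<in> S"
          then have "x - (v \<bullet> x) *\<^sub>R v \<in> T"
            using v less.prems(1) 
            by (auto simp: T_def subspace_diff subspace_scale inner_diff_right norm_eq_1)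
          then show "x \<in> span (insert v B)"
            using B(4) by (auto simp: span_insert)
        qed
      qed
    qed (use v eig B in auto)
  qed
qed

definition eigenbasis :: "real^'a^'a \<Rightarrow> (real^'a) set \<Rightarrow> bool" where
  "eigenbasis A B \<longleftrightarrow> finite B \<and> pairwise orthogonal B \<and> span B = UNIV \<and>
     (\<forall>b\<in>B. norm b = 1 \<and> A *v b = quad A b *\<^sub>R b)"

lemma eigenbasis_exists:
  assumes "symmetric A" obtains B where "eigenbasis A B"
proof -
  obtain B where B: "pairwise orthogonal B" "\<forall>b\<in>B. norm b = 1 \<and> A *v b = quad A b *\<^sub>R b" "span B = UNIV"
    using symmetric_orthonormal_eigenvectors [OF assms subspace_UNIV] by auto
  then have "independent B"
    by (metis norm_zero pairwise_orthogonal_independent zero_neq_one)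
  then show ?thesis
    using B by (intro that [of B]) (auto simp: eigenbasis_def finiteI_independent)
qed

text \<open>Functional calculus: the eigenvalue of a unit eigenvector \<open>b\<close> is \<open>quad A b\<close>.\<close>

definition spectral_fun :: "real^'a^'a \<Rightarrow> (real^'a) set \<Rightarrow> (real \<Rightarrow> real) \<Rightarrow> real^'a^'a" where
  "spectral_fun A B g = matrix (\<lambda>x. \<Sum>b\<in>B. (g (quad A b) * (x \<bullet> b)) *\<^sub>R b)"

lemma eigenbasis_expand: "eigenbasis A B \<Longrightarrow> (\<Sum>b\<in>B. (x \<bullet> b) *\<^sub>R b) = x"
  by (auto simp: eigenbasis_def intro!: orthonormal_basis_expand)

lemma spectral_fun_mult_vec:
  "spectral_fun A B g *v x = (\<Sum>b\<in>B. (g (quad A b) * (x \<bullet> b)) *\<^sub>R b)"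
proof -
  have "linear (\<lambda>x. \<Sum>b\<in>B. (g (quad A b) * (x \<bullet> b)) *\<^sub>R b)"
    by (rule linearI) (simp_all add: algebra_simps inner_add_left scaleR_sum_right sum.distrib)
  then show ?thesis
    by (simp add: spectral_fun_def)
qed

lemma eigenbasis_inner:
  "eigenbasis A B \<Longrightarrow> b \<in> B \<Longrightarrow> b' \<in> B \<Longrightarrow> b \<bullet> b' = (if b = b' then 1 else 0)"
  by (auto simp: eigenbasis_def pairwise_def orthogonal_def norm_eq_1)

lemma spectral_fun_eigenvector:
  assumes "eigenbasis A B" "b \<in> B"
  shows "spectral_fun A B g *v b = g (quad A b) *\<^sub>R b"
proof -
  have "spectral_fun A B g *v b = (\<Sum>b'\<in>B. if b = b' then g (quad A b) *\<^sub>R b else 0)"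
    unfolding spectral_fun_mult_vec using assms
    by (intro sum.cong) (auto simp: eigenbasis_inner)
  then show ?thesis
    using assms by (simp add: eigenbasis_def)
qed

lemma eigenbasis_eqI:
  assumes "eigenbasis A B" "\<And>b. b \<in> B \<Longrightarrow> X *v b = Y *v b"
  shows "X = Y"
  unfolding matrix_eq
  using linear_eq_on_span [of "(*v) X" "(*v) Y" B] assms by (auto simp: eigenbasis_def)

lemma spectral_fun_id: "eigenbasis A B \<Longrightarrow> spectral_fun A B (\<lambda>x. x) = A"
  by (rule eigenbasis_eqI) (auto simp: spectral_fun_eigenvector, simp add: eigenbasis_def)

lemma spectral_fun_mult:
  "eigenbasis A B \<Longrightarrow> spectral_fun A B g ** spectral_fun A B h = spectral_fun A B (\<lambda>x. g x * h x)"
  by (rule eigenbasis_eqI)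
    (auto simp: spectral_fun_eigenvector matrix_vector_mul_assoc [symmetric] matrix_vector_mult_scaleR)

lemma spectral_fun_cong:
  "(\<And>b. b \<in> B \<Longrightarrow> g (quad A b) = h (quad A b)) \<Longrightarrow> spectral_fun A B g = spectral_fun A B h"
  by (simp add: spectral_fun_def)

lemma symmetric_spectral_fun: "symmetric (spectral_fun A B g)"
  by (rule symmetricI)
    (simp add: spectral_fun_mult_vec inner_sum_left inner_sum_right, intro sum.cong refl,
      simp add: inner_commute)

lemma quad_spectral_fun: "quad (spectral_fun A B g) x = (\<Sum>b\<in>B. g (quad A b) * (x \<bullet> b)\<^sup>2)"
  by (simp add: quad_def spectral_fun_mult_vec inner_sum_right power2_eq_square mult.assoc)

lemma quad_eigenbasis: "eigenbasis A B \<Longrightarrow> quad A x = (\<Sum>b\<in>B. quad A b * (x \<bullet> b)\<^sup>2)"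
  using quad_spectral_fun [of A B "\<lambda>x. x" x] by (simp add: spectral_fun_id)

lemma norm_eigenbasis:
  assumes "eigenbasis A B" shows "(norm x)\<^sup>2 = (\<Sum>b\<in>B. (x \<bullet> b)\<^sup>2)"
proof -
  have "spectral_fun A B (\<lambda>_. 1) = mat 1"
    using assms by (intro eigenbasis_eqI [OF assms]) (simp add: spectral_fun_eigenvector)
  then show ?thesis
    using quad_spectral_fun [of A B "\<lambda>_. 1" x] by (simp add: quad_mat_1)
qed

lemma psd_spectral_fun:
  "(\<And>b. b \<in> B \<Longrightarrow> g (quad A b) \<ge> 0) \<Longrightarrow> psd (spectral_fun A B g)"
  by (auto simp: psd_def symmetric_spectral_fun quad_spectral_fun intro!: sum_nonneg)

text \<open>An eigenvector cannot be orthogonal to the whole basis, and a basis vector that it meets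
  must share its eigenvalue. This makes the \<open>Max\<close> and \<open>Min\<close> over
  \<open>eigenvalues\<close> range over finite nonempty sets.\<close>

lemma eigenvalues_eigenbasis:
  assumes B: "eigenbasis A B" and A: "symmetric A" shows "eigenvalues A = quad A ` B"
proof
  show "quad A ` B \<subseteq> eigenvalues A"
  proof
    fix c assume "c \<in> quad A ` B"
    then obtain b where "b \<in> B" "c = quad A b" by blast
    then have "b \<noteq> 0 \<and> A *v b = c *\<^sub>R b" using B by (auto simp: eigenbasis_def)
    then show "c \<in> eigenvalues A" by (auto simp: eigenvalues_def)
  qed
  show "eigenvalues A \<subseteq> quad A ` B"
  proof
    fix c assume "c \<in> eigenvalues A"
    then obtain v where v: "v \<noteq> 0" "A *v v = c *\<^sub>R v"
      by (auto simp: eigenvalues_def)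
    obtain b where b: "b \<in> B" "v \<bullet> b \<noteq> 0"
    proof (rule ccontr)
      assume "\<not> thesis"
      then have "(\<Sum>b\<in>B. (v \<bullet> b) *\<^sub>R b) = 0" using that by (intro sum.neutral) force
      then show False using v eigenbasis_expand [OF B] by auto
    qed
    have "c * (v \<bullet> b) = quad A b * (v \<bullet> b)"
      using symmetric_inner [OF A, of v b] B b v by (simp add: eigenbasis_def)
    then show "c \<in> quad A ` B" using b by auto
  qed
qed

lemma eigenbasis_nonempty: "eigenbasis A B \<Longrightarrow> B \<noteq> {}"
proof
  assume "eigenbasis A B" "B = {}"
  then have "axis undefined 1 \<in> span ({} :: (real^'a) set)" by (simp add: eigenbasis_def)
  then show False by (simp add: axis_eq_0_iff)
qed

lemma finite_eigenvalues: "symmetric A \<Longrightarrow> finite (eigenvalues A)"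
  by (rule eigenbasis_exists [of A]) (auto simp: eigenvalues_eigenbasis, simp add: eigenbasis_def)

lemma eigenvalues_nonempty: "symmetric A \<Longrightarrow> eigenvalues A \<noteq> {}"
  by (rule eigenbasis_exists [of A]) (auto simp: eigenvalues_eigenbasis eigenbasis_nonempty)

lemma lambda_min_le_quad:
  assumes "symmetric A" shows "lambda_min A * (norm x)\<^sup>2 \<le> quad A x"
proof -
  obtain B where B: "eigenbasis A B" using assms eigenbasis_exists by blast
  have "lambda_min A \<le> quad A b" if "b \<in> B" for b
    unfolding lambda_min_def using that assms B
    by (auto simp: finite_eigenvalues eigenvalues_eigenbasis intro!: Min_le)
      (simp add: eigenbasis_def)
  then show ?thesis
    by (auto simp: norm_eigenbasis [OF B] quad_eigenbasis [OF B, of x] sum_distrib_left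
        intro!: sum_mono mult_right_mono)
qed

lemma quad_le_lambda_max:
  assumes "symmetric A" shows "quad A x \<le> lambda_max A * (norm x)\<^sup>2"
proof -
  obtain B where B: "eigenbasis A B" using assms eigenbasis_exists by blast
  have "quad A b \<le> lambda_max A" if "b \<in> B" for b
    unfolding lambda_max_def using that assms B
    by (auto simp: finite_eigenvalues eigenvalues_eigenbasis intro!: Max_ge)
      (simp add: eigenbasis_def)
  then show ?thesis
    by (auto simp: norm_eigenbasis [OF B] quad_eigenbasis [OF B, of x] sum_distrib_left
        intro!: sum_mono mult_right_mono)
qed

lemma lambda_min_pos:
  assumes "pd A" shows "lambda_min A > 0"
proof -
  have A: "symmetric A" using assms by (simp add: pd_def)
  have "c > 0" if "c \<in> eigenvalues A" for c
  proof -
    from that obtain v where v: "v \<noteq> 0" "A *v v = c *\<^sub>R v"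
      by (auto simp: eigenvalues_def)
    then have "c * (v \<bullet> v) > 0"
      using assms by (auto simp: pd_def quad_def)
    moreover have "v \<bullet> v > 0" using v by simp
    ultimately show ?thesis by (rule zero_less_mult_pos2)
  qed
  then show ?thesis
    using A by (simp add: lambda_min_def finite_eigenvalues eigenvalues_nonempty)
qed

text \<open>The hypothesis puts every eigenvalue in \<open>[-c, c]\<close>, and the squared norm of
  \<open>A *v x\<close> is the form of \<open>A ** A\<close>. Loewner bounds are turned into
  operator norm bounds this way.\<close>

lemma symmetric_norm_le:
  assumes A: "symmetric A" and c: "c \<ge> 0" "\<And>x. \<bar>quad A x\<bar> \<le> c * (norm x)\<^sup>2"
  shows "norm (A *v x) \<le> c * norm x"
proof -
  obtain B where B: "eigenbasis A B" using A eigenbasis_exists by blast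
  have "(norm (A *v x))\<^sup>2 = quad (A ** A) x"
    using A by (simp add: quad_square)
  also have "A ** A = spectral_fun A B (\<lambda>x. x * x)"
    using spectral_fun_mult [OF B, of "\<lambda>x. x" "\<lambda>x. x"] by (simp add: spectral_fun_id [OF B])
  also have "quad \<dots> x \<le> (\<Sum>b\<in>B. c\<^sup>2 * (x \<bullet> b)\<^sup>2)"
    unfolding quad_spectral_fun
  proof (intro sum_mono mult_right_mono)
    fix b assume "b \<in> B"
    then have "\<bar>quad A b\<bar> \<le> c" using c(2) [of b] B by (simp add: eigenbasis_def)
    then show "quad A b * quad A b \<le> c\<^sup>2"
      by (metis abs_le_square_iff abs_of_nonneg c(1) power2_eq_square)
  qed auto
  also have "\<dots> = (c * norm x)\<^sup>2"
    by (simp add: norm_eigenbasis [OF B] sum_distrib_left power_mult_distrib)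
  finally show ?thesis
    by (rule power2_le_imp_le) (simp add: c(1))
qed

subsection \<open>Square root and Moore--Penrose inverse\<close>

lemma psd_quad_nonneg: "psd A \<Longrightarrow> quad A b \<ge> 0"
  by (simp add: psd_def)

lemma psd_square_root_exists:
  assumes "psd A" shows "\<exists>X. psd X \<and> X ** X = A"
proof -
  obtain B where B: "eigenbasis A B" using assms eigenbasis_exists psd_def by blast
  have "spectral_fun A B sqrt ** spectral_fun A B sqrt = spectral_fun A B (\<lambda>x. x)"
    unfolding spectral_fun_mult [OF B]
    using assms by (intro spectral_fun_cong) (simp add: psd_def)
  then show ?thesis
    using assms by (intro exI [of _ "spectral_fun A B sqrt"])
      (auto simp: spectral_fun_id [OF B] psd_def symmetric_spectral_fun quad_spectral_fun
        intro!: sum_nonneg)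
qed

text \<open>If \<open>b\<close> is an eigenvector of \<open>X\<^sup>2\<close> with eigenvalue \<open>c > 0\<close>, then \<open>(X + \<surd>c)(X - \<surd>c) b = 0\<close>, and
  \<open>X + \<surd>c\<close> is injective.\<close>

lemma psd_square_root_eigenvector:
  assumes X: "psd X" and b: "(X ** X) *v b = c *\<^sub>R b" and c: "c \<ge> 0"
  shows "X *v b = sqrt c *\<^sub>R b"
proof (cases "c = 0")
  case True
  then have "quad (X ** X) b = 0" using b by (simp add: quad_def)
  then show ?thesis using X True by (simp add: quad_square psd_def)
next
  case False
  define y where "y = X *v b - sqrt c *\<^sub>R b"
  have "X *v y = - (sqrt c *\<^sub>R y)"
    using b c by (simp add: y_def matrix_vector_mult_diff_distrib matrix_vector_mult_scaleR
        matrix_vector_mul_assoc scaleR_diff_right)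
  then have "quad X y = - (sqrt c * (y \<bullet> y))"
    by (simp add: quad_def)
  moreover have "quad X y \<ge> 0" using X by (simp add: psd_def)
  ultimately have "sqrt c * (y \<bullet> y) \<le> 0" by simp
  then have "y \<bullet> y \<le> 0"
    using False c by (simp add: mult_le_0_iff)
  then have "y \<bullet> y = 0" using inner_ge_zero [of y] by linarith
  then show ?thesis by (simp add: y_def)
qed

text \<open>Both roots act as the same scalar on each eigenvector of their common square. Uniqueness
  is what makes the \<open>THE\<close> in \<open>psd_sqrt\<close> denote.\<close>

lemma psd_square_root_unique:
  assumes "psd X" "psd Y" "X ** X = Y ** Y" shows "X = Y"
proof -
  have A: "symmetric (X ** X)" using assms by (simp add: psd_def symmetric_square)
  obtain B where B: "eigenbasis (X ** X) B" using A eigenbasis_exists by blast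
  show ?thesis
  proof (rule eigenbasis_eqI [OF B])
    fix b assume "b \<in> B"
    then have "(X ** X) *v b = quad (X ** X) b *\<^sub>R b" using B by (simp add: eigenbasis_def)
    moreover have "quad (X ** X) b \<ge> 0" using assms by (simp add: quad_square psd_def)
    ultimately show "X *v b = Y *v b"
      using psd_square_root_eigenvector assms by metis
  qed
qed

lemma psd_sqrt:
  assumes "psd A" shows "psd (psd_sqrt A)" "psd_sqrt A ** psd_sqrt A = A"
proof -
  have "\<exists>!X. psd X \<and> X ** X = A"
    using psd_square_root_exists [OF assms] psd_square_root_unique by metis
  from theI' [OF this] show "psd (psd_sqrt A)" "psd_sqrt A ** psd_sqrt A = A"
    by (auto simp: psd_sqrt_def)
qed

text \<open>\<open>A ** X\<close> and \<open>A ** Y\<close> are both the orthogonal projection onto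
  the range of \<open>A\<close>, hence equal; likewise \<open>X ** A\<close> and
  \<open>Y ** A\<close>. Then \<open>X = X ** A ** X = Y ** A ** Y = Y\<close>.\<close>

lemma moore_penrose_unique:
  assumes X: "A ** X ** A = A" "X ** A ** X = X" "symmetric (A ** X)" "symmetric (X ** A)"
    and Y: "A ** Y ** A = A" "Y ** A ** Y = Y" "symmetric (A ** Y)" "symmetric (Y ** A)"
  shows "X = Y"
proof -
  have 1: "A ** X = A ** Y"
  proof -
    have "A ** X = transpose (A ** X)" using X by (simp add: symmetric_def)
    also have "\<dots> = transpose ((A ** Y) ** (A ** X))" by (metis Y(1) matrix_mul_assoc)
    also have "\<dots> = (A ** X) ** (A ** Y)" using X Y by (simp add: matrix_transpose_mul symmetric_def)
    also have "\<dots> = A ** Y" by (simp add: matrix_mul_assoc X)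
    finally show ?thesis .
  qed
  have 2: "X ** A = Y ** A"
  proof -
    have "X ** A = transpose (X ** A)" using X by (simp add: symmetric_def)
    also have "\<dots> = transpose ((X ** A) ** (Y ** A))" by (metis Y(1) matrix_mul_assoc)
    also have "\<dots> = (Y ** A) ** (X ** A)" using X Y by (simp add: matrix_transpose_mul symmetric_def)
    also have "\<dots> = Y ** A" by (metis X(1) matrix_mul_assoc)
    finally show ?thesis .
  qed
  show ?thesis by (metis 1 2 X(2) Y(2) matrix_mul_assoc)
qed

text \<open>Because \<open>inverse 0 = 0\<close>, the scalar \<open>inverse\<close> is already a
  Moore-Penrose inverse, so functional calculus with it yields the matrix one.\<close>

lemma inverse_cancel:
  fixes x :: real
  shows "x * inverse x * x = x" "inverse x * x * inverse x = inverse x"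
  by (cases "x = 0"; simp)+

lemma pseudoinverse_eq_spectral_fun:
  assumes B: "eigenbasis A B" shows "pseudoinverse A = spectral_fun A B inverse"
proof -
  let ?F = "spectral_fun A B" and ?X = "spectral_fun A B inverse"
  have AX: "A ** ?X = ?F (\<lambda>x. x * inverse x)" and XA: "?X ** A = ?F (\<lambda>x. inverse x * x)"
    using spectral_fun_mult [OF B, of "\<lambda>x. x" inverse] spectral_fun_mult [OF B, of inverse "\<lambda>x. x"]
    by (simp_all add: spectral_fun_id [OF B])
  have "?F (\<lambda>x. x * inverse x) ** ?F (\<lambda>x. x) = ?F (\<lambda>x. x)"
    unfolding spectral_fun_mult [OF B] by (rule spectral_fun_cong) (rule inverse_cancel)
  then have 1: "A ** ?X ** A = A"
    by (simp add: AX spectral_fun_id [OF B])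
  have "?F (\<lambda>x. inverse x * x) ** ?X = ?X"
    unfolding spectral_fun_mult [OF B] by (rule spectral_fun_cong) (rule inverse_cancel)
  then have 2: "?X ** A ** ?X = ?X"
    by (simp add: XA)
  have 3: "symmetric (A ** ?X)" "symmetric (?X ** A)"
    unfolding AX XA by (rule symmetric_spectral_fun)+
  have "Y = ?X" if "A ** Y ** A = A \<and> Y ** A ** Y = Y \<and> symmetric (A ** Y) \<and> symmetric (Y ** A)" for Y
    by (rule moore_penrose_unique [of A]) (use that 1 2 3 in blast)+
  then show ?thesis
    unfolding pseudoinverse_def using 1 2 3 by (intro the_equality conjI)
qed

lemma pseudoinverse:
  assumes A: "symmetric A"
  shows "A ** pseudoinverse A ** A = A" "symmetric (pseudoinverse A ** A)"
    "symmetric (pseudoinverse A)"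
proof -
  obtain B where B: "eigenbasis A B" using A eigenbasis_exists by blast
  let ?F = "spectral_fun A B" and ?X = "spectral_fun A B inverse"
  have AX: "A ** ?X = ?F (\<lambda>x. x * inverse x)" and XA: "?X ** A = ?F (\<lambda>x. inverse x * x)"
    using spectral_fun_mult [OF B, of "\<lambda>x. x" inverse] spectral_fun_mult [OF B, of inverse "\<lambda>x. x"]
    by (simp_all add: spectral_fun_id [OF B])
  have "?F (\<lambda>x. x * inverse x) ** ?F (\<lambda>x. x) = ?F (\<lambda>x. x)"
    unfolding spectral_fun_mult [OF B] by (rule spectral_fun_cong) (rule inverse_cancel)
  then show "A ** pseudoinverse A ** A = A"
    by (simp add: AX pseudoinverse_eq_spectral_fun [OF B] spectral_fun_id [OF B])
  show "symmetric (pseudoinverse A ** A)" "symmetric (pseudoinverse A)"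
    unfolding pseudoinverse_eq_spectral_fun [OF B] XA by (rule symmetric_spectral_fun)+
qed

lemma psd_pseudoinverse:
  assumes "psd A" shows "psd (pseudoinverse A)"
proof -
  obtain B where B: "eigenbasis A B" using assms eigenbasis_exists psd_def by blast
  show ?thesis
    unfolding pseudoinverse_eq_spectral_fun [OF B]
    using assms by (intro psd_spectral_fun) (simp add: psd_def)
qed

text \<open>\<open>pseudoinverse A ** A\<close> is the orthogonal projection onto the complement of
  the kernel of \<open>A\<close>, and \<open>y\<close> lies in that complement.\<close>

lemma pseudoinverse_cancel:
  assumes A: "symmetric A" and y: "\<And>z. A *v z = 0 \<Longrightarrow> y \<bullet> z = 0"
  shows "pseudoinverse A *v (A *v y) = y"
proof -
  let ?X = "pseudoinverse A"
  define z where "z = y - ?X *v (A *v y)"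
  have Az: "A *v z = 0"
    using pseudoinverse(1) [OF A]
    by (simp add: z_def matrix_vector_mult_diff_distrib matrix_vector_mul_assoc matrix_mul_assoc)
  have "(?X *v (A *v y)) \<bullet> z = y \<bullet> (?X *v (A *v z))"
    using symmetric_inner [OF pseudoinverse(2) [OF A], of y z]
    by (simp add: matrix_vector_mul_assoc)
  then have "z \<bullet> z = 0"
    using y [OF Az] Az by (simp add: z_def inner_diff_left)
  then show ?thesis by (simp add: z_def)
qed

lemma lambda_min_nonzero_pos:
  assumes "psd A" "A \<noteq> 0" shows "lambda_min_nonzero A > 0"
proof -
  have A: "symmetric A" using assms by (simp add: psd_def)
  obtain B where B: "eigenbasis A B" using A eigenbasis_exists by blast
  have "\<exists>b\<in>B. quad A b \<noteq> 0"
  proof (rule ccontr)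
    assume "\<not> ?thesis"
    then have "A = 0" using B by (intro eigenbasis_eqI [OF B]) (simp add: eigenbasis_def)
    then show False using assms by simp
  qed
  then have "eigenvalues A - {0} \<noteq> {}" by (auto simp: eigenvalues_eigenbasis [OF B A])
  moreover have "c > 0" if "c \<in> eigenvalues A - {0}" for c
    using that assms unfolding eigenvalues_eigenbasis [OF B A] 
    by (metis DiffE imageE insertI1 order_le_imp_less_or_eq psd_quad_nonneg)
  ultimately show ?thesis
    using A by (simp add: lambda_min_nonzero_def finite_eigenvalues)
qed

lemma eigenbasis_lambda_min_nonzero_le:
  assumes "symmetric A" "eigenbasis A B" "b \<in> B" "quad A b \<noteq> 0"
  shows "lambda_min_nonzero A \<le> quad A b"
  unfolding lambda_min_nonzero_def
proof (rule Min_le)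
  show "finite (eigenvalues A - {0})"
    by (intro finite_Diff finite_eigenvalues assms)
  show "quad A b \<in> eigenvalues A - {0}"
    unfolding eigenvalues_eigenbasis [OF assms(2,1)] using assms by blast
qed

text \<open>Eigenvectors in the kernel contribute \<open>inverse 0 = 0\<close>; every other
  eigenvalue is at least the smallest nonzero one.\<close>

lemma quad_pseudoinverse_le:
  assumes "psd A" "A \<noteq> 0"
  shows "quad (pseudoinverse A) x \<le> (norm x)\<^sup>2 / lambda_min_nonzero A"
proof -
  have A: "symmetric A" using assms by (simp add: psd_def)
  obtain B where B: "eigenbasis A B" using A eigenbasis_exists by blast
  have "inverse (quad A b) \<le> 1 / lambda_min_nonzero A" if "b \<in> B" for b
  proof (cases "quad A b = 0")
    case True
    then show ?thesis using lambda_min_nonzero_pos [OF assms] by simp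
  next
    case False
    then show ?thesis
      using eigenbasis_lambda_min_nonzero_le [OF A B that] lambda_min_nonzero_pos [OF assms]
      by (simp add: inverse_eq_divide frac_le)
  qed
  then have "quad (pseudoinverse A) x \<le> (\<Sum>b\<in>B. 1 / lambda_min_nonzero A * (x \<bullet> b)\<^sup>2)"
    unfolding pseudoinverse_eq_spectral_fun [OF B] quad_spectral_fun
    by (intro sum_mono mult_right_mono) auto
  then show ?thesis
    by (simp add: norm_eigenbasis [OF B] sum_divide_distrib)
qed

lemma lambda_min_nonzero_le_quad:
  assumes "psd A" "\<And>z. A *v z = 0 \<Longrightarrow> x \<bullet> z = 0"
  shows "lambda_min_nonzero A * (norm x)\<^sup>2 \<le> quad A x"
proof -
  have A: "symmetric A" using assms by (simp add: psd_def)
  obtain B where B: "eigenbasis A B" using A eigenbasis_exists by blast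
  have "lambda_min_nonzero A * (x \<bullet> b)\<^sup>2 \<le> quad A b * (x \<bullet> b)\<^sup>2" if "b \<in> B" for b
  proof (cases "quad A b = 0")
    case True
    then have "x \<bullet> b = 0" using assms(2) [of b] B that by (simp add: eigenbasis_def)
    then show ?thesis by simp
  next
    case False
    then show ?thesis
      using eigenbasis_lambda_min_nonzero_le [OF A B that] by (simp add: mult_right_mono)
  qed
  then show ?thesis
    by (simp add: norm_eigenbasis [OF B] quad_eigenbasis [OF B, of x] sum_distrib_left sum_mono)
qed

subsection \<open>Stacked vectors and block matrices\<close>

lemma component_add [simp]: "component (x + y) i = component x i + component y i"
  and component_diff [simp]: "component (x - y) i = component x i - component y i"
  and component_scaleR [simp]: "component (c *\<^sub>R x) i = c *\<^sub>R component x i"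
  and component_zero [simp]: "component 0 i = 0"
  and component_stack [simp]: "component (stack u) i = u i"
  by (simp_all add: component_def stack_def vec_eq_iff)

lemma component_eqI: "(\<And>i. component x i = component y i) \<Longrightarrow> x = y"
  by (auto simp: component_def vec_eq_iff)

lemma sum_pairs: "(\<Sum>p\<in>UNIV. f (p :: 'n::finite \<times> 'd::finite)) = (\<Sum>i\<in>UNIV. \<Sum>a\<in>UNIV. f (i, a))"
  by (simp add: sum.cartesian_product UNIV_Times_UNIV [symmetric] del: UNIV_Times_UNIV)

lemma inner_component: "x \<bullet> y = (\<Sum>i\<in>UNIV. component x i \<bullet> component y i)"
  by (simp add: inner_vec_def sum_pairs component_def)

lemma norm_component: "(norm x)\<^sup>2 = (\<Sum>i\<in>UNIV. (norm (component x i))\<^sup>2)"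
  by (simp add: power2_norm_eq_inner inner_component)

lemma component_block_diag: "component (block_diag B *v x) i = B i *v component x i"
proof -
  have "(\<Sum>i'\<in>UNIV. \<Sum>a'\<in>UNIV. (if i = i' then B i $ a $ a' else 0) * x $ (i', a'))
      = (\<Sum>i'\<in>UNIV. if i = i' then (\<Sum>a'\<in>UNIV. B i $ a $ a' * x $ (i, a')) else 0)" for a
    by (intro sum.cong) auto
  then show ?thesis
    by (simp add: vec_eq_iff component_def block_diag_def matrix_vector_mult_def sum_pairs cong: if_cong)
qed

lemma quad_block_diag: "quad (block_diag B) x = (\<Sum>i\<in>UNIV. quad (B i) (component x i))"
  by (simp add: quad_def inner_component component_block_diag)

lemma symmetric_block_diag: "(\<And>i. symmetric (B i)) \<Longrightarrow> symmetric (block_diag B)"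
  by (rule symmetricI) (simp add: inner_component component_block_diag symmetric_inner)

lemma component_kronecker:
  "component (kronecker P (mat 1) *v x) i = (\<Sum>j\<in>UNIV. P $ i $ j *\<^sub>R component x j)"
proof -
  have "(\<Sum>a'\<in>UNIV. P $ i $ j * mat 1 $ a $ a' * x $ (j, a')) = P $ i $ j * x $ (j, a)" for a j
  proof -
    have "(\<Sum>a'\<in>UNIV. P $ i $ j * mat 1 $ a $ a' * x $ (j, a'))
        = (\<Sum>a'\<in>UNIV. if a = a' then P $ i $ j * x $ (j, a) else 0)"
      by (intro sum.cong) (auto simp: mat_def)
    then show ?thesis by simp
  qed
  then show ?thesis
    by (simp add: vec_eq_iff component_def kronecker_def matrix_vector_mult_def sum_pairs)
qed

lemma component_kronecker_diag:
  "component (kronecker (diag a) (mat 1) *v x) i = a i *\<^sub>R component x i"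
proof -
  have "(\<Sum>j\<in>UNIV. diag a $ i $ j *\<^sub>R component x j)
      = (\<Sum>j\<in>UNIV. if i = j then a i *\<^sub>R component x i else 0)"
    by (intro sum.cong) (auto simp: diag_def)
  then show ?thesis by (simp add: component_kronecker)
qed

lemma quad_kronecker_diag:
  "quad (kronecker (diag a) (mat 1)) x = (\<Sum>i\<in>UNIV. a i * (norm (component x i))\<^sup>2)"
  by (simp add: quad_def inner_component component_kronecker_diag power2_norm_eq_inner)

lemma symmetric_kronecker_diag: "symmetric (kronecker (diag a) (mat 1))"
  by (rule symmetricI) (simp add: inner_component component_kronecker_diag)

lemma sum_sum_type:
  "(\<Sum>s\<in>UNIV. f (s :: 'a::finite + 'b::finite)) = (\<Sum>p\<in>UNIV. f (Inl p)) + (\<Sum>p\<in>UNIV. f (Inr p))"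
  by (simp add: UNIV_Plus_UNIV [symmetric] sum.Plus del: UNIV_Plus_UNIV)

lemma vec_join_diff: "vec_join x y - vec_join x' y' = vec_join (x - x') (y - y')"
  by (auto simp: vec_join_def vec_eq_iff split: sum.splits)

lemma quad_block_diag2: "quad (block_diag2 A B) (vec_join x y) = quad A x + quad B y"
  by (simp add: quad_def block_diag2_def vec_join_def inner_vec_def matrix_vector_mult_def
      sum_sum_type)

subsection \<open>The weighted graph Laplacian\<close>

locale weighted_graph =
  fixes E :: "('n::finite \<times> 'n) set" and p :: "'n \<Rightarrow> 'n \<Rightarrow> real"
  assumes graph: "connected_graph E"
    and weights: "\<And>i j. (i, j) \<in> E \<Longrightarrow> p i j = p j i \<and> p i j > 0"
begin

text \<open>The weights extended by zero, since \<open>p\<close> is arbitrary off the edges; sums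
  can then run over all pairs of agents.\<close>

definition cw :: "'n \<Rightarrow> 'n \<Rightarrow> real" where
  "cw i j = (if (i, j) \<in> E then p i j else 0)"

abbreviation L :: "real^('n \<times> 'd::finite)^('n \<times> 'd)" where
  "L \<equiv> kronecker (weight_matrix E p) (mat 1)"

lemma cw_commute: "cw i j = cw j i"
  using graph weights by (auto simp: cw_def connected_graph_def sym_def)

lemma cw_nonneg: "cw i j \<ge> 0"
  using weights by (auto simp: cw_def less_imp_le)

lemma component_L: "component (L *v x) i = (\<Sum>j\<in>UNIV. cw i j *\<^sub>R (component x i - component x j))"
proof -
  have "(\<Sum>s\<in>E `` {i}. p i s) = (\<Sum>s\<in>UNIV. if s \<in> E `` {i} then p i s else 0)"
    by (subst sum.inter_restrict [symmetric]) auto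
  also have "\<dots> = (\<Sum>s\<in>UNIV. cw i s)"
    by (intro sum.cong) (auto simp: cw_def)
  finally have deg: "(\<Sum>s\<in>E `` {i}. p i s) = (\<Sum>s\<in>UNIV. cw i s)" .
  have "(i, i) \<notin> E"
    using graph by (auto simp: connected_graph_def irrefl_def)
  then have "weight_matrix E p $ i $ j *\<^sub>R component x j
      = (if i = j then (\<Sum>s\<in>UNIV. cw i s) *\<^sub>R component x i else 0) - cw i j *\<^sub>R component x j" for j
    using deg by (auto simp: weight_matrix_def cw_def)
  then show ?thesis
    by (simp add: component_kronecker sum_subtractf scaleR_left.sum scaleR_diff_right)
qed

text \<open>Exchanging the names of \<open>i\<close> and \<open>j\<close> in the double sum and
  averaging the two forms gives the Dirichlet form; the factor 1/2 is there because each edge occurs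
  in both directions.\<close>

lemma inner_L:
  "y \<bullet> (L *v x) = (\<Sum>i\<in>UNIV. \<Sum>j\<in>UNIV. cw i j * ((component y i - component y j) \<bullet> (component x i - component x j))) / 2"
proof -
  let ?S = "\<Sum>i\<in>UNIV. \<Sum>j\<in>UNIV. cw i j * (component y i \<bullet> (component x i - component x j))"
  have 1: "y \<bullet> (L *v x) = ?S"
    by (simp add: inner_component component_L inner_sum_right)
  have "?S = (\<Sum>j\<in>UNIV. \<Sum>i\<in>UNIV. cw i j * (component y i \<bullet> (component x i - component x j)))"
    by (rule sum.swap)
  also have "\<dots> = (\<Sum>i\<in>UNIV. \<Sum>j\<in>UNIV. - (cw i j * (component y j \<bullet> (component x i - component x j))))"
    by (intro sum.cong refl) (simp add: cw_commute inner_diff_right algebra_simps)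
  finally have 2: "?S = \<dots>" .
  have "?S + ?S = (\<Sum>i\<in>UNIV. \<Sum>j\<in>UNIV. cw i j * ((component y i - component y j) \<bullet> (component x i - component x j)))"
    by (subst (2) 2) (simp add: sum.distrib [symmetric] inner_diff_left algebra_simps)
  then show ?thesis by (simp add: 1)
qed

lemma quad_L: "quad L x = (\<Sum>i\<in>UNIV. \<Sum>j\<in>UNIV. cw i j * (norm (component x i - component x j))\<^sup>2) / 2"
  by (simp add: quad_def inner_L power2_norm_eq_inner)

lemma symmetric_L: "symmetric L"
proof (rule symmetricI)
  fix x y
  have "(L *v x) \<bullet> y = y \<bullet> (L *v x)" by (rule inner_commute)
  also have "\<dots> = x \<bullet> (L *v y)" unfolding inner_L by (simp only: inner_commute)
  finally show "(L *v x) \<bullet> y = x \<bullet> (L *v y)" .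
qed

lemma psd_L: "psd L"
  by (simp add: psd_def symmetric_L quad_L sum_nonneg cw_nonneg)

lemma L_consensus [simp]: "L *v stack (\<lambda>_. a) = 0"
  by (rule component_eqI) (simp add: component_L)

text \<open>The Dirichlet form vanishes, so the blocks agree across every edge, and by connectedness
  along paths between any two agents.\<close>

lemma L_null_imp_consensus:
  assumes "L *v z = 0" shows "component z i = component z j"
proof -
  have "(\<Sum>i\<in>UNIV. \<Sum>j\<in>UNIV. cw i j * (norm (component z i - component z j))\<^sup>2) = 0"
    using assms quad_L [of z] by (simp add: quad_def)
  then have "cw i j * (norm (component z i - component z j))\<^sup>2 = 0" for i j
    by (simp add: sum_nonneg_eq_0_iff sum_nonneg cw_nonneg)
  then have edge: "component z i = component z j" if "(i, j) \<in> E" for i j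
    using that weights [OF that] by (force simp: cw_def)
  have "(i, j) \<in> E\<^sup>*" using graph by (simp add: connected_graph_def)
  then show ?thesis
    by (induction rule: rtrancl_induct) (use edge in auto)
qed

text \<open>Turns the invariant "agent sum zero" into orthogonality to the kernel of
  \<open>L\<close>, the condition under which the pseudoinverse cancels.\<close>

lemma orthogonal_L_null:
  assumes "(\<Sum>i\<in>UNIV. component y i) = 0" "L *v z = 0" shows "y \<bullet> z = 0"
proof -
  have "y \<bullet> z = (\<Sum>i\<in>UNIV. component y i) \<bullet> component z undefined"
    unfolding inner_component inner_sum_left
    by (intro sum.cong refl) (metis L_null_imp_consensus [OF assms(2)])
  then show ?thesis using assms(1) by simp
qed

text \<open>The range of \<open>L\<close> is orthogonal to the consensus vectors. Hence adding
  \<open>\<beta> *\<^sub>R (L *v x)\<close> to \<open>q\<close> preserves its agent sum.\<close>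

lemma sum_component_L: "(\<Sum>i\<in>UNIV. component (L *v x) i) = 0"
proof -
  have "(\<Sum>i\<in>UNIV. component (L *v x) i) \<bullet> a = 0" for a
  proof -
    have "(\<Sum>i\<in>UNIV. component (L *v x) i) \<bullet> a = (L *v x) \<bullet> stack (\<lambda>_. a)"
      by (simp add: inner_component inner_sum_left)
    then show ?thesis by (simp add: symmetric_inner [OF symmetric_L])
  qed
  then show ?thesis by (metis inner_eq_zero_iff)
qed

text \<open>A single agent would give the zero Laplacian, which has no nonzero eigenvalue; two
  agents make \<open>lamW\<close> meaningful.\<close>

lemma L_nonzero:
  assumes "CARD('n) \<ge> 2" shows "(L :: real^('n \<times> 'd::finite)^('n \<times> 'd)) \<noteq> 0"
proof
  assume "(L :: real^('n \<times> 'd)^('n \<times> 'd)) = 0"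
  then have eq: "component z i = component z j" for z :: "real^('n \<times> 'd)" and i j
    by (intro L_null_imp_consensus) simp
  obtain i j :: 'n where "i \<noteq> j"
    using assms by (metis UNIV_I card_2_iff' card_le_Suc0_iff_eq finite not_less_eq_eq numeral_2_eq_2)
  then show False
    using eq [of "stack (\<lambda>k. if k = i then 1 else 0)" i j] by (simp add: vec_eq_iff)
qed

end

subsection \<open>Gradients of smooth convex functions\<close>

lemma grad_eqI:
  assumes "GDERIV f x :> D" shows "grad f x = D"
  unfolding grad_def
proof (rule the_equality)
  fix D' assume "GDERIV f x :> D'"
  then have "(\<lambda>h. h \<bullet> D') = (\<lambda>h. h \<bullet> D)"
    using assms by (auto simp: gderiv_def intro: has_derivative_unique)
  then have "h \<bullet> D' = h \<bullet> D" for h by metis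
  then show "D' = D" by (metis vector_eq_rdot inner_commute)
qed (fact assms)

text \<open>Riesz representation: the derivative is the inner product with
  \<open>adjoint f' 1\<close>.\<close>

lemma GDERIV_grad:
  fixes f :: "'a::euclidean_space \<Rightarrow> real"
  assumes "f differentiable (at x)" shows "GDERIV f x :> grad f x"
proof -
  obtain f' where f': "(f has_derivative f') (at x)"
    using assms differentiable_def by blast
  then have "linear f'" by (rule has_derivative_linear)
  then have "f' = (\<lambda>h. h \<bullet> adjoint f' 1)"
    by (simp add: fun_eq_iff adjoint_works)
  then have "GDERIV f x :> adjoint f' 1"
    using f' by (simp add: gderiv_def)
  then show ?thesis using grad_eqI by metis
qed

lemma GDERIV_imp_DERIV_line:
  assumes "GDERIV f (x + t *\<^sub>R d) :> D"
  shows "((\<lambda>t. f (x + t *\<^sub>R d)) has_real_derivative d \<bullet> D) (at t)"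
proof -
  have "((\<lambda>t. x + t *\<^sub>R d) has_derivative (\<lambda>h. h *\<^sub>R d)) (at t)"
    by (auto intro!: derivative_eq_intros)
  moreover have "(f has_derivative (\<lambda>h. h \<bullet> D)) (at (x + t *\<^sub>R d))"
    using assms by (simp add: gderiv_def)
  ultimately have "((\<lambda>t. f (x + t *\<^sub>R d)) has_derivative (\<lambda>h. (h *\<^sub>R d) \<bullet> D)) (at t)"
    by (rule has_derivative_compose)
  then show ?thesis
    by (simp add: has_field_derivative_def mult_commute_abs)
qed

locale smooth_convex =
  fixes f :: "'a::real_inner \<Rightarrow> real" and g :: "'a \<Rightarrow> 'a" and M :: real
  assumes gderiv: "\<And>x. GDERIV f x :> g x"
    and convex: "convex_on UNIV f"
    and M_pos: "M > 0"
    and lipschitz: "\<And>x y. norm (g x - g y) \<le> M * norm (x - y)"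
begin

text \<open>By convexity every difference quotient with \<open>0 < t < 1\<close> is at most
  \<open>f (x + d) - f x\<close>; let \<open>t\<close> decrease to 0.\<close>

lemma above_tangent: "f x + d \<bullet> g x \<le> f (x + d)"
proof -
  have "((\<lambda>t. (f (x + t *\<^sub>R d) - f x) / t) \<longlongrightarrow> d \<bullet> g x) (at_right 0)"
    using GDERIV_imp_DERIV_line [of f x 0 d "g x"] gderiv [of x]
    by (simp add: has_field_derivative_iff filterlim_at_split)
  moreover have "eventually (\<lambda>t. (f (x + t *\<^sub>R d) - f x) / t \<le> f (x + d) - f x) (at_right (0::real))"
    unfolding eventually_at_right_field
  proof (intro exI [of _ 1] conjI allI impI)
    fix t :: real assume t: "0 < t" "t < 1"
    have "f (x + t *\<^sub>R d) = f ((1 - t) *\<^sub>R x + t *\<^sub>R (x + d))"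
      by (simp add: algebra_simps)
    also have "\<dots> \<le> (1 - t) * f x + t * f (x + d)"
      using convex t by (intro convex_onD) auto
    finally show "(f (x + t *\<^sub>R d) - f x) / t \<le> f (x + d) - f x"
      using t by (simp add: field_simps)
  qed auto
  ultimately have "d \<bullet> g x \<le> f (x + d) - f x"
    by (intro tendsto_upperbound) auto
  then show ?thesis by simp
qed

lemma descent: "f (x + d) \<le> f x + d \<bullet> g x + M / 2 * (norm d)\<^sup>2"
proof -
  \<comment> \<open>\<open>h\<close> is \<open>f\<close> along the segment with the linear and
    quadratic terms of the upper model subtracted; the Lipschitz bound makes its derivative
    nonpositive.\<close>
  define h where "h t = f (x + t *\<^sub>R d) - t * (d \<bullet> g x) - M / 2 * t\<^sup>2 * (norm d)\<^sup>2" for t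
  have "h 1 \<le> h 0"
  proof (rule DERIV_nonpos_imp_nonincreasing [of 0 1 h])
    fix t :: real assume t: "0 \<le> t" "t \<le> 1"
    let ?D = "d \<bullet> g (x + t *\<^sub>R d) - d \<bullet> g x - M * t * (norm d)\<^sup>2"
    have "(h has_real_derivative ?D) (at t)"
      unfolding h_def
      by (rule derivative_eq_intros GDERIV_imp_DERIV_line gderiv refl | simp)+
    moreover have "d \<bullet> (g (x + t *\<^sub>R d) - g x) \<le> norm d * (M * norm (x + t *\<^sub>R d - x))"
      by (intro order_trans [OF norm_cauchy_schwarz] mult_left_mono lipschitz) auto
    then have "?D \<le> 0"
      using t by (simp add: inner_diff_right power2_eq_square algebra_simps)
    ultimately show "\<exists>y. (h has_real_derivative y) (at t) \<and> y \<le> 0" by blast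
  qed simp
  then show ?thesis by (simp add: h_def)
qed

text \<open>The convex function \<open>f - \<langle>g x, \<cdot>\<rangle>\<close> is minimal at \<open>x\<close>; compare its value there with the one after a
  gradient step from \<open>y\<close>.\<close>

lemma above_tangent_strong:
  "f x + (y - x) \<bullet> g x + (norm (g y - g x))\<^sup>2 / (2 * M) \<le> f y"
proof -
  define r where "r = g y - g x"
  define d where "d = (-1 / M) *\<^sub>R r"
  have "f x + (y + d - x) \<bullet> g x \<le> f (y + d)"
    using above_tangent [of x "y + d - x"] by simp
  also have "\<dots> \<le> f y + d \<bullet> g y + M / 2 * (norm d)\<^sup>2"
    by (rule descent)
  finally have "f x + (y - x) \<bullet> g x \<le> f y + d \<bullet> r + M / 2 * (norm d)\<^sup>2"
    by (simp add: r_def inner_diff_right inner_diff_left inner_add_left)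
  moreover have "d \<bullet> r + M / 2 * (norm d)\<^sup>2 = - ((norm r)\<^sup>2 / (2 * M))"
    using M_pos by (simp add: d_def power2_norm_eq_inner [symmetric] field_simps power2_eq_square)
  ultimately have "f x + (y - x) \<bullet> g x \<le> f y - (norm r)\<^sup>2 / (2 * M)"
    by linarith
  then show ?thesis by (simp add: r_def)
qed

text \<open>The Baillon-Haddad inequality: add the strengthened tangent bound to itself with the two
  points exchanged.\<close>

lemma cocoercive: "(norm (g x - g y))\<^sup>2 / M \<le> (x - y) \<bullet> (g x - g y)"
  using above_tangent_strong [of x y] above_tangent_strong [of y x] 
  by (simp add: inner_diff_left inner_diff_right norm_minus_commute)

end

subsection \<open>The consensus problem\<close>

lemma GDERIV_sum:
  "(\<And>i. i \<in> I \<Longrightarrow> GDERIV (f i) x :> D i) \<Longrightarrow> GDERIV (\<lambda>x. \<Sum>i\<in>I. f i x) x :> (\<Sum>i\<in>I. D i)"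
  by (auto simp: gderiv_def inner_sum_right intro!: has_derivative_sum)

lemma GDERIV_cmult: "GDERIV f x :> D \<Longrightarrow> GDERIV (\<lambda>x. c * f x) x :> c *\<^sub>R D"
  using has_derivative_mult_right [of f "\<lambda>h. h \<bullet> D" "at x" c] by (simp add: gderiv_def)

lemma convex_on_finite_sum:
  assumes "finite I" "convex S" "\<And>i. i \<in> I \<Longrightarrow> convex_on S (f i)"
  shows "convex_on S (\<lambda>x. \<Sum>i\<in>I. f i x :: real)"
  using assms
proof (induction I rule: finite_induct)
  case empty
  then show ?case by (simp add: convex_on_const)
qed (auto intro!: convex_on_add)

lemma norm_average_le:
  assumes "\<And>j. j \<in> A \<Longrightarrow> norm (u j) \<le> c" "finite A" "c \<ge> 0"
  shows "norm ((1 / real (card A)) *\<^sub>R (\<Sum>j\<in>A. u j)) \<le> c"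
proof -
  have "norm (\<Sum>j\<in>A. u j) \<le> real (card A) * c"
    using sum_norm_bound [of A u c] assms by simp
  then have "norm (\<Sum>j\<in>A. u j) / real (card A) \<le> c"
    using assms(3) by (cases "card A = 0") (simp_all add: field_simps)
  then show ?thesis by simp
qed

locale consensus = weighted_graph E p
  for E :: "('n::finite \<times> 'n) set" and p :: "'n \<Rightarrow> 'n \<Rightarrow> real" +
  fixes l :: "'n \<Rightarrow> 'c::finite \<Rightarrow> real^'d \<Rightarrow> real^'m \<Rightarrow> real"
    and dat :: "'n \<Rightarrow> 'c \<Rightarrow> real^'m"
    and xopt :: "real^'d" and mf :: real and Mi :: "'n \<Rightarrow> real"
  assumes assumption1: "assumption1 l dat xopt mf Mi"
    and card_agents: "CARD('n) \<ge> 2"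
begin

abbreviation fi :: "'n \<Rightarrow> real^'d \<Rightarrow> real" where "fi \<equiv> local_loss l dat"

definition gf :: "'n \<Rightarrow> real^'d \<Rightarrow> real^'d" where "gf i = grad (fi i)"

definition F :: "real^('n \<times> 'd) \<Rightarrow> real^('n \<times> 'd)" where
  "F x = stack (\<lambda>i. gf i (component x i))"

abbreviation gl :: "'n \<Rightarrow> 'c \<Rightarrow> real^'d \<Rightarrow> real^'d" where "gl i j \<equiv> grad (\<lambda>x. l i j x (dat i j))"

lemma mf_pos: "mf > 0" and Mi_pos: "Mi i > 0"
  using assumption1 by (auto simp: assumption1_def)

lemma GDERIV_sample: "GDERIV (\<lambda>x. l i j x (dat i j)) x :> gl i j x"
  using assumption1 by (intro GDERIV_grad) (auto simp: assumption1_def twice_cont_diff_def)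

lemma GDERIV_fi': "GDERIV (fi i) x :> (1 / real CARD('c)) *\<^sub>R (\<Sum>j\<in>UNIV. gl i j x)"
  unfolding local_loss_def by (intro GDERIV_cmult GDERIV_sum GDERIV_sample)

lemma gf_eq: "gf i x = (1 / real CARD('c)) *\<^sub>R (\<Sum>j\<in>UNIV. gl i j x)"
  unfolding gf_def by (intro grad_eqI GDERIV_fi')

lemma GDERIV_fi: "GDERIV (fi i) x :> gf i x"
  using GDERIV_fi' by (simp add: gf_eq)

lemma gf_lipschitz: "norm (gf i x - gf i y) \<le> Mi i * norm (x - y)"
proof -
  have "norm (gl i j x - gl i j y) \<le> Mi i * norm (x - y)" for j
    using assumption1 by (auto simp: assumption1_def lipschitz_on_def dist_norm)
  then have "norm ((1 / real CARD('c)) *\<^sub>R (\<Sum>j\<in>UNIV. gl i j x - gl i j y)) \<le> Mi i * norm (x - y)"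
    using Mi_pos [of i] by (intro norm_average_le) auto
  then show ?thesis
    by (simp only: gf_eq sum_subtractf scaleR_diff_right)
qed

sublocale smooth_convex "fi i" "gf i" "Mi i" for i
proof
  have "convex_on UNIV (\<lambda>x. l i j x (dat i j))" for j
    using assumption1 by (auto simp: assumption1_def)
  then show "convex_on UNIV (fi i)"
    unfolding local_loss_def by (intro convex_on_cmul convex_on_finite_sum) auto
qed (use GDERIV_fi Mi_pos gf_lipschitz in auto)

lemma grad_stacked_loss: "grad (stacked_loss l dat) x = F x"
proof (rule grad_eqI)
  have lin: "((\<lambda>x :: real^('n \<times> 'd). component x i) has_derivative (\<lambda>h. component h i)) (at x)" for i
    by (intro bounded_linear_imp_has_derivative linear_conv_bounded_linear [THEN iffD1] linearI) auto
  have "((\<lambda>x. fi i (component x i)) has_derivative (\<lambda>h. component h i \<bullet> gf i (component x i))) (at x)" for i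
    using GDERIV_fi [of i "component x i"] unfolding gderiv_def
    by (rule has_derivative_compose [OF lin])
  then have "((\<lambda>x. \<Sum>i\<in>UNIV. fi i (component x i)) has_derivative
      (\<lambda>h. \<Sum>i\<in>UNIV. component h i \<bullet> gf i (component x i))) (at x)"
    by (intro has_derivative_sum) auto
  then show "GDERIV (stacked_loss l dat) x :> F x"
    by (simp add: gderiv_def stacked_loss_def [abs_def] inner_component F_def)
qed

lemma GDERIV_global_loss: "GDERIV (global_loss l dat) x :> (\<Sum>i\<in>UNIV. gf i x)"
  unfolding global_loss_def by (intro GDERIV_sum GDERIV_fi)

lemma grad_global_loss: "grad (global_loss l dat) x = (\<Sum>i\<in>UNIV. gf i x)"
  by (intro grad_eqI GDERIV_global_loss)

text \<open>Fermat's rule at the minimiser. It gives \<open>F xs\<close> agent sum zero, which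
  together with \<open>q\<close> makes the dual error orthogonal to the consensus vectors.\<close>

lemma sum_gf_xopt: "(\<Sum>i\<in>UNIV. gf i xopt) = 0"
proof -
  have "(\<lambda>h. h \<bullet> (\<Sum>i\<in>UNIV. gf i xopt)) = (\<lambda>h. 0)"
    using GDERIV_global_loss [of xopt] assumption1
    by (intro differential_zero_maxmin [of xopt UNIV "global_loss l dat"])
      (auto simp: gderiv_def assumption1_def)
  then have "h \<bullet> (\<Sum>i\<in>UNIV. gf i xopt) = 0" for h by metis
  then show ?thesis by (metis inner_eq_zero_iff)
qed

definition xs :: "real^('n \<times> 'd)" where "xs = stack (\<lambda>_. xopt)"

definition M :: real where "M = Max (range Mi)"

lemma Mi_le_M: "Mi i \<le> M" and M_pos': "M > 0"
proof -
  show le: "Mi i \<le> M" for i by (simp add: M_def)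
  show "M > 0" using le [of undefined] Mi_pos [of undefined] by linarith
qed

lemma F_lipschitz: "norm (F x - F y) \<le> M * norm (x - y)"
proof (rule power2_le_imp_le)
  have "(norm (F x - F y))\<^sup>2 \<le> (\<Sum>i\<in>UNIV. (M * norm (component x i - component y i))\<^sup>2)"
    unfolding norm_component
    by (intro sum_mono power_mono)
      (auto simp: F_def intro!: order_trans [OF gf_lipschitz] mult_right_mono Mi_le_M)
  then show "(norm (F x - F y))\<^sup>2 \<le> (M * norm (x - y))\<^sup>2"
    by (simp add: power_mult_distrib sum_distrib_left norm_component)
qed (use M_pos' in auto)

text \<open>The constants \<open>Mi i\<close> are kept agent by agent rather than replaced by
  \<open>M\<close>, so that the coupling of gradients and step is absorbed by
  \<open>quad LM\<close>, as in the condition on \<open>D\<close>.\<close>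

lemma F_cocoercive:
  "(\<Sum>i\<in>UNIV. (norm (component (F x - F y) i))\<^sup>2 / Mi i) \<le> (x - y) \<bullet> (F x - F y)"
  unfolding inner_component by (intro sum_mono) (simp add: F_def cocoercive)

lemma F_monotone: "0 \<le> (x - y) \<bullet> (F x - F y)"
  using Mi_pos by (intro order_trans [OF _ F_cocoercive]) (auto intro!: sum_nonneg simp: less_imp_le)

lemma norm_F_diff_le:
  "(norm (F x - F y))\<^sup>2 \<le> (\<Sum>i\<in>UNIV. (Mi i)\<^sup>2 * (norm (component (x - y) i))\<^sup>2)"
  unfolding norm_component power_mult_distrib [symmetric]
  by (intro sum_mono power_mono) (auto simp: F_def gf_lipschitz)

lemma sum_component_F_xs: "(\<Sum>i\<in>UNIV. component (F xs) i) = 0"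
  by (simp add: F_def xs_def sum_gf_xopt)

lemma psd_L': "psd (L :: real^('n \<times> 'd)^('n \<times> 'd))" and L_nonzero': "(L :: real^('n \<times> 'd)^('n \<times> 'd)) \<noteq> 0"
  using psd_L L_nonzero card_agents by auto

definition lamW :: real where "lamW = lambda_min_nonzero (L :: real^('n \<times> 'd)^('n \<times> 'd))"

lemma lamW_pos: "lamW > 0"
  unfolding lamW_def by (intro lambda_min_nonzero_pos psd_L' L_nonzero')

text \<open>The error is split into its consensus part \<open>b\<close>, where the global restricted strong convexity
  applies, and the orthogonal part \<open>r\<close>, which the Laplacian penalises.\<close>

lemma restricted_strong_convexity_aux:
  assumes \<beta>: "\<beta> > 0" and \<gamma>: "\<gamma> > 0"
  shows "min (mf / real CARD('n) - 2 * M * \<gamma>) (\<beta> * (lamW / (2 * (1 + 1 / \<gamma>\<^sup>2)))) * (norm (x - xs))\<^sup>2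
    \<le> (x - xs) \<bullet> (F x - F xs) + \<beta> / 2 * quad L (x - xs)"
    (is "?\<zeta> * _ \<le> _")
proof -
  define N where "N = real CARD('n)"
  have N: "N > 0" by (simp add: N_def)
  define e where "e = x - xs"
  define a where "a = (1 / N) *\<^sub>R (\<Sum>i\<in>UNIV. component e i)"
  define b :: "real^('n \<times> 'd)" where "b = stack (\<lambda>_. a)"
  define r where "r = e - b"
  have "(\<Sum>i\<in>(UNIV :: 'n set). a) = N *\<^sub>R a"
    by (simp only: sum_constant_scaleR N_def)
  then have r0: "(\<Sum>i\<in>UNIV. component r i) = 0"
    using N by (simp add: r_def b_def sum_subtractf del: sum_constant) (simp add: a_def)
  have "b \<bullet> r = a \<bullet> (\<Sum>i\<in>UNIV. component r i)"
    by (simp add: inner_component b_def inner_sum_right)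
  then have orth: "b \<bullet> r = 0" by (simp add: r0)
  have e: "e = b + r" by (simp add: r_def)
  have norm_e: "(norm e)\<^sup>2 = (norm b)\<^sup>2 + (norm r)\<^sup>2"
    using orth by (simp add: e power2_norm_eq_inner inner_add_left inner_add_right inner_commute)
  \<comment> \<open>The vector \<open>b\<close> holds one copy of \<open>a\<close> per agent, so
    strong convexity of the global loss in \<open>a\<close> becomes the constant
    \<open>mf / N\<close> for \<open>b\<close>.\<close>
  have norm_b: "(norm b)\<^sup>2 = N * (norm a)\<^sup>2"
    by (simp add: norm_component b_def N_def)
  have "quad L e = quad L r"
    by (simp add: e quad_def matrix_vector_right_distrib inner_add_left symmetric_inner [OF symmetric_L, symmetric] b_def)
  moreover have "lamW * (norm r)\<^sup>2 \<le> quad L r"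
    unfolding lamW_def using r0 by (intro lambda_min_nonzero_le_quad psd_L') (simp add: orthogonal_L_null)
  ultimately have quad: "lamW * (norm r)\<^sup>2 \<le> quad L e" by simp
  define T where "T = e \<bullet> (F x - F xs)"
  have T0: "T \<ge> 0" unfolding T_def e_def by (rule F_monotone)
  \<comment> \<open>The projection of \<open>x\<close> onto the consensus vectors. Passing through
    \<open>y\<close> splits \<open>T\<close> into four products: one bounded below by restricted
    strong convexity, two cross terms that each cost \<open>M * norm b * norm r\<close>, and one
    that is nonnegative by monotonicity.\<close>
  define y where "y = xs + b"
  have xy: "x - y = r" by (simp add: y_def r_def e_def)
  have "b \<bullet> (F y - F xs) = a \<bullet> (grad (global_loss l dat) (xopt + a) - grad (global_loss l dat) xopt)"
    by (simp add: inner_component b_def F_def y_def xs_def grad_global_loss inner_sum_right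
        sum_subtractf [symmetric] inner_diff_right)
  also have "\<dots> \<ge> mf * (norm a)\<^sup>2"
    using assumption1 unfolding assumption1_def
    by (metis add_diff_cancel_left' inner_commute)
  finally have 1: "b \<bullet> (F y - F xs) \<ge> mf / N * (norm b)\<^sup>2"
    using N by (simp add: norm_b)
  have 2: "r \<bullet> (F y - F xs) \<ge> - (M * norm b * norm r)"
  proof -
    have "\<bar>r \<bullet> (F y - F xs)\<bar> \<le> norm r * (M * norm (y - xs))"
      by (intro order_trans [OF Cauchy_Schwarz_ineq2] mult_left_mono F_lipschitz) auto
    then show ?thesis by (simp add: y_def mult_ac)
  qed
  have 3: "b \<bullet> (F x - F y) \<ge> - (M * norm b * norm r)"
  proof -
    have "\<bar>b \<bullet> (F x - F y)\<bar> \<le> norm b * (M * norm (x - y))"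
      by (intro order_trans [OF Cauchy_Schwarz_ineq2] mult_left_mono F_lipschitz) auto
    then show ?thesis by (simp add: xy mult_ac)
  qed
  have 4: "r \<bullet> (F x - F y) \<ge> 0" using F_monotone [of x y] by (simp add: xy)
  have "T = b \<bullet> (F y - F xs) + r \<bullet> (F y - F xs) + b \<bullet> (F x - F y) + r \<bullet> (F x - F y)"
    by (simp add: T_def e inner_diff_right inner_add_left)
  then have T: "T \<ge> mf / N * (norm b)\<^sup>2 - 2 * M * norm b * norm r"
    using 1 2 3 4 by linarith
  \<comment> \<open>\<open>\<gamma>\<close> is the threshold for the ratio of \<open>norm r\<close>
    to \<open>norm b\<close>. Below it the cross terms cost at most \<open>2 * M * \<gamma>\<close>
    times the square of \<open>norm b\<close>; above it the error is dominated by \<open>r\<close>,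
    and the Laplacian penalty alone suffices, with \<open>T\<close> merely nonnegative.\<close>
  have "?\<zeta> * (norm e)\<^sup>2 \<le> T + \<beta> / 2 * (lamW * (norm r)\<^sup>2)"
  proof (cases "norm r \<le> \<gamma> * norm b")
    case True
    have "M * norm b * norm r \<le> M * norm b * (\<gamma> * norm b)"
      using True M_pos' by (intro mult_left_mono) auto
    then have "(mf / N - 2 * M * \<gamma>) * (norm b)\<^sup>2 \<le> T"
      using T by (simp add: algebra_simps power2_eq_square)
    moreover have "?\<zeta> * (norm b)\<^sup>2 \<le> (mf / N - 2 * M * \<gamma>) * (norm b)\<^sup>2"
      by (intro mult_right_mono) (auto simp: N_def)
    moreover have "\<beta> * (lamW / (2 * (1 + 1 / \<gamma>\<^sup>2))) \<le> \<beta> * (lamW / 2)"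
      using \<beta> \<gamma> lamW_pos by (intro mult_left_mono divide_left_mono) (auto intro!: add_pos_nonneg)
    then have "?\<zeta> * (norm r)\<^sup>2 \<le> \<beta> * (lamW / 2) * (norm r)\<^sup>2"
      by (intro mult_right_mono) (rule order_trans [OF min.cobounded2], auto)
    ultimately show ?thesis by (simp add: norm_e algebra_simps)
  next
    case False
    then have "(\<gamma> * norm b)\<^sup>2 \<le> (norm r)\<^sup>2"
      using \<gamma> by (intro power_mono) auto
    then have "(norm e)\<^sup>2 \<le> (1 + 1 / \<gamma>\<^sup>2) * (norm r)\<^sup>2"
      using \<gamma> by (simp add: norm_e field_simps power_mult_distrib)
    then have "\<beta> * (lamW / (2 * (1 + 1 / \<gamma>\<^sup>2))) * (norm e)\<^sup>2
        \<le> \<beta> * (lamW / (2 * (1 + 1 / \<gamma>\<^sup>2))) * ((1 + 1 / \<gamma>\<^sup>2) * (norm r)\<^sup>2)"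
      using \<beta> \<gamma> lamW_pos by (intro mult_left_mono) (auto intro!: mult_nonneg_nonneg divide_nonneg_nonneg)
    also have "\<dots> = \<beta> / 2 * (lamW * (norm r)\<^sup>2)"
    proof -
      have "1 + 1 / \<gamma>\<^sup>2 > 0" using \<gamma> by (simp add: add_pos_nonneg)
      then show ?thesis by (simp add: field_simps)
    qed
    finally have "\<beta> * (lamW / (2 * (1 + 1 / \<gamma>\<^sup>2))) * (norm e)\<^sup>2 \<le> T + \<beta> / 2 * (lamW * (norm r)\<^sup>2)"
      using T0 by linarith
    moreover have "?\<zeta> * (norm e)\<^sup>2 \<le> \<beta> * (lamW / (2 * (1 + 1 / \<gamma>\<^sup>2))) * (norm e)\<^sup>2"
      by (intro mult_right_mono) auto
    ultimately show ?thesis by linarith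
  qed
  also have "\<dots> \<le> T + \<beta> / 2 * quad L e"
    using quad \<beta> by simp
  finally show ?thesis by (simp add: e_def T_def)
qed

definition mbeta :: "real \<Rightarrow> real" where
  "mbeta \<beta> = (SUP \<gamma>\<in>{0<..}.
     min (mf / real CARD('n) - 2 * M * \<gamma>) (\<beta> * (lamW / (2 * (1 + 1 / \<gamma>\<^sup>2)))))"

text \<open>Each \<open>\<gamma> > 0\<close> gives a lower bound with the same right-hand side, so
  the bound passes to the supremum.\<close>

lemma restricted_strong_convexity:
  assumes \<beta>: "\<beta> > 0"
  shows "mbeta \<beta> * (norm (x - xs))\<^sup>2 \<le> (x - xs) \<bullet> (F x - F xs) + \<beta> / 2 * quad L (x - xs)"
proof (cases "x = xs")
  case False
  then have pos: "(norm (x - xs))\<^sup>2 > 0" by simp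
  have "mbeta \<beta> \<le> ((x - xs) \<bullet> (F x - F xs) + \<beta> / 2 * quad L (x - xs)) / (norm (x - xs))\<^sup>2"
    unfolding mbeta_def
    by (rule cSUP_least) (use restricted_strong_convexity_aux [OF \<beta>] pos in \<open>auto simp: pos_le_divide_eq\<close>)
  then show ?thesis using pos by (simp add: pos_le_divide_eq)
qed (simp add: quad_def)

lemma mbeta_pos:
  assumes \<beta>: "\<beta> > 0" shows "mbeta \<beta> > 0"
proof -
  \<comment> \<open>Chosen so that the first entry of the minimum becomes half of
    \<open>mf / N\<close>.\<close>
  define \<gamma> where "\<gamma> = mf / (4 * M * real CARD('n))"
  have \<gamma>: "\<gamma> > 0" using mf_pos M_pos' by (simp add: \<gamma>_def)
  have "0 < min (mf / real CARD('n) - 2 * M * \<gamma>) (\<beta> * (lamW / (2 * (1 + 1 / \<gamma>\<^sup>2))))"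
  proof -
    have "mf / real CARD('n) - 2 * M * \<gamma> = mf / (2 * real CARD('n))"
      using M_pos' by (simp add: \<gamma>_def field_simps)
    moreover have "1 + 1 / \<gamma>\<^sup>2 > 0" using \<gamma> by (simp add: add_pos_nonneg)
    ultimately show ?thesis using mf_pos \<beta> lamW_pos by simp
  qed
  also have "\<dots> \<le> mbeta \<beta>"
    unfolding mbeta_def
  proof (rule cSUP_upper)
    show "bdd_above ((\<lambda>\<gamma>. min (mf / real CARD('n) - 2 * M * \<gamma>) (\<beta> * (lamW / (2 * (1 + 1 / \<gamma>\<^sup>2))))) ` {0<..})"
      using M_pos' by (intro bdd_aboveI2 [where M = "mf / real CARD('n)"]) (auto intro!: min.coboundedI1)
  qed (use \<gamma> in auto)
  finally show ?thesis .
qed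

end

subsection \<open>One step of the iteration\<close>

lemma two_inner_le:
  fixes a b :: "'a::real_inner"
  assumes "c > 0" shows "2 * (a \<bullet> b) \<le> c * (norm a)\<^sup>2 + (norm b)\<^sup>2 / c"
proof -
  have "0 \<le> c * (norm (a - (1 / c) *\<^sub>R b))\<^sup>2" using assms by simp
  also have "\<dots> = c * (norm a)\<^sup>2 - 2 * (a \<bullet> b) + (norm b)\<^sup>2 / c"
    using assms unfolding power2_norm_eq_inner
    by (simp add: inner_diff_left inner_diff_right inner_commute field_simps power2_eq_square)
  finally show ?thesis by simp
qed

text \<open>Removes the square root: distances in the variable \<open>v\<close> become values of the
  form of the pseudoinverse in the variable \<open>q\<close>.\<close>

lemma psd_pseudoinverse_sqrt_norm:
  assumes "psd A"
  shows "(norm (psd_sqrt (pseudoinverse A) *v y))\<^sup>2 = quad (pseudoinverse A) y"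
  using psd_sqrt [OF psd_pseudoinverse [OF assms]] quad_square [of "psd_sqrt (pseudoinverse A)" y]
  by (simp add: psd_def)

lemma loewner_between_symmetric:
  assumes "c *\<^sub>R mat 1 \<preceq>\<^sub>L B" shows "symmetric B"
proof -
  have "symmetric ((B - c *\<^sub>R mat 1) + c *\<^sub>R mat 1)"
    using assms by (intro symmetric_add symmetric_scaleR symmetric_mat) (auto simp: loewner_le_def psd_def)
  then show ?thesis by simp
qed

lemma loewner_lower: "c *\<^sub>R mat 1 \<preceq>\<^sub>L B \<Longrightarrow> c * (norm x)\<^sup>2 \<le> quad B x"
  and loewner_upper: "B \<preceq>\<^sub>L c *\<^sub>R mat 1 \<Longrightarrow> quad B x \<le> c * (norm x)\<^sup>2"
  unfolding loewner_le_def psd_def by (auto simp: quad_simps dest!: spec [of _ x])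

text \<open>The matrices and \<open>\<kappa>\<close> are parameters tied by equations, so the
  symbols of the final statement can be substituted for them directly.\<close>

locale sopro = consensus E p l dat xopt mf Mi
  for E :: "('n::finite \<times> 'n) set" and p :: "'n \<Rightarrow> 'n \<Rightarrow> real"
    and l :: "'n \<Rightarrow> 'c::finite \<Rightarrow> real^'d \<Rightarrow> real^'m \<Rightarrow> real"
    and dat :: "'n \<Rightarrow> 'c \<Rightarrow> real^'m"
    and xopt :: "real^'d" and mf :: real and Mi :: "'n \<Rightarrow> real" +
  fixes mi :: "'n \<Rightarrow> real" and Di :: "'n \<Rightarrow> real^'d^'d" and \<beta> \<eta> :: real
    and D Lm LM R :: "real^('n \<times> 'd)^('n \<times> 'd)" and \<kappa> :: "real \<Rightarrow> real"
  assumes m_i: "hessian_bounds l mi Mi"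
    and \<beta>: "\<beta> > 0"
    and \<eta>: "0 < \<eta>" "\<eta> < 1"
    and D_def: "D = block_diag Di"
    and D_sym: "\<And>i. symmetric (Di i)"
    and Lm_def: "Lm = kronecker (diag mi) (mat 1)"
    and LM_def: "LM = kronecker (diag Mi) (mat 1)"
    and R_def: "R = (1/2) *\<^sub>R (Lm + LM) + D"
    and \<kappa>_def: "\<And>c0. \<kappa> c0 = lambda_min (R - (1 / (2 * (1 - \<eta>))) *\<^sub>R LM
          - (1 / (4 * c0)) *\<^sub>R ((LM - Lm) ** (LM - Lm))
          + Lm - LM - \<beta> *\<^sub>R ((1/2) *\<^sub>R mat 1 + L))"
    and D_large: "(1 / (2 * (1 - \<eta>))) *\<^sub>R LM
          + (1 / (8 * \<eta> * mbeta \<beta>)) *\<^sub>R ((LM - Lm) ** (LM - Lm))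
          + (1/2) *\<^sub>R (LM - 3 *\<^sub>R Lm) + \<beta> *\<^sub>R ((1/2) *\<^sub>R mat 1 + L) \<prec>\<^sub>L D"
begin

text \<open>\<open>L\<close> is polymorphic in the dimension of the blocks; \<open>LL\<close> is its instance for this problem.\<close>

abbreviation LL :: "real^('n \<times> 'd)^('n \<times> 'd)" where "LL \<equiv> L"

abbreviation Wp :: "real^('n \<times> 'd)^('n \<times> 'd)" where "Wp \<equiv> pseudoinverse LL"

lemma mi_bounds: "0 \<le> mi i" "mi i \<le> Mi i"
  using m_i by (auto simp: hessian_bounds_def)

lemma sym_D: "symmetric D" and sym_Lm: "symmetric Lm" and sym_LM: "symmetric LM"
  by (simp_all add: D_def Lm_def LM_def symmetric_block_diag D_sym symmetric_kronecker_diag)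

lemmas sym_intros = symmetric_intros sym_D sym_Lm sym_LM symmetric_L

lemma sym_R: "symmetric R"
  unfolding R_def by (intro sym_intros)

lemma quad_Lm: "quad Lm x = (\<Sum>i\<in>UNIV. mi i * (norm (component x i))\<^sup>2)"
  and quad_LM: "quad LM x = (\<Sum>i\<in>UNIV. Mi i * (norm (component x i))\<^sup>2)"
  by (simp_all add: Lm_def LM_def quad_kronecker_diag)

lemma component_LM_diff: "component ((LM - Lm) *v x) i = (Mi i - mi i) *\<^sub>R component x i"
  by (simp add: LM_def Lm_def matrix_vector_mult_diff_rdistrib component_kronecker_diag scaleR_diff_left)

lemma quad_LM_diff_square:
  "quad ((LM - Lm) ** (LM - Lm)) x = (\<Sum>i\<in>UNIV. ((Mi i - mi i) * norm (component x i))\<^sup>2)"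
  by (simp add: quad_square sym_intros norm_component component_LM_diff power_mult_distrib)

lemma quad_LM_square: "quad (LM ** LM) x = (\<Sum>i\<in>UNIV. (Mi i)\<^sup>2 * (norm (component x i))\<^sup>2)"
  unfolding quad_square [OF sym_LM] norm_component
  by (simp add: LM_def component_kronecker_diag power_mult_distrib)

lemma quad_Lm_nonneg: "0 \<le> quad Lm x" and quad_Lm_le_LM: "quad Lm x \<le> quad LM x"
  by (auto simp: quad_Lm quad_LM mi_bounds intro!: sum_nonneg sum_mono mult_right_mono)

lemma quad_D_gt:
  assumes "x \<noteq> 0"
  shows "quad LM x / (2 * (1 - \<eta>)) + quad ((LM - Lm) ** (LM - Lm)) x / (8 * \<eta> * mbeta \<beta>)
     + (quad LM x - 3 * quad Lm x) / 2 + \<beta> * ((norm x)\<^sup>2 / 2 + quad LL x) < quad D x"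
  using D_large assms unfolding loewner_less_def pd_def by (auto simp: quad_simps)

text \<open>After dropping nonnegative terms, the condition on \<open>D\<close> leaves
  \<open>D\<close> above \<open>(LM - 3 Lm) / 2\<close>, which is at least \<open>- Lm\<close>. This
  is what makes \<open>h + D\<close> invertible for every admissible Hessian sample.\<close>

lemma quad_Lm_D_pos:
  assumes "x \<noteq> 0" shows "quad Lm x + quad D x > 0"
proof -
  have "quad ((LM - Lm) ** (LM - Lm)) x / (8 * \<eta> * mbeta \<beta>) \<ge> 0"
    using \<eta> mbeta_pos [OF \<beta>] by (simp add: quad_LM_diff_square sum_nonneg)
  moreover have "quad LM x / (2 * (1 - \<eta>)) \<ge> 0"
    using \<eta> quad_Lm_nonneg [of x] quad_Lm_le_LM [of x] by simp
  moreover have "\<beta> * ((norm x)\<^sup>2 / 2 + quad LL x) \<ge> 0"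
    using \<beta> psd_L' by (simp add: psd_def)
  moreover have "0 < lm + d" if "0 \<le> a" "0 \<le> b" "0 \<le> c" "lm \<le> lM" "b + a + (lM - 3 * lm) / 2 + c < d"
    for a b c lm lM d :: real
    using that by argo
  ultimately show ?thesis
    using quad_D_gt [OF assms] quad_Lm_le_LM [of x] by blast
qed

lemma quad_R_pos:
  assumes "x \<noteq> 0" shows "quad R x > 0"
  using quad_Lm_D_pos [OF assms] quad_Lm_le_LM [of x] unfolding R_def quad_simps by argo

lemma quad_LM_D_pos: "x \<noteq> 0 \<Longrightarrow> quad (LM + D) x > 0"
  using quad_Lm_D_pos [of x] quad_Lm_le_LM [of x] by (simp add: quad_simps)

definition nLMD :: real where "nLMD = spectral_norm (LM + D)"

lemma quad_LM_D_le: "quad (LM + D) x \<le> nLMD * (norm x)\<^sup>2"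
proof -
  have "quad (LM + D) x \<le> norm x * norm ((LM + D) *v x)"
    unfolding quad_def by (rule norm_cauchy_schwarz)
  also have "\<dots> \<le> norm x * (nLMD * norm x)"
    unfolding nLMD_def spectral_norm_def by (intro mult_left_mono onorm) auto
  finally show ?thesis by (simp add: power2_eq_square mult_ac)
qed

lemma nLMD_pos: "nLMD > 0"
proof -
  have "0 < quad (LM + D) (axis undefined 1)" by (intro quad_LM_D_pos) (simp add: axis_eq_0_iff)
  also have "\<dots> \<le> nLMD * (norm (axis undefined 1 :: real^('n \<times> 'd)))\<^sup>2" by (rule quad_LM_D_le)
  finally show ?thesis by simp
qed

text \<open>The squared \<open>Q\<close>-norm of the error of \<open>z\<close>, written in
  \<open>q\<close>: since \<open>v\<close> and its optimum are the images of \<open>q\<close> and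
  \<open>- F xs\<close> under the root of \<open>Wp\<close>, the second summand is the squared error
  of \<open>v\<close>.\<close>

definition V :: "real^('n \<times> 'd) \<Rightarrow> real^('n \<times> 'd) \<Rightarrow> real" where
  "V x q = \<beta> * quad R (x - xs) + quad Wp (q + F xs)"

definition lmax :: "real \<Rightarrow> real \<Rightarrow> real" where
  "lmax c1 c2 = lambda_max (R + ((1 + 1 / c1) * (1 + 1 / c2) / (\<beta> * lamW)) *\<^sub>R (LM ** LM))"

lemma lmax_bound:
  "quad R x + ((1 + 1 / c1) * (1 + 1 / c2) / (\<beta> * lamW)) * quad (LM ** LM) x \<le> lmax c1 c2 * (norm x)\<^sup>2"
  using quad_le_lambda_max [of "R + ((1 + 1 / c1) * (1 + 1 / c2) / (\<beta> * lamW)) *\<^sub>R (LM ** LM)" x]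
  by (simp add: lmax_def quad_simps sym_intros sym_R)

lemma lmax_pos:
  assumes "c1 > 0" "c2 > 0" shows "lmax c1 c2 > 0"
proof -
  let ?x = "axis undefined 1 :: real^('n \<times> 'd)"
  have "0 < quad R ?x" by (intro quad_R_pos) (simp add: axis_eq_0_iff)
  moreover have "0 \<le> ((1 + 1 / c1) * (1 + 1 / c2) / (\<beta> * lamW)) * quad (LM ** LM) ?x"
    using assms \<beta> lamW_pos by (intro mult_nonneg_nonneg) (auto simp: quad_LM_square intro!: sum_nonneg)
  ultimately have "0 < lmax c1 c2 * (norm ?x)\<^sup>2" using lmax_bound [of ?x c1 c2] by linarith
  then show ?thesis by simp
qed

lemma \<kappa>_bound:
  "\<kappa> c0 * (norm x)\<^sup>2 \<le> quad R x - quad LM x / (2 * (1 - \<eta>)) - quad ((LM - Lm) ** (LM - Lm)) x / (4 * c0)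
     + quad Lm x - quad LM x - \<beta> * ((norm x)\<^sup>2 / 2 + quad LL x)"
proof -
  have "symmetric (R - (1 / (2 * (1 - \<eta>))) *\<^sub>R LM - (1 / (4 * c0)) *\<^sub>R ((LM - Lm) ** (LM - Lm))
          + Lm - LM - \<beta> *\<^sub>R ((1/2) *\<^sub>R mat 1 + LL))"
    by (intro sym_intros sym_R)
  from lambda_min_le_quad [OF this, of x] show ?thesis
    by (simp add: \<kappa>_def quad_simps)
qed

lemma Wp_nonneg: "psd Wp" and sym_Wp: "symmetric Wp"
  using psd_pseudoinverse [OF psd_L'] by (auto simp: psd_def)

lemma quad_Wp_le: "quad Wp x \<le> (norm x)\<^sup>2 / lamW"
  unfolding lamW_def by (intro quad_pseudoinverse_le psd_L' L_nonzero')

lemma quad_Wp_L: "quad Wp (LL *v x) = quad LL x"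
  using pseudoinverse(1) [of LL]
  by (simp add: quad_def symmetric_inner symmetric_L matrix_vector_mul_assoc matrix_mul_assoc)

text \<open>On vectors with agent sum zero, \<open>Wp ** LL\<close> acts as the identity; this frees
  the cross term of the dual update from the pseudoinverse.\<close>

lemma Wp_L_inner:
  assumes "(\<Sum>i\<in>UNIV. component y i) = 0" shows "y \<bullet> (Wp *v (LL *v x)) = y \<bullet> x"
proof -
  have "Wp *v (LL *v y) = y"
    using assms by (intro pseudoinverse_cancel symmetric_L) (simp add: orthogonal_L_null)
  then show ?thesis
    using symmetric_inner [OF pseudoinverse(2) [of LL], of y x]
    by (simp add: symmetric_L matrix_vector_mul_assoc)
qed

section \<open>Pathwise estimates for Hessian blocks between the Loewner bounds\<close>

context
  fixes Hs :: "'n \<Rightarrow> real^'d^'d" and h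
  assumes Hs: "\<And>i. mi i *\<^sub>R mat 1 \<preceq>\<^sub>L Hs i" "\<And>i. Hs i \<preceq>\<^sub>L Mi i *\<^sub>R mat 1"
    and h_def: "h = block_diag Hs"
begin

lemma sym_h: "symmetric h"
  unfolding h_def by (intro symmetric_block_diag loewner_between_symmetric [OF Hs(1)])

lemma quad_h: "quad Lm x \<le> quad h x" "quad h x \<le> quad LM x"
  by (auto simp: h_def quad_block_diag quad_Lm quad_LM intro!: sum_mono loewner_lower loewner_upper Hs)

lemma pd_h_D: "pd (h + D)"
  using quad_Lm_D_pos quad_h(1)
  by (force simp: pd_def quad_simps sym_h sym_intros intro: less_le_trans)

lemma norm_h_D_le: "norm ((h + D) *v x) \<le> nLMD * norm x"
proof (rule symmetric_norm_le)
  show "symmetric (h + D)" by (intro sym_intros sym_h)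
  show "\<bar>quad (h + D) x\<bar> \<le> nLMD * (norm x)\<^sup>2" for x
  proof -
    have "quad (h + D) x \<ge> 0" using pd_imp_psd [OF pd_h_D] by (simp add: psd_def)
    moreover have "quad (h + D) x \<le> quad (LM + D) x" by (simp add: quad_simps quad_h)
    ultimately show ?thesis using quad_LM_D_le [of x] by linarith
  qed
qed (use nLMD_pos in simp)

text \<open>\<open>R - D\<close> is the midpoint of the two Hessian bounds, so in block
  \<open>i\<close> the matrix \<open>h + D\<close> deviates from \<open>R\<close> by at most the
  half-width \<open>(Mi i - mi i) / 2\<close>.\<close>

lemma norm_R_diff_le:
  "(norm ((R - (h + D)) *v x))\<^sup>2 \<le> quad ((LM - Lm) ** (LM - Lm)) x / 4"
proof -
  have "(norm (component ((R - (h + D)) *v x) i))\<^sup>2 \<le> ((Mi i - mi i) * norm (component x i))\<^sup>2 / 4" for i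
  proof -
    define B where "B = ((Mi i + mi i) / 2) *\<^sub>R mat 1 - Hs i"
    have "component ((R - (h + D)) *v x) i = B *v component x i"
      by (simp add: R_def h_def Lm_def LM_def B_def matrix_vector_mult_diff_rdistrib
          matrix_vector_mult_add_rdistrib component_kronecker_diag component_block_diag
          scaleR_matrix_vector_assoc [symmetric] algebra_simps add_divide_distrib)
    moreover have "norm (B *v component x i) \<le> ((Mi i - mi i) / 2) * norm (component x i)"
    proof (rule symmetric_norm_le)
      show "symmetric B"
        unfolding B_def by (intro symmetric_intros loewner_between_symmetric [OF Hs(1)])
      show "\<bar>quad B y\<bar> \<le> (Mi i - mi i) / 2 * (norm y)\<^sup>2" for y
        using loewner_lower [OF Hs(1) [of i], of y] loewner_upper [OF Hs(2) [of i], of y]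
        by (simp add: B_def quad_simps abs_le_iff field_simps)
    qed (use mi_bounds [of i] in simp)
    ultimately have "(norm (component ((R - (h + D)) *v x) i))\<^sup>2
        \<le> (((Mi i - mi i) / 2) * norm (component x i))\<^sup>2"
      by (intro power_mono) auto
    then show ?thesis by (simp add: power_mult_distrib power_divide)
  qed
  then show ?thesis
    unfolding norm_component quad_LM_diff_square sum_divide_distrib by (intro sum_mono)
qed

lemma quad_R_diff_le: "2 * quad (R - (h + D)) x \<le> quad LM x - quad Lm x"
  using quad_h [of x] unfolding R_def quad_simps by argo

text \<open>The conditions on \<open>\<delta>\<close> are the three entries of the rate with
  denominators cleared. They compare \<open>\<delta>\<close> times the coefficients of
  \<open>|d|^2\<close>, of the Laplacian form of \<open>e\<close> and of \<open>|e|^2\<close> in a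
  bound on \<open>V\<close> with the decrease available in each.\<close>

lemma one_step:
  fixes x q g :: "real^('n \<times> 'd)"
  assumes q: "(\<Sum>i\<in>UNIV. component q i) = 0"
    and c: "0 < c0" "0 < c1" "0 < c2"
    and x': "x' = x - matrix_inv (h + D) *v (g + \<beta> *\<^sub>R (LL *v x) + q)"
    and q': "q' = q + \<beta> *\<^sub>R (LL *v x')"
    and \<epsilon>: "\<epsilon> = g - F x"
    and \<delta>: "0 \<le> \<delta>" "\<delta> * (2 * (1 + c1) * nLMD\<^sup>2) \<le> \<beta> * lamW * \<kappa> c0"
      "\<delta> * ((1 + 1 / c1) * (1 + c2)) \<le> 1 - \<eta>"
      "\<delta> * lmax c1 c2 \<le> 2 * \<eta> * mbeta \<beta> - c0"
  shows "V x' q' \<le> (1 - \<delta>) * V x q - 2 * \<beta> * ((x - xs) \<bullet> \<epsilon>) + (2 * (1 + c1) * \<delta> / lamW + 2) * (norm \<epsilon>)\<^sup>2"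
proof -
  define e where "e = x - xs"
  define d where "d = x' - x"
  define e' where "e' = x' - xs"
  define y where "y = q + F xs"
  define G where "G = F x - F xs"
  have e': "e' = e + d" by (simp add: e'_def e_def d_def)
  have Lx: "LL *v x = LL *v e" "LL *v x' = LL *v e'"
    by (simp_all add: e_def e'_def xs_def matrix_vector_mult_diff_distrib)
  have Hd: "(h + D) *v d = - (G + \<epsilon> + \<beta> *\<^sub>R (LL *v e) + y)"
  proof -
    have "d = - (matrix_inv (h + D) *v (g + \<beta> *\<^sub>R (LL *v x) + q))"
      by (simp add: d_def x')
    then have "(h + D) *v d = - ((h + D) *v (matrix_inv (h + D) *v (g + \<beta> *\<^sub>R (LL *v x) + q)))"
      by (metis matrix_vector_mult_diff_distrib matrix_vector_mult_0_right diff_0)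
    also have "\<dots> = - (g + \<beta> *\<^sub>R (LL *v x) + q)"
      by (simp add: pd_invertible [OF pd_h_D])
    finally show ?thesis by (simp add: Lx G_def \<epsilon> y_def)
  qed
  have y_eq: "y = - ((h + D) *v d) - G - \<epsilon> - \<beta> *\<^sub>R (LL *v e)"
    unfolding Hd by simp
  \<comment> \<open>Conservation of the agent sum of \<open>q\<close> meets optimality of
    \<open>xopt\<close> here.\<close>
  have y0: "(\<Sum>i\<in>UNIV. component y i) = 0"
    by (simp add: y_def sum.distrib q sum_component_F_xs)
  \<comment> \<open>An exact identity. The dual part changes by \<open>2 * \<beta> * (e' \<bullet>
    y) + \<beta>\<^sup>2 * quad LL e'\<close>; inserting \<open>y_eq\<close> and polarising turns
    all Laplacian terms into \<open>\<beta>\<^sup>2 * (quad LL d - quad LL e)\<close>, which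
    supplies the negative term in \<open>e\<close>.\<close>
  have "V x' q' - V x q = \<beta> * (2 * (e' \<bullet> (R *v d)) - quad R d - 2 * (e' \<bullet> ((h + D) *v d))
      - 2 * (e' \<bullet> G) - 2 * (e' \<bullet> \<epsilon>) + \<beta> * quad LL d - \<beta> * quad LL e)"
  proof -
    have "quad Wp (q' + F xs) = quad Wp (y + \<beta> *\<^sub>R (LL *v e'))"
      by (simp add: q' y_def Lx add_ac)
    also have "\<dots> = quad Wp y + 2 * \<beta> * (e' \<bullet> y) + \<beta>\<^sup>2 * quad LL e'"
      unfolding quad_add_vec [OF sym_Wp] quad_mult_vec quad_Wp_L matrix_vector_mult_scaleR
      using Wp_L_inner [OF y0, of e'] by (simp add: inner_commute)
    finally have 1: "quad Wp (q' + F xs) = quad Wp y + 2 * \<beta> * (e' \<bullet> y) + \<beta>\<^sup>2 * quad LL e'" .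
    have ed: "e = e' + (-1) *\<^sub>R d" by (simp add: e')
    have 2: "quad R e = quad R e' - 2 * (e' \<bullet> (R *v d)) + quad R d"
      unfolding ed quad_add_vec [OF sym_R] quad_mult_vec matrix_vector_mult_scaleR by simp
    have dd: "d = e' + (-1) *\<^sub>R e" by (simp add: e')
    have 3: "quad LL d = quad LL e' - 2 * (e' \<bullet> (LL *v e)) + quad LL e"
      unfolding dd quad_add_vec [OF symmetric_L] quad_mult_vec matrix_vector_mult_scaleR by simp
    have 4: "e' \<bullet> y = - (e' \<bullet> ((h + D) *v d)) - e' \<bullet> G - e' \<bullet> \<epsilon> - \<beta> * (e' \<bullet> (LL *v e))"
      unfolding y_eq by (simp add: inner_diff_right)
    show ?thesis
      unfolding V_def 1 e_def [symmetric] e'_def [symmetric] y_def [symmetric] 2 3 4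
      by (simp add: algebra_simps power2_eq_square)
  qed
  also have "2 * (e' \<bullet> (R *v d)) - quad R d - 2 * (e' \<bullet> ((h + D) *v d))
      - 2 * (e' \<bullet> G) - 2 * (e' \<bullet> \<epsilon>) + \<beta> * quad LL d - \<beta> * quad LL e
      \<le> - (\<kappa> c0 * (norm d)\<^sup>2) - (2 * \<eta> * mbeta \<beta> - c0) * (norm e)\<^sup>2 - \<beta> * (1 - \<eta>) * quad LL e
        - 2 * (e \<bullet> \<epsilon>) + 2 / \<beta> * (norm \<epsilon>)\<^sup>2"
  proof -
    have 1: "2 * (e' \<bullet> (R *v d)) - 2 * (e' \<bullet> ((h + D) *v d))
      = 2 * (e \<bullet> ((R - (h + D)) *v d)) + 2 * quad (R - (h + D)) d"
      by (simp add: e' quad_def matrix_vector_mult_diff_rdistrib inner_add_left inner_diff_right)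
    \<comment> \<open>The share \<open>c0\<close> of \<open>|e|^2\<close> given up here accounts for
      the \<open>1 / (4 * c0)\<close> in \<open>\<kappa>\<close>.\<close>
    have 2: "2 * (e \<bullet> ((R - (h + D)) *v d)) \<le> c0 * (norm e)\<^sup>2 + quad ((LM - Lm) ** (LM - Lm)) d / (4 * c0)"
    proof -
      have "(norm ((R - (h + D)) *v d))\<^sup>2 / c0 \<le> quad ((LM - Lm) ** (LM - Lm)) d / 4 / c0"
        using c by (intro divide_right_mono norm_R_diff_le) auto
      then show ?thesis using two_inner_le [OF c(1), of e "(R - (h + D)) *v d"] by simp
    qed
    have 3: "2 * quad (R - (h + D)) d \<le> quad LM d - quad Lm d"
      by (rule quad_R_diff_le)
    \<comment> \<open>Young's parameter for agent \<open>i\<close> is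
      \<open>Mi i / (2 * (1 - \<eta>))\<close>. Its reciprocal produces the cocoercivity sum with
      factor \<open>2 * (1 - \<eta>)\<close>, so of the available \<open>2 * (e \<bullet> G)\<close>
      exactly the fraction \<open>\<eta>\<close> survives.\<close>
    have 4: "- 2 * (d \<bullet> G) \<le> quad LM d / (2 * (1 - \<eta>)) + 2 * (1 - \<eta>) * (e \<bullet> G)"
    proof -
      have "- 2 * (d \<bullet> G) = (\<Sum>i\<in>UNIV. 2 * (component d i \<bullet> (- component G i)))"
        by (simp add: inner_component sum_distrib_left)
      also have "\<dots> \<le> (\<Sum>i\<in>UNIV. Mi i * (norm (component d i))\<^sup>2 / (2 * (1 - \<eta>))
          + 2 * (1 - \<eta>) * ((norm (component G i))\<^sup>2 / Mi i))"
      proof (rule sum_mono)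
        fix i
        have "Mi i / (2 * (1 - \<eta>)) > 0" using \<eta> Mi_pos [of i] by simp
        from two_inner_le [OF this, of "component d i" "- component G i"]
        show "2 * (component d i \<bullet> (- component G i)) \<le> Mi i * (norm (component d i))\<^sup>2 / (2 * (1 - \<eta>))
          + 2 * (1 - \<eta>) * ((norm (component G i))\<^sup>2 / Mi i)"
          by (simp add: mult_ac)
      qed
      also have "\<dots> = quad LM d / (2 * (1 - \<eta>)) + 2 * (1 - \<eta>) * (\<Sum>i\<in>UNIV. (norm (component G i))\<^sup>2 / Mi i)"
        by (simp add: sum.distrib quad_LM sum_divide_distrib sum_distrib_left)
      also have "\<dots> \<le> quad LM d / (2 * (1 - \<eta>)) + 2 * (1 - \<eta>) * (e \<bullet> G)"
        unfolding G_def e_def using \<eta> by (intro add_left_mono mult_left_mono F_cocoercive) auto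
      finally show ?thesis .
    qed
    \<comment> \<open>The parameter \<open>\<beta> / 2\<close> is the room reserved by half the
      identity in \<open>\<kappa>\<close>; after multiplication by \<open>\<beta>\<close> the noise
      keeps the coefficient 2.\<close>
    have 5: "- 2 * (d \<bullet> \<epsilon>) \<le> \<beta> / 2 * (norm d)\<^sup>2 + 2 / \<beta> * (norm \<epsilon>)\<^sup>2"
      using two_inner_le [of "\<beta> / 2" d "- \<epsilon>"] \<beta> by (simp add: mult_ac)
    \<comment> \<open>Restricted strong convexity borrows the fraction \<open>\<eta>\<close> of
      \<open>\<beta> * quad LL e\<close>; the fraction \<open>1 - \<eta>\<close> remains as
      decrease.\<close>
    have 6: "\<eta> * (2 * (mbeta \<beta> * (norm e)\<^sup>2)) \<le> \<eta> * (2 * (e \<bullet> G) + \<beta> * quad LL e)"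
      using restricted_strong_convexity [OF \<beta>, of x] \<eta>
      by (intro mult_left_mono) (auto simp: e_def G_def)
    show ?thesis
      using 1 2 3 4 5 6 \<kappa>_bound [of c0 d]
      by (simp add: e' inner_add_left algebra_simps)
  qed
  finally have main: "V x' q' - V x q \<le> \<beta> * (- (\<kappa> c0 * (norm d)\<^sup>2) - (2 * \<eta> * mbeta \<beta> - c0) * (norm e)\<^sup>2
      - \<beta> * (1 - \<eta>) * quad LL e - 2 * (e \<bullet> \<epsilon>) + 2 / \<beta> * (norm \<epsilon>)\<^sup>2)"
    using \<beta> by simp
  \<comment> \<open>\<open>c1\<close> separates the step and the noise from the consensus error and
    the gradient difference, and \<open>c2\<close> separates the last two. Step and noise are split
    evenly, hence the factor 2 in the first entry of the rate and in \<Gamma>.\<close>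
  have Wpy: "quad Wp y \<le> (1 + c1) * (2 / lamW * (nLMD\<^sup>2 * (norm d)\<^sup>2 + (norm \<epsilon>)\<^sup>2))
      + (1 + 1 / c1) * ((1 + c2) * (\<beta>\<^sup>2 * quad LL e) + (1 + 1 / c2) * (quad (LM ** LM) e / lamW))"
  proof -
    have "y = (-1) *\<^sub>R (((h + D) *v d + \<epsilon>) + (\<beta> *\<^sub>R (LL *v e) + G))"
      by (simp add: y_eq)
    then have "quad Wp y = quad Wp (((h + D) *v d + \<epsilon>) + (\<beta> *\<^sub>R (LL *v e) + G))"
      by (simp only: quad_mult_vec) simp
    also have "\<dots> \<le> (1 + c1) * quad Wp ((h + D) *v d + \<epsilon>) + (1 + 1 / c1) * quad Wp (\<beta> *\<^sub>R (LL *v e) + G)"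
      by (intro quad_add_le Wp_nonneg c)
    also have "\<dots> \<le> (1 + c1) * (2 / lamW * (nLMD\<^sup>2 * (norm d)\<^sup>2 + (norm \<epsilon>)\<^sup>2))
      + (1 + 1 / c1) * ((1 + c2) * (\<beta>\<^sup>2 * quad LL e) + (1 + 1 / c2) * (quad (LM ** LM) e / lamW))"
    proof (intro add_mono mult_left_mono)
      have "quad Wp ((h + D) *v d + \<epsilon>) \<le> 2 * quad Wp ((h + D) *v d) + 2 * quad Wp \<epsilon>"
        using quad_add_le [OF Wp_nonneg, of 1] by simp
      also have "\<dots> \<le> 2 * ((norm ((h + D) *v d))\<^sup>2 / lamW) + 2 * ((norm \<epsilon>)\<^sup>2 / lamW)"
        by (intro add_mono mult_left_mono quad_Wp_le) auto
      also have "\<dots> \<le> 2 * ((nLMD * norm d)\<^sup>2 / lamW) + 2 * ((norm \<epsilon>)\<^sup>2 / lamW)"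
        using lamW_pos norm_h_D_le [of d]
        by (intro add_mono mult_left_mono divide_right_mono power_mono) auto
      finally show "quad Wp ((h + D) *v d + \<epsilon>) \<le> 2 / lamW * (nLMD\<^sup>2 * (norm d)\<^sup>2 + (norm \<epsilon>)\<^sup>2)"
        by (simp add: power_mult_distrib add_divide_distrib distrib_left)
      have "quad Wp (\<beta> *\<^sub>R (LL *v e) + G)
          \<le> (1 + c2) * quad Wp (\<beta> *\<^sub>R (LL *v e)) + (1 + 1 / c2) * quad Wp G"
        by (intro quad_add_le Wp_nonneg c)
      also have "quad Wp (\<beta> *\<^sub>R (LL *v e)) = \<beta>\<^sup>2 * quad LL e"
        by (simp add: quad_mult_vec quad_Wp_L)
      finally have "quad Wp (\<beta> *\<^sub>R (LL *v e) + G)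
          \<le> (1 + c2) * (\<beta>\<^sup>2 * quad LL e) + (1 + 1 / c2) * quad Wp G" .
      moreover have "quad Wp G \<le> quad (LM ** LM) e / lamW"
        unfolding quad_LM_square using lamW_pos
        by (intro order_trans [OF quad_Wp_le] divide_right_mono)
          (auto simp: G_def e_def intro: order_trans [OF norm_F_diff_le])
      then have "(1 + 1 / c2) * quad Wp G \<le> (1 + 1 / c2) * (quad (LM ** LM) e / lamW)"
        using c by (intro mult_left_mono) auto
      ultimately show "quad Wp (\<beta> *\<^sub>R (LL *v e) + G)
          \<le> (1 + c2) * (\<beta>\<^sup>2 * quad LL e) + (1 + 1 / c2) * (quad (LM ** LM) e / lamW)"
        by linarith
    qed (use c in auto)
    finally show ?thesis .
  qed
  define s where "s = (1 + 1 / c1) * (1 + 1 / c2)"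
  define t where "t = (1 + 1 / c1) * (1 + c2)"
  have "\<delta> * V x q = \<delta> * \<beta> * quad R e + \<delta> * quad Wp y"
    by (simp add: V_def e_def y_def algebra_simps)
  also have "\<dots> \<le> \<delta> * \<beta> * quad R e + \<delta> * ((1 + c1) * (2 / lamW * (nLMD\<^sup>2 * (norm d)\<^sup>2 + (norm \<epsilon>)\<^sup>2))
      + (1 + 1 / c1) * ((1 + c2) * (\<beta>\<^sup>2 * quad LL e) + (1 + 1 / c2) * (quad (LM ** LM) e / lamW)))"
    using \<delta>(1) Wpy by (intro add_left_mono mult_left_mono) auto
  also have "\<dots> = \<delta> * \<beta> * (quad R e + s / (\<beta> * lamW) * quad (LM ** LM) e)
      + (\<delta> * (2 * (1 + c1) * nLMD\<^sup>2)) / lamW * (norm d)\<^sup>2 + (\<delta> * t) * (\<beta>\<^sup>2 * quad LL e)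
      + 2 * (1 + c1) * \<delta> / lamW * (norm \<epsilon>)\<^sup>2"
  proof -
    have "u * (v * a + w * b) = (u * v) * a + (u * w) * b" for u v w a b :: real
      by (simp add: algebra_simps)
    then have st: "(1 + 1 / c1) * ((1 + c2) * a + (1 + 1 / c2) * b) = t * a + s * b" for a b
      unfolding s_def t_def .
    have "\<delta> * \<beta> * (s / (\<beta> * lamW) * quad (LM ** LM) e) = \<delta> * (s * (quad (LM ** LM) e / lamW))"
      using \<beta> by simp
    then show ?thesis
      unfolding st distrib_left [of "\<delta> * \<beta>"] by (simp add: algebra_simps add_divide_distrib)
  qed
  also have "\<dots> \<le> \<beta> * ((2 * \<eta> * mbeta \<beta> - c0) * (norm e)\<^sup>2) + \<beta> * \<kappa> c0 * (norm d)\<^sup>2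
      + (1 - \<eta>) * (\<beta>\<^sup>2 * quad LL e) + 2 * (1 + c1) * \<delta> / lamW * (norm \<epsilon>)\<^sup>2"
  proof (intro add_mono order_refl)
    have "\<delta> * \<beta> * (quad R e + s / (\<beta> * lamW) * quad (LM ** LM) e) \<le> \<delta> * \<beta> * (lmax c1 c2 * (norm e)\<^sup>2)"
      using \<delta>(1) \<beta> lmax_bound [of e c1 c2] by (intro mult_left_mono) (auto simp: s_def)
    also have "\<dots> = \<beta> * (\<delta> * lmax c1 c2 * (norm e)\<^sup>2)" by simp
    also have "\<dots> \<le> \<beta> * ((2 * \<eta> * mbeta \<beta> - c0) * (norm e)\<^sup>2)"
      using \<delta>(4) \<beta> by (intro mult_left_mono mult_right_mono) auto
    finally show "\<delta> * \<beta> * (quad R e + s / (\<beta> * lamW) * quad (LM ** LM) e) \<le> \<beta> * ((2 * \<eta> * mbeta \<beta> - c0) * (norm e)\<^sup>2)" .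
    show "\<delta> * (2 * (1 + c1) * nLMD\<^sup>2) / lamW * (norm d)\<^sup>2 \<le> \<beta> * \<kappa> c0 * (norm d)\<^sup>2"
      using \<delta>(2) lamW_pos by (intro mult_right_mono) (auto simp: field_simps)
    show "\<delta> * t * (\<beta>\<^sup>2 * quad LL e) \<le> (1 - \<eta>) * (\<beta>\<^sup>2 * quad LL e)"
      using \<delta>(3) psd_L' by (intro mult_right_mono) (auto simp: t_def psd_def)
  qed
  finally have "\<delta> * V x q \<le> \<beta> * ((2 * \<eta> * mbeta \<beta> - c0) * (norm e)\<^sup>2) + \<beta> * \<kappa> c0 * (norm d)\<^sup>2
      + (1 - \<eta>) * (\<beta>\<^sup>2 * quad LL e) + 2 * (1 + c1) * \<delta> / lamW * (norm \<epsilon>)\<^sup>2" .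
  moreover have "\<beta> * (2 / \<beta> * (norm \<epsilon>)\<^sup>2) = 2 * (norm \<epsilon>)\<^sup>2" using \<beta> by simp
  ultimately show ?thesis
    using main by (simp add: e_def [symmetric] algebra_simps power2_eq_square)
qed

end

end

subsection \<open>Sampling without replacement\<close>

text \<open>Removing \<open>T\<close> is a bijection onto the subsets of the complement of
  \<open>T\<close> of size \<open>k - card T\<close>.\<close>

lemma card_supersets:
  fixes T :: "'c::finite set"
  assumes "card T \<le> k"
  shows "card {A. T \<subseteq> A \<and> card A = k} = (CARD('c) - card T) choose (k - card T)"
proof -
  let ?S = "{B. B \<subseteq> - T \<and> card B = k - card T}"
  have inj: "inj_on (\<lambda>B. B \<union> T) ?S"
    by (rule inj_onI) blast
  have "{A. T \<subseteq> A \<and> card A = k} = (\<lambda>B. B \<union> T) ` ?S"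
  proof (intro equalityI subsetI)
    fix A assume "A \<in> {A. T \<subseteq> A \<and> card A = k}"
    then have "A - T \<in> ?S" "A = (A - T) \<union> T"
      by (auto simp: card_Diff_subset)
    then show "A \<in> (\<lambda>B. B \<union> T) ` ?S" by (rule rev_image_eqI)
  next
    fix A assume "A \<in> (\<lambda>B. B \<union> T) ` ?S"
    then obtain B where B: "B \<subseteq> - T" "card B = k - card T" "A = B \<union> T" by auto
    then have "card A = card B + card T"
      by (simp add: card_Un_disjoint disjoint_eq_subset_Compl)
    then show "A \<in> {A. T \<subseteq> A \<and> card A = k}" using B assms by auto
  qed
  then have "card {A. T \<subseteq> A \<and> card A = k} = card ?S"
    by (simp only: card_image [OF inj])
  also have "\<dots> = card (- T) choose (k - card T)"
    by (rule n_subsets) simp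
  finally show ?thesis by (simp add: Compl_eq_Diff_UNIV card_Diff_subset)
qed

lemma card_subsets: "card {A :: 'c::finite set. card A = k} = CARD('c) choose k"
  using card_supersets [of "{} :: 'c set" k] by simp

lemma sum_of_samples:
  fixes u :: "'c::finite \<Rightarrow> 'v::real_vector"
  assumes "1 \<le> k"
  shows "(\<Sum>A | card A = k. \<Sum>j\<in>A. u j) = real ((CARD('c) - 1) choose (k - 1)) *\<^sub>R (\<Sum>j\<in>UNIV. u j)"
proof -
  have "(\<Sum>A | card A = k. \<Sum>j\<in>A. u j) = (\<Sum>A | card A = k. \<Sum>j\<in>UNIV. if j \<in> A then u j else 0)"
    by (rule sum.cong [OF refl]) (simp add: sum.If_cases)
  also have "\<dots> = (\<Sum>j\<in>UNIV. \<Sum>A | card A = k. if j \<in> A then u j else 0)"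
    by (rule sum.swap)
  also have "\<dots> = (\<Sum>j\<in>UNIV. \<Sum>A | {j} \<subseteq> A \<and> card A = k. u j)"
    by (rule sum.cong [OF refl], subst sum.If_cases) (auto intro!: sum.cong)
  also have "\<dots> = (\<Sum>j\<in>UNIV. real ((CARD('c) - 1) choose (k - 1)) *\<^sub>R u j)"
  proof (intro sum.cong refl)
    fix j
    show "(\<Sum>A | {j} \<subseteq> A \<and> card A = k. u j) = real ((CARD('c) - 1) choose (k - 1)) *\<^sub>R u j"
      using card_supersets [of "{j}" k] assms by (simp only: sum_constant_scaleR) simp
  qed
  finally show ?thesis by (simp add: scaleR_sum_right)
qed

text \<open>Expand the square and count the samples containing a given pair. All pairs
  \<open>i \<noteq> j\<close> have the same count; subtracting it everywhere leaves a multiple of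
  the square of the full sum, which is zero, and on the diagonal the difference of the two
  counts.\<close>

lemma sum_of_samples_squared:
  fixes u :: "'c::finite \<Rightarrow> 'v::real_inner"
  assumes k: "1 \<le> k" and C: "2 \<le> CARD('c)" and u: "(\<Sum>j\<in>UNIV. u j) = 0"
  shows "(\<Sum>A | card A = k. (norm (\<Sum>j\<in>A. u j))\<^sup>2)
    = real ((CARD('c) - 2) choose (k - 1)) * (\<Sum>j\<in>UNIV. (norm (u j))\<^sup>2)"
proof -
  let ?C = "CARD('c)"
  \<comment> \<open>The number of samples containing two given distinct elements, as a difference:
    for \<open>k = 1\<close> it is 0, whereas truncated subtraction would make the binomial with
    lower index \<open>k - 2\<close> equal to 1.\<close>
  define c2 where "c2 = ((?C - 1) choose (k - 1)) - ((?C - 2) choose (k - 1))"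
  have pascal: "(?C - 1) choose (k - 1) = ((?C - 2) choose (k - 1)) + c2"
  proof -
    have "?C - 1 = Suc (?C - 2)" using C by simp
    then have "(?C - 2) choose (k - 1) \<le> (?C - 1) choose (k - 1)"
      by (cases "k - 1") auto
    then show ?thesis by (simp add: c2_def)
  qed
  have pair: "card {A. i \<in> A \<and> j \<in> A \<and> card A = k} = c2" if "i \<noteq> j" for i j :: 'c
  proof (cases "k = 1")
    case True
    have "{A. i \<in> A \<and> j \<in> A \<and> card A = k} = {}"
      using that by (auto simp: True card_1_singleton_iff)
    then show ?thesis by (simp add: c2_def True)
  next
    case False
    then have m: "k = Suc (Suc (k - 2))" using k by linarith
    have n: "?C = Suc (Suc (?C - 2))" using C by linarith
    have "c2 = (?C - 2) choose (k - 2)"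
      unfolding c2_def by (subst (1 2 3) m, subst (1) n) simp
    moreover have "card {i, j} = 2" using that by simp
    ultimately show ?thesis
      using card_supersets [of "{i, j}" k] False k by simp
  qed
  have "(\<Sum>A | card A = k. (norm (\<Sum>j\<in>A. u j))\<^sup>2)
      = (\<Sum>A | card A = k. \<Sum>i\<in>UNIV. \<Sum>j\<in>UNIV. if i \<in> A \<and> j \<in> A then u i \<bullet> u j else 0)"
  proof (rule sum.cong [OF refl])
    fix A :: "'c set"
    have "(\<Sum>j\<in>A. u j) = (\<Sum>j\<in>UNIV. if j \<in> A then u j else 0)" by (simp add: sum.If_cases)
    then show "(norm (\<Sum>j\<in>A. u j))\<^sup>2 = (\<Sum>i\<in>UNIV. \<Sum>j\<in>UNIV. if i \<in> A \<and> j \<in> A then u i \<bullet> u j else 0)"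
      unfolding power2_norm_eq_inner
      by (simp only: inner_sum_left inner_sum_right) (intro sum.cong refl, auto simp: inner_commute)
  qed
  also have "\<dots> = (\<Sum>i\<in>UNIV. \<Sum>j\<in>UNIV. \<Sum>A | card A = k. if i \<in> A \<and> j \<in> A then u i \<bullet> u j else 0)"
    by (subst sum.swap) (intro sum.cong refl, subst sum.swap, rule refl)
  also have "\<dots> = (\<Sum>i\<in>UNIV. \<Sum>j\<in>UNIV. real (card {A. i \<in> A \<and> j \<in> A \<and> card A = k}) * (u i \<bullet> u j))"
    by (intro sum.cong refl, subst sum.If_cases) (auto intro!: arg_cong [where f = card] disjI2)
  also have "\<dots> = (\<Sum>i\<in>UNIV. \<Sum>j\<in>UNIV. real c2 * (u i \<bullet> u j)
      + (if i = j then real ((?C - 2) choose (k - 1)) * (u i \<bullet> u i) else 0))"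
  proof (intro sum.cong refl)
    fix i j
    show "real (card {A. i \<in> A \<and> j \<in> A \<and> card A = k}) * (u i \<bullet> u j) = real c2 * (u i \<bullet> u j)
      + (if i = j then real ((?C - 2) choose (k - 1)) * (u i \<bullet> u i) else 0)"
    proof (cases "i = j")
      case True
      have "card {A. i \<in> A \<and> card A = k} = ((?C - 2) choose (k - 1)) + c2"
        using card_supersets [of "{i}" k] k unfolding pascal [symmetric] by simp
      then show ?thesis using True by (simp add: algebra_simps)
    qed (simp add: pair)
  qed
  also have "\<dots> = real c2 * ((\<Sum>i\<in>UNIV. u i) \<bullet> (\<Sum>j\<in>UNIV. u j))
      + real ((?C - 2) choose (k - 1)) * (\<Sum>i\<in>UNIV. u i \<bullet> u i)"
    by (simp add: sum.distrib sum_distrib_left inner_sum_left inner_sum_right) (rule sum.swap)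
  finally show ?thesis by (simp add: u power2_norm_eq_inner)
qed

lemma sample_mean:
  fixes u :: "'c::finite \<Rightarrow> 'v::real_vector"
  assumes k: "1 \<le> k" "k \<le> CARD('c)" and u: "(\<Sum>j\<in>UNIV. u j) = 0"
  shows "(\<Sum>A | card A = k. (1 / real (card A)) *\<^sub>R (\<Sum>j\<in>A. u j)) = 0"
proof -
  have "(\<Sum>A | card A = k. (1 / real (card A)) *\<^sub>R (\<Sum>j\<in>A. u j))
      = (1 / real k) *\<^sub>R (\<Sum>A | card A = k. \<Sum>j\<in>A. u j)"
    by (simp add: scaleR_sum_right)
  then show ?thesis by (simp add: sum_of_samples [OF k(1)] u)
qed

text \<open>The finite population correction. With the normalisation by one less than the population
  size, the variance of the sample mean is exactly \<tau> times the population variance.\<close>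

lemma sample_second_moment:
  fixes u :: "'c::finite \<Rightarrow> 'v::real_inner"
  assumes k: "1 \<le> k" "k \<le> CARD('c)" and u: "(\<Sum>j\<in>UNIV. u j) = 0"
  shows "(\<Sum>A | card A = k. (norm ((1 / real (card A)) *\<^sub>R (\<Sum>j\<in>A. u j)))\<^sup>2) / real (CARD('c) choose k)
    = (real CARD('c) - real k) / (real CARD('c) * real k) * ((\<Sum>j\<in>UNIV. (norm (u j))\<^sup>2) / (real CARD('c) - 1))"
proof (cases "2 \<le> CARD('c)")
  case True
  let ?C = "CARD('c)"
  let ?S = "\<Sum>j\<in>UNIV. (norm (u j))\<^sup>2"
  have "(\<Sum>A | card A = k. (norm ((1 / real (card A)) *\<^sub>R (\<Sum>j\<in>A. u j)))\<^sup>2)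
      = (1 / (real k)\<^sup>2) * (\<Sum>A | card A = k. (norm (\<Sum>j\<in>A. u j))\<^sup>2)"
    by (simp add: sum_distrib_left power_divide)
  also have "\<dots> = (1 / (real k)\<^sup>2) * (real ((?C - 2) choose (k - 1)) * ?S)"
    by (simp add: sum_of_samples_squared [OF k(1) True u])
  finally have 1: "(\<Sum>A | card A = k. (norm ((1 / real (card A)) *\<^sub>R (\<Sum>j\<in>A. u j)))\<^sup>2)
      = (1 / (real k)\<^sup>2) * (real ((?C - 2) choose (k - 1)) * ?S)" .
  have "k * (?C choose k) = ?C * ((?C - 1) choose (k - 1))"
    using k by (intro times_binomial_minus1_eq) auto
  moreover have "(?C - k) * ((?C - 1) choose (k - 1)) = (?C - 1) * ((?C - 2) choose (k - 1))"
    using binomial_absorb_comp [of "?C - 1" "k - 1"] k by (simp add: numeral_2_eq_2)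
  ultimately have "k * (?C choose k) * (?C - k) = ?C * ((?C - 1) * ((?C - 2) choose (k - 1)))"
    by (metis (no_types, opaque_lifting) mult.assoc mult.commute)
  then have "real (k * (?C choose k) * (?C - k)) = real (?C * ((?C - 1) * ((?C - 2) choose (k - 1))))"
    by (rule arg_cong)
  then have 2: "real k * real (?C choose k) * (real ?C - real k)
      = real ?C * ((real ?C - 1) * real ((?C - 2) choose (k - 1)))"
    using k True by (simp add: of_nat_diff)
  have "real (?C choose k) > 0" using k by (simp add: zero_less_binomial)
  moreover have "real k > 0" "real ?C > 0" "real ?C - 1 > 0" using k True by auto
  ultimately have 3: "real ((?C - 2) choose (k - 1)) / ((real k)\<^sup>2 * real (?C choose k))
      = (real ?C - real k) / (real ?C * real k * (real ?C - 1))"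
    using 2 by (simp add: divide_simps power2_eq_square) (simp add: algebra_simps)
  have "(1 / (real k)\<^sup>2) * (real ((?C - 2) choose (k - 1)) * ?S) / real (?C choose k)
      = real ((?C - 2) choose (k - 1)) / ((real k)\<^sup>2 * real (?C choose k)) * ?S"
    by simp
  also have "\<dots> = (real ?C - real k) / (real ?C * real k) * (?S / (real ?C - 1))"
    unfolding 3 by simp
  finally show ?thesis unfolding 1 .
next
  \<comment> \<open>A population of one: the centred vector is zero, and the quotient by zero on the
    right is 0 as well.\<close>
  case False
  then have "CARD('c) = 1"
    using zero_less_card_finite [where 'a = 'c] by linarith
  then obtain c where c: "UNIV = {c :: 'c}" by (metis card_1_singletonE)
  then have "u c = 0" using u unfolding c by simp
  moreover have "j = c" for j using c by blast
  ultimately have "u j = 0" for j by metis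
  then show ?thesis by simp
qed

locale sampling_process = prob_space \<Omega>
  for \<Omega> :: "'o measure" +
  fixes G H :: "nat \<Rightarrow> 'n::finite \<Rightarrow> 'o \<Rightarrow> 'c::finite set"
    and nG :: nat and nH :: "nat \<Rightarrow> 'n \<Rightarrow> nat"
  assumes sampling: "sampling \<Omega> G H nG nH"
begin

lemma nG: "1 \<le> nG" "nG \<le> CARD('c)"
  using sampling by (auto simp: sampling_def)

text \<open>All sample sets as one independent family, so that disjoint index sets give independent
  blocks such as past and present.\<close>

definition Z :: "nat \<times> 'n \<times> bool \<Rightarrow> 'o \<Rightarrow> 'c set" where
  "Z = (\<lambda>(k, i, b). if b then G k i else H k i)"

lemma Z_simps: "Z (k, i, True) = G k i" "Z (k, i, False) = H k i"
  by (simp_all add: Z_def)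

lemma indep_Z: "indep_vars (\<lambda>_. count_space UNIV) Z UNIV"
  using sampling by (simp add: sampling_def Z_def)

lemma measurable_Z: "Z z \<in> measurable \<Omega> (count_space UNIV)"
  using indep_Z unfolding indep_vars_def2 by blast

lemma measurable_G: "G k i \<in> measurable \<Omega> (count_space UNIV)"
  and measurable_H: "H k i \<in> measurable \<Omega> (count_space UNIV)"
  using measurable_Z [of "(k, i, True)"] measurable_Z [of "(k, i, False)"] by (simp_all add: Z_simps)

text \<open>A quantity is determined by time \<open>k\<close> if it depends on the sample sets of the iterations
  before \<open>k\<close> only. It then takes finitely many values.\<close>

definition determined :: "nat \<Rightarrow> ('o \<Rightarrow> 'v) \<Rightarrow> bool" where
  "determined k f \<longleftrightarrow>
     (\<forall>\<omega> \<omega>'. (\<forall>j<k. \<forall>i. G j i \<omega> = G j i \<omega>' \<and> H j i \<omega> = H j i \<omega>') \<longrightarrow> f \<omega> = f \<omega>')"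

lemma determined_comp: "determined k f \<Longrightarrow> determined k (\<lambda>\<omega>. g (f \<omega>))"
  unfolding determined_def by metis

lemma determined_Suc: "determined k f \<Longrightarrow> determined (Suc k) f"
  unfolding determined_def by (metis less_SucI)

lemma determined_comp2:
  assumes "determined k f" "determined k g" shows "determined k (\<lambda>\<omega>. h (f \<omega>) (g \<omega>))"
  unfolding determined_def
proof (intro allI impI)
  fix \<omega> \<omega>' assume "\<forall>j<k. \<forall>i. G j i \<omega> = G j i \<omega>' \<and> H j i \<omega> = H j i \<omega>'"
  then have "f \<omega> = f \<omega>'" "g \<omega> = g \<omega>'"
    using assms unfolding determined_def by blast+
  then show "h (f \<omega>) (g \<omega>) = h (f \<omega>') (g \<omega>')" by simp
qed

lemma determined_G: "determined (Suc k) (\<lambda>\<omega> i. G k i \<omega>)"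
  by (simp add: determined_def)

definition past :: "nat \<Rightarrow> 'o \<Rightarrow> nat \<times> 'n \<times> bool \<Rightarrow> 'c set" where
  "past k \<omega> = restrict (\<lambda>z. Z z \<omega>) ({..<k} \<times> UNIV)"

text \<open>A finite product of finite discrete spaces is discrete, so every function of the past is
  measurable.\<close>

lemma PiM_past:
  "PiM ({..<k} \<times> UNIV) (\<lambda>_ :: nat \<times> 'n \<times> bool. count_space (UNIV :: 'c set set))
    = count_space (({..<k} \<times> UNIV) \<rightarrow>\<^sub>E UNIV)"
  by (rule count_space_PiM_finite) (auto intro: countable_finite)

lemma measurable_past: "past k \<in> measurable \<Omega> (count_space (({..<k} \<times> UNIV) \<rightarrow>\<^sub>E UNIV))"
  unfolding past_def PiM_past [symmetric] by (intro measurable_restrict measurable_Z)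

text \<open>The quantity is constant on the fibres of \<open>past k\<close>; its value is read off
  at a chosen representative.\<close>

lemma determined_factors:
  assumes "determined k f" obtains h where "f = h \<circ> past k"
proof -
  have "f \<omega> = f \<omega>'" if "past k \<omega> = past k \<omega>'" for \<omega> \<omega>'
  proof -
    have "Z z \<omega> = Z z \<omega>'" if "fst z < k" for z
    proof -
      have "z \<in> {..<k} \<times> UNIV" using that by (auto simp: mem_Times_iff)
      then show ?thesis using fun_cong [OF \<open>past k \<omega> = past k \<omega>'\<close>, of z] by (simp add: past_def)
    qed
    from this [of "(_, _, True)"] this [of "(_, _, False)"] show ?thesis
      using assms by (auto simp: determined_def Z_simps)
  qed
  then have "f = (\<lambda>z. f (SOME \<omega>. past k \<omega> = z)) \<circ> past k"
    by (auto simp: fun_eq_iff intro: someI2)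
  then show ?thesis by (rule that)
qed

text \<open>Finitely many histories make the quantity bounded. All measurability and integrability
  of the iterates rests on this, without any regularity of \<open>matrix_inv\<close> or
  \<open>hess\<close>.\<close>

lemma integrable_determined:
  fixes f :: "'o \<Rightarrow> real"
  assumes "determined k f" shows "integrable \<Omega> f"
proof -
  obtain h where h: "f = h \<circ> past k" using assms by (rule determined_factors)
  let ?P = "({..<k} \<times> (UNIV :: ('n \<times> bool) set)) \<rightarrow>\<^sub>E (UNIV :: 'c set set)"
  have fin: "finite ?P" by (intro finite_PiE) auto
  show ?thesis
  proof (rule integrable_const_bound)
    show "f \<in> borel_measurable \<Omega>"
      unfolding h by (rule measurable_comp [OF measurable_past]) simp
    have "past k \<omega> \<in> ?P" for \<omega> by (auto simp: past_def)
    then show "AE \<omega> in \<Omega>. norm (f \<omega>) \<le> Max ((\<lambda>z. \<bar>h z\<bar>) ` ?P)"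
      using fin by (intro AE_I2) (auto simp: h intro!: Max_ge)
  qed
qed

lemma expectation_indicator_G:
  "expectation (\<lambda>\<omega>. indicat_real {A} (G k i \<omega>)) = (if card A = nG then 1 / real (CARD('c) choose nG) else 0)"
proof -
  let ?S = "{A :: 'c set. card A = nG}"
  have card: "card ?S = CARD('c) choose nG" by (rule card_subsets)
  then have "card ?S > 0" using nG by (simp add: zero_less_binomial)
  then have S: "?S \<noteq> {}" "finite ?S" using card_gt_0_iff by blast+
  have "expectation (\<lambda>\<omega>. indicat_real {A} (G k i \<omega>)) = (\<integral>B. indicat_real {A} B \<partial>distr \<Omega> (count_space UNIV) (G k i))"
    by (rule integral_distr [OF measurable_G, symmetric]) simp
  also have "\<dots> = (\<integral>B. indicat_real {A} B \<partial>measure_pmf (pmf_of_set ?S))"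
    using sampling by (simp add: sampling_def)
  also have "\<dots> = pmf (pmf_of_set ?S) A"
    by (simp add: pmf.rep_eq)
  also have "\<dots> = (if card A = nG then 1 / real (CARD('c) choose nG) else 0)"
    by (subst pmf_of_set [OF S]) (simp add: card indicator_def)
  finally show ?thesis .
qed

lemma expectation_mult_indicator_G:
  fixes f :: "'o \<Rightarrow> real"
  assumes f: "determined k f"
  shows "expectation (\<lambda>\<omega>. f \<omega> * indicator {A} (G k i \<omega>))
    = expectation f * (if card A = nG then 1 / real (CARD('c) choose nG) else 0)"
proof -
  obtain h where h: "f = h \<circ> past k" using f by (rule determined_factors)
  \<comment> \<open>The indices of the past and the index \<open>(k, i, True)\<close> are
    disjoint.\<close>
  have "indep_var (PiM ({..<k} \<times> UNIV) (\<lambda>_. count_space UNIV)) (past k)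
      (PiM {(k, i, True)} (\<lambda>_. count_space UNIV)) (\<lambda>\<omega>. restrict (\<lambda>z. Z z \<omega>) {(k, i, True)})"
    unfolding past_def by (intro indep_var_restrict [OF indep_Z]) auto
  then have "indep_var borel (h \<circ> past k)
      borel ((\<lambda>z. indicator {A} (z (k, i, True)) :: real) \<circ> (\<lambda>\<omega>. restrict (\<lambda>z. Z z \<omega>) {(k, i, True)}))"
  proof (rule indep_var_compose)
    show "h \<in> borel_measurable (PiM ({..<k} \<times> UNIV) (\<lambda>_. count_space UNIV))"
      unfolding PiM_past by simp
    show "(\<lambda>z. indicator {A} (z (k, i, True))) \<in> borel_measurable (PiM {(k, i, True)} (\<lambda>_. count_space UNIV))"
      by (rule measurable_compose [OF measurable_component_singleton [of "(k, i, True)"]]) auto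
  qed
  then have ind: "indep_var borel f borel (\<lambda>\<omega>. indicator {A} (G k i \<omega>) :: real)"
    by (simp add: h comp_def Z_simps)
  have "determined (Suc k) (\<lambda>\<omega>. indicator {A} (G k i \<omega>) :: real)"
    by (auto simp: determined_def)
  then have "integrable \<Omega> (\<lambda>\<omega>. indicator {A} (G k i \<omega>) :: real)"
    by (rule integrable_determined)
  from indep_var_lebesgue_integral [OF ind integrable_determined [OF f] this]
  show ?thesis by (simp add: expectation_indicator_G)
qed

text \<open>Plays the role of conditioning on the past: decompose by the value \<open>A\<close> of
  the current sample, use independence for each \<open>A\<close>, and reassemble. The integrand on
  the right is the conditional mean.\<close>

lemma expectation_sample:
  fixes \<phi> :: "'o \<Rightarrow> 'c set \<Rightarrow> real"
  assumes \<phi>: "determined k \<phi>"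
  shows "expectation (\<lambda>\<omega>. \<phi> \<omega> (G k i \<omega>))
    = expectation (\<lambda>\<omega>. (\<Sum>A | card A = nG. \<phi> \<omega> A) / real (CARD('c) choose nG))"
proof -
  have det: "determined k (\<lambda>\<omega>. \<phi> \<omega> A)" for A
    using \<phi> by (rule determined_comp)
  have int: "integrable \<Omega> (\<lambda>\<omega>. \<phi> \<omega> A * indicator {A} (G k i \<omega>))" for A
    using det [of A] by (intro integrable_determined [of "Suc k"]) (auto simp: determined_def)
  have "\<phi> \<omega> (G k i \<omega>) = (\<Sum>A\<in>UNIV. \<phi> \<omega> A * indicator {A} (G k i \<omega>))" for \<omega>
    by (simp add: indicator_def if_distrib sum.If_cases cong: if_cong)
  then have "expectation (\<lambda>\<omega>. \<phi> \<omega> (G k i \<omega>))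
      = (\<Sum>A\<in>UNIV. expectation (\<lambda>\<omega>. \<phi> \<omega> A * indicator {A} (G k i \<omega>)))"
    using int by (simp only: Bochner_Integration.integral_sum)
  also have "\<dots> = (\<Sum>A\<in>UNIV. if card A = nG then expectation (\<lambda>\<omega>. \<phi> \<omega> A) / real (CARD('c) choose nG) else 0)"
    by (intro sum.cong refl) (simp add: expectation_mult_indicator_G [OF det])
  also have "\<dots> = (\<Sum>A | card A = nG. expectation (\<lambda>\<omega>. \<phi> \<omega> A) / real (CARD('c) choose nG))"
    by (simp add: sum.If_cases)
  also have "\<dots> = expectation (\<lambda>\<omega>. (\<Sum>A | card A = nG. \<phi> \<omega> A) / real (CARD('c) choose nG))"
    using integrable_determined [OF det] by (simp add: sum_divide_distrib)
  finally show ?thesis .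
qed

text \<open>An empty sample would give the average Hessian 0, which can violate the lower bound. The
  law of the sample excludes this only almost surely, so the one-step inequality is used almost
  everywhere.\<close>

lemma AE_card_H: "AE \<omega> in \<Omega>. \<forall>i. 1 \<le> card (H k i \<omega>)"
proof -
  have "AE \<omega> in \<Omega>. 1 \<le> card (H k i \<omega>)" for i
  proof (rule AE_distrD [OF measurable_H])
    let ?S = "{A :: 'c set. card A = nH k i}"
    have nH: "1 \<le> nH k i" "nH k i \<le> CARD('c)" using sampling by (auto simp: sampling_def)
    then have "card ?S > 0" by (simp add: card_subsets zero_less_binomial)
    then have S: "?S \<noteq> {}" "finite ?S" using card_gt_0_iff by blast+
    have "distr \<Omega> (count_space UNIV) (H k i) = measure_pmf (pmf_of_set ?S)"
      using sampling by (simp add: sampling_def)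
    then show "AE A in distr \<Omega> (count_space UNIV) (H k i). 1 \<le> card A"
      using nH by (simp only: AE_measure_pmf_iff set_pmf_of_set [OF S]) simp
  qed
  then show ?thesis by (simp add: AE_all_countable)
qed

end

subsection \<open>Expected decrease\<close>

lemma matrix_sum_mult_vec: "(\<Sum>j\<in>A. B j) *v y = (\<Sum>j\<in>A. B j *v (y :: real^'a))"
  by (induction A rule: infinite_finite_induct) (auto simp: matrix_vector_mult_add_rdistrib)

lemma st_sopro_cong:
  assumes "\<And>j i. j < k \<Longrightarrow> G j i = G' j i" "\<And>j i. j < k \<Longrightarrow> H j i = H' j i"
  shows "st_sopro l dat W \<beta> D G H x0 q0 k = st_sopro l dat W \<beta> D G' H' x0 q0 k"
  using assms
proof (induction k)
  case (Suc k)
  have "st_sopro l dat W \<beta> D G H x0 q0 k = st_sopro l dat W \<beta> D G' H' x0 q0 k"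
    using Suc.prems by (intro Suc.IH) auto
  moreover have "G k = G' k" "H k = H' k"
    using Suc.prems by auto
  ultimately show ?case by (simp add: Let_def)
qed simp

lemma limsup_linear_recursion:
  fixes e :: "nat \<Rightarrow> real"
  assumes \<delta>: "0 < \<delta>" "\<delta> < 1" and step: "\<And>k. e (Suc k) \<le> (1 - \<delta>) * e k + b"
  shows "limsup (\<lambda>k. ereal (e k)) \<le> ereal (b / \<delta>)"
proof -
  \<comment> \<open>\<open>b / \<delta>\<close> is the fixed point of the recursion; the excess over
    it contracts by the factor \<open>1 - \<delta>\<close>.\<close>
  have bound: "e k \<le> b / \<delta> + (1 - \<delta>) ^ k * (e 0 - b / \<delta>)" for k
  proof (induction k)
    case (Suc k)
    have "e (Suc k) \<le> (1 - \<delta>) * (b / \<delta> + (1 - \<delta>) ^ k * (e 0 - b / \<delta>)) + b"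
      using Suc.IH \<delta> by (intro order_trans [OF step] add_right_mono mult_left_mono) auto
    also have "\<dots> = b / \<delta> + (1 - \<delta>) ^ Suc k * (e 0 - b / \<delta>)"
      using \<delta> by (simp add: field_simps)
    finally show ?case .
  qed simp
  have "(\<lambda>k. b / \<delta> + (1 - \<delta>) ^ k * (e 0 - b / \<delta>)) \<longlonglongrightarrow> b / \<delta> + 0 * (e 0 - b / \<delta>)"
    using \<delta> by (intro tendsto_intros LIMSEQ_realpow_zero) auto
  then have "(\<lambda>k. ereal (b / \<delta> + (1 - \<delta>) ^ k * (e 0 - b / \<delta>))) \<longlonglongrightarrow> ereal (b / \<delta>)"
    by simp
  then have lim: "limsup (\<lambda>k. ereal (b / \<delta> + (1 - \<delta>) ^ k * (e 0 - b / \<delta>))) = ereal (b / \<delta>)"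
    by (intro lim_imp_Limsup) auto
  show ?thesis
    unfolding lim [symmetric] by (intro Limsup_mono always_eventually allI) (use bound in simp)
qed

locale sopro_process =
  sopro E p l dat xopt mf Mi mi Di \<beta> \<eta> D Lm LM R \<kappa> + sampling_process \<Omega> G H nG nH
  for E :: "('n::finite \<times> 'n) set" and p :: "'n \<Rightarrow> 'n \<Rightarrow> real"
    and l :: "'n \<Rightarrow> 'c::finite \<Rightarrow> real^'d \<Rightarrow> real^'m \<Rightarrow> real"
    and dat :: "'n \<Rightarrow> 'c \<Rightarrow> real^'m"
    and xopt :: "real^'d" and mf :: real and Mi mi :: "'n \<Rightarrow> real"
    and Di :: "'n \<Rightarrow> real^'d^'d" and \<beta> \<eta> :: real
    and D Lm LM R :: "real^('n \<times> 'd)^('n \<times> 'd)" and \<kappa> :: "real \<Rightarrow> real"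
    and \<Omega> :: "'o measure" and G H :: "nat \<Rightarrow> 'n \<Rightarrow> 'o \<Rightarrow> 'c set"
    and nG :: nat and nH :: "nat \<Rightarrow> 'n \<Rightarrow> nat" +
  fixes x0 q0 :: "real^('n \<times> 'd)" and \<sigma> :: real
  assumes q0: "(\<Sum>i\<in>UNIV. component q0 i) = 0"
    and variance: "\<And>i x. sample_variance l dat i x \<le> \<sigma>\<^sup>2"
begin

definition iterate :: "nat \<Rightarrow> 'o \<Rightarrow> (real^('n \<times> 'd)) \<times> (real^('n \<times> 'd))" where
  "iterate k \<omega> = st_sopro l dat LL \<beta> D (\<lambda>k i. G k i \<omega>) (\<lambda>k i. H k i \<omega>) x0 q0 k"

definition X :: "nat \<Rightarrow> 'o \<Rightarrow> real^('n \<times> 'd)" where "X k \<omega> = fst (iterate k \<omega>)"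
definition Y :: "nat \<Rightarrow> 'o \<Rightarrow> real^('n \<times> 'd)" where "Y k \<omega> = snd (iterate k \<omega>)"

definition noise_i :: "'n \<Rightarrow> 'c set \<Rightarrow> real^'d \<Rightarrow> real^'d" where
  "noise_i i A x = sample_grad l dat A i x - gf i x"

definition noise :: "nat \<Rightarrow> 'o \<Rightarrow> real^('n \<times> 'd)" where
  "noise k \<omega> = stack (\<lambda>i. noise_i i (G k i \<omega>) (component (X k \<omega>) i))"

definition \<tau> :: real where "\<tau> = (real CARD('c) - real nG) / (real CARD('c) * real nG)"

lemma determined_iterate: "determined k (iterate k)"
  unfolding determined_def iterate_def by (intro allI impI st_sopro_cong) auto

lemma determined_X: "determined k (X k)"
  unfolding X_def by (rule determined_comp [OF determined_iterate])

text \<open>The noise of iteration \<open>k\<close> uses the sample drawn in that iteration, hence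
  the index \<open>Suc k\<close>.\<close>

lemma determined_noise: "determined (Suc k) (noise k)"
  unfolding noise_def
  by (rule determined_comp2 [OF determined_Suc [OF determined_X] determined_G,
      where h = "\<lambda>x A. stack (\<lambda>i. noise_i i (A i) (component x i))"])

lemma iterate_Suc:
  fixes k \<omega>
  defines "g \<equiv> stack (\<lambda>i. sample_grad l dat (G k i \<omega>) i (component (X k \<omega>) i))"
    and "h \<equiv> block_diag (\<lambda>i. sample_hess l dat (H k i \<omega>) i (component (X k \<omega>) i))"
  shows "X (Suc k) \<omega> = X k \<omega> - matrix_inv (h + D) *v (g + \<beta> *\<^sub>R (LL *v X k \<omega>) + Y k \<omega>)"
    and "Y (Suc k) \<omega> = Y k \<omega> + \<beta> *\<^sub>R (LL *v X (Suc k) \<omega>)"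
  by (simp_all add: X_def Y_def iterate_def g_def h_def Let_def split_beta)

lemma sum_component_Y: "(\<Sum>i\<in>UNIV. component (Y k \<omega>) i) = 0"
proof (induction k)
  case 0
  then show ?case by (simp add: Y_def iterate_def q0)
next
  case (Suc k)
  then show ?case
    by (simp add: iterate_Suc(2) sum.distrib scaleR_sum_right [symmetric] sum_component_L)
qed

lemma sample_hess_bounds:
  assumes "1 \<le> card A"
  shows "mi i *\<^sub>R mat 1 \<preceq>\<^sub>L sample_hess l dat A i x" "sample_hess l dat A i x \<preceq>\<^sub>L Mi i *\<^sub>R mat 1"
proof -
  let ?h = "\<lambda>j. hess (\<lambda>y. l i j y (dat i j)) x"
  let ?c = "1 / real (card A)"
  have h: "mi i *\<^sub>R mat 1 \<preceq>\<^sub>L ?h j" "?h j \<preceq>\<^sub>L Mi i *\<^sub>R mat 1" for j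
    using m_i by (auto simp: hessian_bounds_def)
  have mult: "sample_hess l dat A i x *v y = ?c *\<^sub>R (\<Sum>j\<in>A. ?h j *v y)" for y
    by (simp add: sample_hess_def scaleR_matrix_vector_assoc [symmetric] matrix_sum_mult_vec)
  have sym: "symmetric (sample_hess l dat A i x)"
    by (rule symmetricI)
      (simp add: mult inner_sum_left inner_sum_right symmetric_inner [OF loewner_between_symmetric [OF h(1)]])
  have quad: "quad (sample_hess l dat A i x) y = ?c * (\<Sum>j\<in>A. quad (?h j) y)" for y
    by (simp add: quad_def mult inner_sum_right)
  have "(\<Sum>j\<in>A. mi i * (norm y)\<^sup>2) \<le> (\<Sum>j\<in>A. quad (?h j) y)"
    "(\<Sum>j\<in>A. quad (?h j) y) \<le> (\<Sum>j\<in>A. Mi i * (norm y)\<^sup>2)" for y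
    by (intro sum_mono loewner_lower loewner_upper h)+
  then have "mi i * (norm y)\<^sup>2 \<le> quad (sample_hess l dat A i x) y"
    "quad (sample_hess l dat A i x) y \<le> Mi i * (norm y)\<^sup>2" for y
    using assms by (simp_all add: quad field_simps)
  then show "mi i *\<^sub>R mat 1 \<preceq>\<^sub>L sample_hess l dat A i x" "sample_hess l dat A i x \<preceq>\<^sub>L Mi i *\<^sub>R mat 1"
    unfolding loewner_le_def psd_def by (auto simp: quad_simps intro!: symmetric_intros sym)
qed

lemma noise_i_eq:
  assumes "1 \<le> card A"
  shows "noise_i i A x = (1 / real (card A)) *\<^sub>R (\<Sum>j\<in>A. gl i j x - gf i x)"
proof -
  have "(\<Sum>j\<in>A. gf i x) = real (card A) *\<^sub>R gf i x" by (rule sum_constant_scaleR)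
  then show ?thesis
    using assms by (cases "A = {}")
      (simp_all add: noise_i_def sample_grad_def sum_subtractf scaleR_diff_right del: sum_constant)
qed

lemma sum_centered: "(\<Sum>j\<in>UNIV. gl i j x - gf i x) = 0"
proof -
  have "(\<Sum>j\<in>(UNIV :: 'c set). gf i x) = real CARD('c) *\<^sub>R gf i x" by (rule sum_constant_scaleR)
  then show ?thesis by (simp add: sum_subtractf gf_eq del: sum_constant)
qed

lemma noise_i_mean: "(\<Sum>A | card A = nG. noise_i i A x) = 0"
proof -
  have "(\<Sum>A | card A = nG. noise_i i A x)
      = (\<Sum>A | card A = nG. (1 / real (card A)) *\<^sub>R (\<Sum>j\<in>A. gl i j x - gf i x))"
    using nG by (intro sum.cong refl noise_i_eq) auto
  then show ?thesis by (simp only: sample_mean [OF nG sum_centered])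
qed

lemma \<tau>_nonneg: "\<tau> \<ge> 0"
  using nG by (simp add: \<tau>_def)

lemma noise_i_second_moment:
  "(\<Sum>A | card A = nG. (norm (noise_i i A x))\<^sup>2) / real (CARD('c) choose nG) \<le> \<tau> * \<sigma>\<^sup>2"
proof -
  have "(\<Sum>A | card A = nG. (norm (noise_i i A x))\<^sup>2)
      = (\<Sum>A | card A = nG. (norm ((1 / real (card A)) *\<^sub>R (\<Sum>j\<in>A. gl i j x - gf i x)))\<^sup>2)"
    using nG by (intro sum.cong refl arg_cong [where f = "\<lambda>x. (norm x)\<^sup>2"] noise_i_eq) auto
  moreover have "sample_variance l dat i x = (\<Sum>j\<in>UNIV. (norm (gl i j x - gf i x))\<^sup>2) / (real CARD('c) - 1)"
    by (simp add: sample_variance_def gf_def)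
  ultimately have "(\<Sum>A | card A = nG. (norm (noise_i i A x))\<^sup>2) / real (CARD('c) choose nG)
      = \<tau> * sample_variance l dat i x"
    by (simp only: sample_second_moment [OF nG sum_centered] \<tau>_def)
  then show ?thesis
    using variance [of i x] \<tau>_nonneg by (simp add: mult_left_mono)
qed

text \<open>Agent by agent: the iterate is determined before the sample is drawn, and the noise sums
  to zero over all samples of the given size.\<close>

lemma expectation_inner_noise: "expectation (\<lambda>\<omega>. (X k \<omega> - xs) \<bullet> noise k \<omega>) = 0"
proof -
  let ?\<phi> = "\<lambda>i \<omega> A. component (X k \<omega> - xs) i \<bullet> noise_i i A (component (X k \<omega>) i)"
  have det: "determined k (?\<phi> i)" for i
    by (rule determined_comp [OF determined_X, where g = "\<lambda>x A. component (x - xs) i \<bullet> noise_i i A (component x i)"])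
  have int: "integrable \<Omega> (\<lambda>\<omega>. ?\<phi> i \<omega> (G k i \<omega>))" for i
  proof (rule integrable_determined [of "Suc k"])
    show "determined (Suc k) (\<lambda>\<omega>. ?\<phi> i \<omega> (G k i \<omega>))"
      by (rule determined_comp2 [OF determined_Suc [OF det] determined_G, where h = "\<lambda>f A. f (A i)"])
  qed
  have "(X k \<omega> - xs) \<bullet> noise k \<omega> = (\<Sum>i\<in>UNIV. ?\<phi> i \<omega> (G k i \<omega>))" for \<omega>
    by (simp add: inner_component noise_def)
  then have "expectation (\<lambda>\<omega>. (X k \<omega> - xs) \<bullet> noise k \<omega>) = (\<Sum>i\<in>UNIV. expectation (\<lambda>\<omega>. ?\<phi> i \<omega> (G k i \<omega>)))"
    using int by (simp only: Bochner_Integration.integral_sum)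
  also have "\<dots> = 0"
  proof (rule sum.neutral, rule ballI)
    fix i
    have "(\<Sum>A | card A = nG. ?\<phi> i \<omega> A) = 0" for \<omega>
      unfolding inner_sum_right [symmetric] noise_i_mean by simp
    then show "expectation (\<lambda>\<omega>. ?\<phi> i \<omega> (G k i \<omega>)) = 0"
      by (simp only: expectation_sample [OF det]) simp
  qed
  finally show ?thesis .
qed

lemma expectation_noise_squared:
  "expectation (\<lambda>\<omega>. (norm (noise k \<omega>))\<^sup>2) \<le> real CARD('n) * \<tau> * \<sigma>\<^sup>2"
proof -
  let ?\<phi> = "\<lambda>i \<omega> A. (norm (noise_i i A (component (X k \<omega>) i)))\<^sup>2"
  have det: "determined k (?\<phi> i)" for i
    by (rule determined_comp [OF determined_X, where g = "\<lambda>x A. (norm (noise_i i A (component x i)))\<^sup>2"])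
  have int: "integrable \<Omega> (\<lambda>\<omega>. ?\<phi> i \<omega> (G k i \<omega>))" for i
  proof (rule integrable_determined [of "Suc k"])
    show "determined (Suc k) (\<lambda>\<omega>. ?\<phi> i \<omega> (G k i \<omega>))"
      by (rule determined_comp2 [OF determined_Suc [OF det] determined_G, where h = "\<lambda>f A. f (A i)"])
  qed
  have "(norm (noise k \<omega>))\<^sup>2 = (\<Sum>i\<in>UNIV. ?\<phi> i \<omega> (G k i \<omega>))" for \<omega>
    by (simp add: norm_component noise_def)
  then have "expectation (\<lambda>\<omega>. (norm (noise k \<omega>))\<^sup>2) = (\<Sum>i\<in>UNIV. expectation (\<lambda>\<omega>. ?\<phi> i \<omega> (G k i \<omega>)))"
    using int by (simp only: Bochner_Integration.integral_sum)
  also have "\<dots> \<le> (\<Sum>i\<in>(UNIV :: 'n set). \<tau> * \<sigma>\<^sup>2)"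
  proof (rule sum_mono)
    fix i
    have "determined k (\<lambda>\<omega>. (\<Sum>A | card A = nG. ?\<phi> i \<omega> A) / real (CARD('c) choose nG))"
      by (rule determined_comp [OF det, where g = "\<lambda>f. (\<Sum>A | card A = nG. f A) / real (CARD('c) choose nG)"])
    then have "integrable \<Omega> (\<lambda>\<omega>. (\<Sum>A | card A = nG. ?\<phi> i \<omega> A) / real (CARD('c) choose nG))"
      by (rule integrable_determined)
    then show "expectation (\<lambda>\<omega>. ?\<phi> i \<omega> (G k i \<omega>)) \<le> \<tau> * \<sigma>\<^sup>2"
      unfolding expectation_sample [OF det]
      by (intro integral_le_const AE_I2 noise_i_second_moment)
  qed
  finally show ?thesis by (simp add: mult.assoc)
qed

definition err :: "nat \<Rightarrow> real" where "err k = expectation (\<lambda>\<omega>. V (X k \<omega>) (Y k \<omega>))"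

lemma err_step:
  assumes c: "0 < c0" "0 < c1" "0 < c2"
    and \<delta>: "0 \<le> \<delta>" "\<delta> * (2 * (1 + c1) * nLMD\<^sup>2) \<le> \<beta> * lamW * \<kappa> c0"
      "\<delta> * ((1 + 1 / c1) * (1 + c2)) \<le> 1 - \<eta>"
      "\<delta> * lmax c1 c2 \<le> 2 * \<eta> * mbeta \<beta> - c0"
  shows "err (Suc k) \<le> (1 - \<delta>) * err k + (2 * (1 + c1) * \<delta> / lamW + 2) * (real CARD('n) * \<tau> * \<sigma>\<^sup>2)"
proof -
  let ?\<Gamma> = "2 * (1 + c1) * \<delta> / lamW + 2"
  have \<Gamma>: "?\<Gamma> \<ge> 0" using c \<delta> lamW_pos by simp
  have detV: "determined k (\<lambda>\<omega>. V (X k \<omega>) (Y k \<omega>))" for k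
    unfolding X_def Y_def by (rule determined_comp [OF determined_iterate, where g = "\<lambda>z. V (fst z) (snd z)"])
  have det1: "determined (Suc k) (\<lambda>\<omega>. (X k \<omega> - xs) \<bullet> noise k \<omega>)"
    by (rule determined_comp2 [OF determined_Suc [OF determined_X] determined_noise,
        where h = "\<lambda>x e. (x - xs) \<bullet> e"])
  have det2: "determined (Suc k) (\<lambda>\<omega>. (norm (noise k \<omega>))\<^sup>2)"
    by (rule determined_comp [OF determined_noise])
  note int = integrable_determined [OF detV] integrable_determined [OF det1] integrable_determined [OF det2]
  have "err (Suc k) \<le> expectation (\<lambda>\<omega>. (1 - \<delta>) * V (X k \<omega>) (Y k \<omega>)
      - 2 * \<beta> * ((X k \<omega> - xs) \<bullet> noise k \<omega>) + ?\<Gamma> * (norm (noise k \<omega>))\<^sup>2)"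
    unfolding err_def
  proof (rule integral_mono_AE)
    show "AE \<omega> in \<Omega>. V (X (Suc k) \<omega>) (Y (Suc k) \<omega>) \<le> (1 - \<delta>) * V (X k \<omega>) (Y k \<omega>)
      - 2 * \<beta> * ((X k \<omega> - xs) \<bullet> noise k \<omega>) + ?\<Gamma> * (norm (noise k \<omega>))\<^sup>2"
      using AE_card_H [of k]
    proof eventually_elim
      case (elim \<omega>)
      show ?case
      proof (rule one_step [OF _ _ refl _ c iterate_Suc(1) iterate_Suc(2) _ \<delta>])
        show "noise k \<omega> = stack (\<lambda>i. sample_grad l dat (G k i \<omega>) i (component (X k \<omega>) i)) - F (X k \<omega>)"
          by (rule component_eqI) (simp add: noise_def noise_i_def F_def)
      qed (use elim sample_hess_bounds sum_component_Y in auto)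
    qed
  qed (use int in auto)
  also have "\<dots> = (1 - \<delta>) * err k - 2 * \<beta> * expectation (\<lambda>\<omega>. (X k \<omega> - xs) \<bullet> noise k \<omega>)
      + ?\<Gamma> * expectation (\<lambda>\<omega>. (norm (noise k \<omega>))\<^sup>2)"
    using int by (simp add: err_def)
  also have "\<dots> \<le> (1 - \<delta>) * err k + ?\<Gamma> * (real CARD('n) * \<tau> * \<sigma>\<^sup>2)"
    using \<Gamma> expectation_noise_squared by (simp only: expectation_inner_noise) (simp add: mult_left_mono)
  finally show ?thesis .
qed

definition dmin :: "real \<Rightarrow> real \<Rightarrow> real \<Rightarrow> real" where
  "dmin c0 c1 c2 = Min {\<beta> * lamW * \<kappa> c0 / (2 * (1 + c1) * nLMD\<^sup>2),
     (1 - \<eta>) / ((1 + 1 / c1) * (1 + c2)), (2 * \<eta> * mbeta \<beta> - c0) / lmax c1 c2}"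

definition dsup :: "real \<Rightarrow> real \<Rightarrow> real" where
  "dsup c0 c1 = (SUP c2\<in>{0<..}. dmin c0 c1 c2)"

lemma converges:
  assumes c: "0 < c0" "c0 < 2 * \<eta> * mbeta \<beta>" "\<kappa> c0 > 0" "c1 > 0"
  shows "converges_linearly_to_neighborhood err (dsup c0 c1) (2 * (1 + c1) * dsup c0 c1 / lamW + 2)
    (real CARD('n) * \<tau> * \<sigma>\<^sup>2)"
proof -
  define \<rho> where "\<rho> = real CARD('n) * \<tau> * \<sigma>\<^sup>2"
  have dmin_pos: "dmin c0 c1 c2 > 0" if "c2 > 0" for c2
    using c that \<eta> \<beta> lamW_pos nLMD_pos lmax_pos [OF c(4) that]
    by (auto simp: dmin_def intro!: divide_pos_pos mult_pos_pos add_pos_pos)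
  \<comment> \<open>The second entry lies below \<open>1 - \<eta>\<close> for every
    \<open>c2\<close>; this makes the supremum finite and less than 1.\<close>
  have dmin_le: "dmin c0 c1 c2 \<le> 1 - \<eta>" if "c2 > 0" for c2
  proof -
    have "dmin c0 c1 c2 \<le> (1 - \<eta>) / ((1 + 1 / c1) * (1 + c2))"
      unfolding dmin_def by (intro Min_le) auto
    also have "\<dots> \<le> (1 - \<eta>) / 1"
    proof (rule divide_left_mono)
      have "1 * 1 \<le> (1 + 1 / c1) * (1 + c2)" using c that by (intro mult_mono) auto
      then show "1 \<le> (1 + 1 / c1) * (1 + c2)" by simp
    qed (use \<eta> c that in \<open>auto intro!: mult_pos_pos add_pos_pos\<close>)
    finally show ?thesis by simp
  qed
  have bdd: "bdd_above (dmin c0 c1 ` {0<..})"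
    by (rule bdd_aboveI2 [where M = "1 - \<eta>"]) (use dmin_le in auto)
  have upper: "dmin c0 c1 c2 \<le> dsup c0 c1" if "c2 > 0" for c2
    unfolding dsup_def using that bdd by (intro cSUP_upper) auto
  have pos: "dsup c0 c1 > 0" using dmin_pos [of 1] upper [of 1] by simp
  have "dsup c0 c1 \<le> 1 - \<eta>" unfolding dsup_def by (rule cSUP_least) (use dmin_le in auto)
  then have lt1: "dsup c0 c1 < 1" using \<eta> by simp
  have step: "err (Suc k) \<le> (1 - dmin c0 c1 c2) * err k + (2 * (1 + c1) * dmin c0 c1 c2 / lamW + 2) * \<rho>"
    if c2: "c2 > 0" for k c2
    unfolding \<rho>_def
  proof (rule err_step [OF c(1,4) c2])
    let ?d = "dmin c0 c1 c2"
    have le: "?d \<le> \<beta> * lamW * \<kappa> c0 / (2 * (1 + c1) * nLMD\<^sup>2)" "?d \<le> (1 - \<eta>) / ((1 + 1 / c1) * (1 + c2))"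
      "?d \<le> (2 * \<eta> * mbeta \<beta> - c0) / lmax c1 c2"
      unfolding dmin_def by (intro Min_le; auto)+
    show "0 \<le> ?d" using dmin_pos [OF c2] by simp
    show "?d * (2 * (1 + c1) * nLMD\<^sup>2) \<le> \<beta> * lamW * \<kappa> c0"
      using le(1) c nLMD_pos by (subst (asm) pos_le_divide_eq) auto
    show "?d * ((1 + 1 / c1) * (1 + c2)) \<le> 1 - \<eta>"
      using le(2) c c2 by (subst (asm) pos_le_divide_eq) (auto intro!: mult_pos_pos add_pos_pos)
    show "?d * lmax c1 c2 \<le> 2 * \<eta> * mbeta \<beta> - c0"
      using le(3) lmax_pos [OF c(4) c2] by (subst (asm) pos_le_divide_eq) auto
  qed
  have "err (Suc k) \<le> (1 - dsup c0 c1) * err k + (2 * (1 + c1) * dsup c0 c1 / lamW + 2) * \<rho>" for k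
  proof -
    define a where "a = err k - 2 * (1 + c1) / lamW * \<rho>"
    define b where "b = err k + 2 * \<rho> - err (Suc k)"
    have ab: "dmin c0 c1 c2 * a \<le> b" if "c2 > 0" for c2
      using step [OF that, of k] by (simp add: a_def b_def algebra_simps)
    have "dsup c0 c1 * a \<le> b"
    \<comment> \<open>For positive \<open>a\<close> the bounds say that each \<open>dmin\<close> is
      at most \<open>b / a\<close>, and so is the supremum. Otherwise multiplication by
      \<open>a\<close> reverses order, and the bound at \<open>c2 = 1\<close> already implies the
      one at the supremum.\<close>
    proof (cases "a > 0")
      case True
      have "dsup c0 c1 \<le> b / a"
        unfolding dsup_def by (rule cSUP_least) (use ab True in \<open>auto simp: pos_le_divide_eq\<close>)
      then show ?thesis using True by (simp add: pos_le_divide_eq)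
    next
      case False
      then have "dsup c0 c1 * a \<le> dmin c0 c1 1 * a"
        using upper [of 1] by (intro mult_right_mono_neg) auto
      then show ?thesis using ab [of 1] by simp
    qed
    then show ?thesis by (simp add: a_def b_def algebra_simps)
  qed
  note rec = this
  have "2 * (1 + c1) * dsup c0 c1 / lamW + 2 > 0"
    using pos c lamW_pos by (intro add_nonneg_pos) auto
  moreover have "limsup (\<lambda>k. ereal (err k)) \<le> ereal ((2 * (1 + c1) * dsup c0 c1 / lamW + 2) * \<rho> / dsup c0 c1)"
    using pos lt1 rec by (rule limsup_linear_recursion)
  ultimately show ?thesis
    unfolding converges_linearly_to_neighborhood_def \<rho>_def [symmetric]
    using pos lt1 rec by (simp add: mult.commute)
qed

lemma \<kappa>_pos_exists: "\<exists>c0. 0 < c0 \<and> c0 < 2 * \<eta> * mbeta \<beta> \<and> \<kappa> c0 > 0"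
proof -
  define a where "a = 2 * \<eta> * mbeta \<beta>"
  have a: "a > 0" using \<eta> mbeta_pos [OF \<beta>] by (simp add: a_def)
  let ?B = "(LM - Lm) ** (LM - Lm)"
  let ?K = "\<lambda>c0. R - (1 / (2 * (1 - \<eta>))) *\<^sub>R LM - (1 / (4 * c0)) *\<^sub>R ?B
      + Lm - LM - \<beta> *\<^sub>R ((1/2) *\<^sub>R mat 1 + LL)"
  have sym: "symmetric (?K c0)" for c0 by (intro sym_intros sym_R)
  have "pd (?K a)"
    unfolding pd_def
  proof (intro conjI sym allI impI)
    fix x :: "real^('n \<times> 'd)" assume "x \<noteq> 0"
    from quad_D_gt [OF this] show "0 < quad (?K a) x"
      unfolding R_def quad_simps a_def by (simp add: field_simps)
  qed
  define \<mu> where "\<mu> = lambda_min (?K a)"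
  have m: "\<mu> > 0" unfolding \<mu>_def by (rule lambda_min_pos) fact
  \<comment> \<open>The maximum with 1 keeps \<open>b\<close> positive when
    \<open>LM = Lm\<close>.\<close>
  define b where "b = max 1 (lambda_max ?B)"
  have b: "b > 0" by (simp add: b_def)
  have symB: "symmetric ?B" by (intro sym_intros)
  \<comment> \<open>Moving from \<open>a\<close> to \<open>c\<close> subtracts
    \<open>(1 / c - 1 / a) / 4\<close> times \<open>?B\<close>. This choice makes the factor
    \<open>\<mu> / (2 * b)\<close>, so at most half of the least eigenvalue \<open>\<mu>\<close> is
    lost.\<close>
  define c where "c = 1 / (1 / a + 2 * \<mu> / b)"
  have inv: "1 / c = 1 / a + 2 * \<mu> / b" by (simp add: c_def)
  have den: "1 / a + 2 * \<mu> / b > 1 / a" "1 / a > 0" using a m b by auto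
  have c_pos: "c > 0" unfolding c_def by (rule divide_pos_pos) (use den in linarith)+
  have "c < 1 / (1 / a)" unfolding c_def
    using den by (intro divide_strict_left_mono mult_pos_pos) linarith+
  then have "c < a" by simp
  moreover have "pd (?K c)"
    unfolding pd_def
  proof (intro conjI sym allI impI)
    fix x :: "real^('n \<times> 'd)" assume x: "x \<noteq> 0"
    have B: "quad ?B x \<le> b * (norm x)\<^sup>2"
      using quad_le_lambda_max [OF symB, of x] mult_right_mono [of "lambda_max ?B" b "(norm x)\<^sup>2"]
      by (simp add: b_def)
    have "?K c = ?K a - ((1 / c - 1 / a) / 4) *\<^sub>R ?B"
      by (simp add: scaleR_diff_left diff_divide_distrib mult.commute)
    then have "quad (?K c) x = quad (?K a) x - (\<mu> / (2 * b)) * quad ?B x"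
      by (simp only: inv quad_simps) simp
    also have "\<dots> \<ge> \<mu> * (norm x)\<^sup>2 - (\<mu> / (2 * b)) * (b * (norm x)\<^sup>2)"
      using lambda_min_le_quad [OF sym, of a x, folded \<mu>_def] B m b by (intro diff_mono mult_left_mono) auto
    also have "\<mu> * (norm x)\<^sup>2 - (\<mu> / (2 * b)) * (b * (norm x)\<^sup>2)
        = \<mu> / 2 * (norm x)\<^sup>2"
      using b by (simp add: field_simps)
    finally have "\<mu> / 2 * (norm x)\<^sup>2 \<le> quad (?K c) x" .
    moreover have "\<mu> / 2 * (norm x)\<^sup>2 > 0" using m x by simp
    ultimately show "0 < quad (?K c) x" by linarith
  qed
  then have "\<kappa> c > 0" unfolding \<kappa>_def by (rule lambda_min_pos)
  ultimately show ?thesis using c_pos by (auto simp: a_def)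
qed

end

theorem theorem1:
  fixes l :: "'n::finite \<Rightarrow> 'c::finite \<Rightarrow> real^'d \<Rightarrow> real^'m \<Rightarrow> real"
    and S :: "'w measure" and \<xi> :: "'n \<Rightarrow> 'c \<Rightarrow> 'w \<Rightarrow> real^'m" and w :: 'w
    and dat :: "'n \<Rightarrow> 'c \<Rightarrow> real^'m"
    and E :: "('n \<times> 'n) set" and p :: "'n \<Rightarrow> 'n \<Rightarrow> real"
    and xopt :: "real^'d" and mf \<sigma> \<beta> :: real and mi Mi :: "'n \<Rightarrow> real"
    and Di :: "'n \<Rightarrow> real^'d^'d"
    and \<Omega> :: "'o measure" and G H :: "nat \<Rightarrow> 'n \<Rightarrow> 'o \<Rightarrow> 'c set"
    and nG :: nat and nH :: "nat \<Rightarrow> 'n \<Rightarrow> nat"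
    and x0 q0 vopt :: "real^('n \<times> 'd)" and x q v :: "nat \<Rightarrow> 'o \<Rightarrow> real^('n \<times> 'd)"
    and W D \<Lambda>m \<Lambda>M R :: "real^('n \<times> 'd)^('n \<times> 'd)"
    and Q :: "real^(('n \<times> 'd) + ('n \<times> 'd))^(('n \<times> 'd) + ('n \<times> 'd))"
    and lamW M N \<tau> m\<beta> \<eta> :: real and err :: "nat \<Rightarrow> real"
    and \<kappa> :: "real \<Rightarrow> real"
    and \<delta> :: "real \<Rightarrow> real \<Rightarrow> real" and \<Gamma> :: "real \<Rightarrow> real \<Rightarrow> real"
  assumes N_def: "N = real CARD('n)" and "CARD('n) \<ge> 2"
    and graph: "connected_graph E"
    and weights: "\<And>i j. (i, j) \<in> E \<Longrightarrow> p i j = p j i \<and> p i j > 0"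
    and W_def: "W = kronecker (weight_matrix E p) (mat 1)"
    and lamW_def: "lamW = lambda_min_nonzero W"
    and dat_def: "dat = (\<lambda>i j. \<xi> i j w)"
    and assumption1: "assumption1 l dat xopt mf Mi"
    and m_i: "hessian_bounds l mi Mi"
    and assumption2: "assumption2 S \<xi> w l \<sigma>"
    and sampling: "sampling \<Omega> G H nG nH"
    and \<tau>_def: "\<tau> = (real CARD('c) - real nG) / (real CARD('c) * real nG)"
    and \<Lambda>m_def: "\<Lambda>m = kronecker (diag mi) (mat 1)"
    and \<Lambda>M_def: "\<Lambda>M = kronecker (diag Mi) (mat 1)"
    and M_def: "M = Max (range Mi)"
    and \<beta>: "\<beta> > 0"
    and D_def: "D = block_diag Di" and D_sym: "\<And>i. symmetric (Di i)"
    and q0: "(\<Sum>i\<in>UNIV. component q0 i) = 0"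
    and x_def: "\<And>k \<omega>. x k \<omega> =
          fst (st_sopro l dat W \<beta> D (\<lambda>k i. G k i \<omega>) (\<lambda>k i. H k i \<omega>) x0 q0 k)"
    and q_def: "\<And>k \<omega>. q k \<omega> =
          snd (st_sopro l dat W \<beta> D (\<lambda>k i. G k i \<omega>) (\<lambda>k i. H k i \<omega>) x0 q0 k)"
    and m\<beta>_def: "m\<beta> = (SUP \<gamma>\<in>{0<..}.
          min (mf / N - 2 * M * \<gamma>) (\<beta> * (lamW / (2 * (1 + 1 / \<gamma>\<^sup>2)))))"
    and R_def: "R = (1/2) *\<^sub>R (\<Lambda>m + \<Lambda>M) + D"
    and Q_def: "Q = block_diag2 (\<beta> *\<^sub>R R) (mat 1)"
    and v_def: "\<And>k \<omega>. v k \<omega> = psd_sqrt (pseudoinverse W) *v q k \<omega>"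
    and vopt_def: "vopt = - (psd_sqrt (pseudoinverse W) *v grad (stacked_loss l dat) (stack (\<lambda>_. xopt)))"
    and err_def: "\<And>k. err k = prob_space.expectation \<Omega>
          (\<lambda>\<omega>. quad Q (vec_join (x k \<omega>) (v k \<omega>) - vec_join (stack (\<lambda>_. xopt)) vopt))"
    and \<eta>: "0 < \<eta>" "\<eta> < 1"
    and D_large: "(1 / (2 * (1 - \<eta>))) *\<^sub>R \<Lambda>M
          + (1 / (8 * \<eta> * m\<beta>)) *\<^sub>R ((\<Lambda>M - \<Lambda>m) ** (\<Lambda>M - \<Lambda>m))
          + (1/2) *\<^sub>R (\<Lambda>M - 3 *\<^sub>R \<Lambda>m) + \<beta> *\<^sub>R ((1/2) *\<^sub>R mat 1 + W) \<prec>\<^sub>L D"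
    and \<kappa>_def: "\<And>c0. \<kappa> c0 = lambda_min (R - (1 / (2 * (1 - \<eta>))) *\<^sub>R \<Lambda>M
          - (1 / (4 * c0)) *\<^sub>R ((\<Lambda>M - \<Lambda>m) ** (\<Lambda>M - \<Lambda>m))
          + \<Lambda>m - \<Lambda>M - \<beta> *\<^sub>R ((1/2) *\<^sub>R mat 1 + W))"
    and \<delta>_def: "\<And>c0 c1. \<delta> c0 c1 = (SUP c2\<in>{0<..}. Min {
          \<beta> * lamW * \<kappa> c0 / (2 * (1 + c1) * (spectral_norm (\<Lambda>M + D))\<^sup>2),
          (1 - \<eta>) / ((1 + 1 / c1) * (1 + c2)),
          (2 * \<eta> * m\<beta> - c0) / lambda_max (R +
             ((1 + 1 / c1) * (1 + 1 / c2) / (\<beta> * lamW)) *\<^sub>R (\<Lambda>M ** \<Lambda>M))})"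
    and \<Gamma>_def: "\<And>c0 c1. \<Gamma> c0 c1 = 2 * (1 + c1) * \<delta> c0 c1 / lamW + 2"
  shows "(\<exists>\<delta>s \<Gamma>s. converges_linearly_to_neighborhood err \<delta>s \<Gamma>s (N * \<tau> * \<sigma>\<^sup>2)) \<and>
    (\<exists>c0. 0 < c0 \<and> c0 < 2 * \<eta> * m\<beta> \<and> \<kappa> c0 > 0) \<and>
    (\<forall>c0 c1. 0 < c0 \<and> c0 < 2 * \<eta> * m\<beta> \<and> \<kappa> c0 > 0 \<and> c1 > 0 \<longrightarrow>
       converges_linearly_to_neighborhood err (\<delta> c0 c1) (\<Gamma> c0 c1) (N * \<tau> * \<sigma>\<^sup>2))"
proof -
  interpret C: consensus E p l dat xopt mf Mi
    using graph weights assumption1 \<open>CARD('n) \<ge> 2\<close> by unfold_locales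
  have W: "W = C.L" by (simp add: W_def)
  have lamW: "lamW = C.lamW" by (simp add: lamW_def C.lamW_def W)
  have M: "M = C.M" by (simp add: M_def C.M_def)
  have m\<beta>: "m\<beta> = C.mbeta \<beta>" by (simp add: m\<beta>_def C.mbeta_def lamW M N_def)
  \<comment> \<open>A second interpretation, because the condition on \<open>D\<close> must first be
    rewritten with \<open>C.mbeta\<close>, which the consensus locale provides.\<close>
  interpret S: sopro_process E p l dat xopt mf Mi mi Di \<beta> \<eta> D \<Lambda>m \<Lambda>M R \<kappa> \<Omega> G H nG nH x0 q0 \<sigma>
  proof (intro sopro_process.intro sopro.intro sopro_axioms.intro sampling_process.intro
      sampling_process_axioms.intro sopro_process_axioms.intro)
    show "consensus E p l dat xopt mf Mi" by (rule C.consensus_axioms)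
    show "prob_space \<Omega>" using sampling by (simp add: sampling_def)
    show "\<And>i x. sample_variance l dat i x \<le> \<sigma>\<^sup>2"
      using assumption2 by (simp add: assumption2_def dat_def)
  qed (use m_i \<beta> \<eta> D_def D_sym \<Lambda>m_def \<Lambda>M_def R_def \<kappa>_def D_large q0 sampling in \<open>simp_all add: W m\<beta>\<close>)
  have X: "x k \<omega> = S.X k \<omega>" "q k \<omega> = S.Y k \<omega>" for k \<omega>
    by (simp_all add: x_def q_def S.X_def S.Y_def S.iterate_def W)
  have err: "err = S.err"
  proof
    fix k
    have "quad Q (vec_join (x k \<omega>) (v k \<omega>) - vec_join (stack (\<lambda>_. xopt)) vopt) = S.V (S.X k \<omega>) (S.Y k \<omega>)" for \<omega>
    proof -
      have "v k \<omega> - vopt = psd_sqrt (pseudoinverse W) *v (S.Y k \<omega> + C.F C.xs)"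
        by (simp add: v_def vopt_def X C.grad_stacked_loss C.xs_def matrix_vector_right_distrib)
      then show ?thesis
        by (simp add: Q_def vec_join_diff quad_block_diag2 quad_scaleR quad_mat_1 W
            psd_pseudoinverse_sqrt_norm [OF C.psd_L'] S.V_def X C.xs_def)
    qed
    then show "err k = S.err k" by (simp only: err_def S.err_def)
  qed
  have \<delta>: "\<delta> c0 c1 = S.dsup c0 c1" for c0 c1
    by (simp add: \<delta>_def S.dsup_def S.dmin_def S.nLMD_def S.lmax_def lamW m\<beta>)
  have conv: "converges_linearly_to_neighborhood err (\<delta> c0 c1) (\<Gamma> c0 c1) (N * \<tau> * \<sigma>\<^sup>2)"
    if "0 < c0" "c0 < 2 * \<eta> * m\<beta>" "\<kappa> c0 > 0" "c1 > 0" for c0 c1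
    using S.converges [of c0 c1] that
    by (simp add: err \<delta> \<Gamma>_def lamW m\<beta> N_def \<tau>_def S.\<tau>_def)
  obtain c0 where c0: "0 < c0" "c0 < 2 * \<eta> * m\<beta>" "\<kappa> c0 > 0"
    using S.\<kappa>_pos_exists unfolding m\<beta> by blast
  show ?thesis
    \<comment> \<open>The existence claim takes \<open>c1 = 1\<close>.\<close>
    using c0 conv conv [OF c0 zero_less_one] by blast
qed

end
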